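(* Let $D$ be a commutative Dedekind domain with an automorphism $\sigma$ that acts trivially on the ideal class group $G(D)$, and let $R = D((x;\sigma))$ be the skew Laurent series ring. Then any two stably isomorphic finitely generated projective $R$-modules are isomorphic.
   Context: A commutative Dedekind domain is a commutative domain in which every nonzero ideal is invertible (fields are allowed). The skew Laurent series ring $D((x;\sigma))$ is the set of formal series $\sum_{i=k}^\infty a_i x^i$ with $k\in\mathbb Z$, $a_i\in D$, with termwise addition and multiplication determined by $x^i a=\sigma^i(a)x^i$ for $a\in D$, $i\in\mathbb Z$. We say $\sigma$ acts trivially on $G(D)$ if $\sigma(\mathfrak I)$ is isomorphic to $\mathfrak I$ as a $D$-module for every ideal $\mathfrak I$ of $D$. Modules are right modules; two right $R$-modules $M,N$ are stably isomorphic if $M\oplus R^n\simeq N\oplus R^n$ for some integer $n\ge 0$. *)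

theory Defs
  imports
    "HOL-Computational_Algebra.Formal_Laurent_Series"
    "HOL-Computational_Algebra.Fraction_Field"
    "HOL-Algebra.Ring"
begin

section \<open>Dedekind domains\<close>

text \<open>Ideals of a domain are its submodules, fractional ideals are certain submodules of its field
  of fractions; \<^term>\<open>module.subspace\<close> is the submodule predicate of the type-class based module
  library.\<close>

definition dom_ideal :: "'a::idom set \<Rightarrow> bool" where
  "dom_ideal I \<longleftrightarrow> module.subspace (*) I"

abbreviation to_frac :: "'a::idom \<Rightarrow> 'a fract" where
  "to_frac a \<equiv> Fraction_Field.Fract a 1"

abbreviation frac_scale :: "'a::idom \<Rightarrow> 'a fract \<Rightarrow> 'a fract" where
  "frac_scale a x \<equiv> to_frac a * x"

definition fractional_ideal :: "'a::idom fract set \<Rightarrow> bool" where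
  "fractional_ideal J \<longleftrightarrow>
     module.subspace frac_scale J \<and> (\<exists>d. d \<noteq> 0 \<and> (\<forall>x\<in>J. frac_scale d x \<in> range to_frac))"

definition fractional_ideal_prod :: "'a::idom fract set \<Rightarrow> 'a fract set \<Rightarrow> 'a fract set" where
  "fractional_ideal_prod I J = module.span frac_scale {x * y | x y. x \<in> I \<and> y \<in> J}"

definition invertible_ideal :: "'a::idom set \<Rightarrow> bool" where
  "invertible_ideal I \<longleftrightarrow>
     (\<exists>J. fractional_ideal J \<and> fractional_ideal_prod (to_frac ` I) J = range to_frac)"

definition dedekind_domain :: "'a::idom itself \<Rightarrow> bool" where
  "dedekind_domain _ \<longleftrightarrow> (\<forall>I :: 'a set. dom_ideal I \<and> I \<noteq> {0} \<longrightarrow> invertible_ideal I)"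


section \<open>Automorphisms\<close>

definition ring_automorphism :: "('a::idom \<Rightarrow> 'a) \<Rightarrow> bool" where
  "ring_automorphism \<sigma> \<longleftrightarrow> bij \<sigma> \<and> \<sigma> 1 = 1 \<and>
     (\<forall>a b. \<sigma> (a + b) = \<sigma> a + \<sigma> b) \<and> (\<forall>a b. \<sigma> (a * b) = \<sigma> a * \<sigma> b)"

definition ideals_isomorphic :: "'a::idom set \<Rightarrow> 'a set \<Rightarrow> bool" where
  "ideals_isomorphic I J \<longleftrightarrow>
     (\<exists>f. bij_betw f I J \<and> (\<forall>x\<in>I. \<forall>y\<in>I. f (x + y) = f x + f y) \<and> (\<forall>a. \<forall>x\<in>I. f (a * x) = a * f x))"

definition acts_trivially_on_class_group :: "('a::idom \<Rightarrow> 'a) \<Rightarrow> bool" where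
  "acts_trivially_on_class_group \<sigma> \<longleftrightarrow> (\<forall>I. dom_ideal I \<longrightarrow> ideals_isomorphic (\<sigma> ` I) I)"

definition aut_power :: "('a \<Rightarrow> 'a) \<Rightarrow> int \<Rightarrow> 'a \<Rightarrow> 'a" where
  "aut_power \<sigma> i = (if i \<ge> 0 then \<sigma> ^^ nat i else inv_into UNIV \<sigma> ^^ nat (- i))"


section \<open>Skew Laurent series\<close>

text \<open>Only the underlying additive group of \<^typ>\<open>'a fls\<close> is used. Since
  \<open>(a x\<^sup>i) (b x\<^sup>j) = a \<sigma>\<^sup>i(b) x\<^sup>i\<^sup>+\<^sup>j\<close>, the coefficient at \<open>n\<close> of \<open>f g\<close> is the sum of
  \<open>f\<^sub>i \<sigma>\<^sup>i(g\<^sub>n\<^sub>-\<^sub>i)\<close> over all \<open>i\<close>; outside the finite range below every term vanishes.\<close>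

definition skew_mult :: "('a::idom \<Rightarrow> 'a) \<Rightarrow> 'a fls \<Rightarrow> 'a fls \<Rightarrow> 'a fls" where
  "skew_mult \<sigma> f g = Abs_fls (\<lambda>n. \<Sum>i = fls_subdegree f..n - fls_subdegree g.
     fls_nth f i * aut_power \<sigma> i (fls_nth g (n - i)))"

definition skew_laurent :: "('a::idom \<Rightarrow> 'a) \<Rightarrow> 'a fls ring" where
  "skew_laurent \<sigma> = \<lparr>carrier = UNIV, mult = skew_mult \<sigma>, one = 1, zero = 0, add = (+)\<rparr>"


section \<open>Right modules\<close>

text \<open>As in \<open>HOL-Algebra\<close>, the fields \<^const>\<open>mult\<close> and \<^const>\<open>one\<close> of a module are irrelevant.\<close>

record ('r, 'm) rmodule = "'m ring" +
  ract :: "'m \<Rightarrow> 'r \<Rightarrow> 'm" (infixl "\<star>\<index>" 70)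

locale right_module = R?: ring R + M?: abelian_group M
  for R :: "('r, 'x) ring_scheme" (structure) and M :: "('r, 'm, 'y) rmodule_scheme" (structure) +
  assumes ract_closed: "\<lbrakk>x \<in> carrier M; a \<in> carrier R\<rbrakk> \<Longrightarrow> x \<star>\<^bsub>M\<^esub> a \<in> carrier M"
    and ract_add_left: "\<lbrakk>x \<in> carrier M; y \<in> carrier M; a \<in> carrier R\<rbrakk> \<Longrightarrow>
      (x \<oplus>\<^bsub>M\<^esub> y) \<star>\<^bsub>M\<^esub> a = x \<star>\<^bsub>M\<^esub> a \<oplus>\<^bsub>M\<^esub> y \<star>\<^bsub>M\<^esub> a"
    and ract_add_right: "\<lbrakk>x \<in> carrier M; a \<in> carrier R; b \<in> carrier R\<rbrakk> \<Longrightarrow>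
      x \<star>\<^bsub>M\<^esub> (a \<oplus>\<^bsub>R\<^esub> b) = x \<star>\<^bsub>M\<^esub> a \<oplus>\<^bsub>M\<^esub> x \<star>\<^bsub>M\<^esub> b"
    and ract_mult: "\<lbrakk>x \<in> carrier M; a \<in> carrier R; b \<in> carrier R\<rbrakk> \<Longrightarrow>
      x \<star>\<^bsub>M\<^esub> (a \<otimes>\<^bsub>R\<^esub> b) = (x \<star>\<^bsub>M\<^esub> a) \<star>\<^bsub>M\<^esub> b"
    and ract_one: "x \<in> carrier M \<Longrightarrow> x \<star>\<^bsub>M\<^esub> \<one>\<^bsub>R\<^esub> = x"

definition rmod_hom :: "('r, 'x) ring_scheme \<Rightarrow> ('r, 'm, 'y) rmodule_scheme \<Rightarrow>
    ('r, 'n, 'z) rmodule_scheme \<Rightarrow> ('m \<Rightarrow> 'n) set" where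
  "rmod_hom R M N = {f \<in> carrier M \<rightarrow> carrier N.
     (\<forall>x\<in>carrier M. \<forall>y\<in>carrier M. f (x \<oplus>\<^bsub>M\<^esub> y) = f x \<oplus>\<^bsub>N\<^esub> f y) \<and>
     (\<forall>x\<in>carrier M. \<forall>a\<in>carrier R. f (x \<star>\<^bsub>M\<^esub> a) = f x \<star>\<^bsub>N\<^esub> a)}"

definition rmod_isomorphic :: "('r, 'x) ring_scheme \<Rightarrow> ('r, 'm, 'y) rmodule_scheme \<Rightarrow>
    ('r, 'n, 'z) rmodule_scheme \<Rightarrow> bool" where
  "rmod_isomorphic R M N \<longleftrightarrow> (\<exists>f\<in>rmod_hom R M N. bij_betw f (carrier M) (carrier N))"

definition rmod_sum :: "('r, 'm, 'y) rmodule_scheme \<Rightarrow> ('r, 'n, 'z) rmodule_scheme \<Rightarrow>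
    ('r, 'm \<times> 'n) rmodule" where
  "rmod_sum M N = \<lparr>carrier = carrier M \<times> carrier N, mult = undefined, one = undefined,
     zero = (\<zero>\<^bsub>M\<^esub>, \<zero>\<^bsub>N\<^esub>),
     add = (\<lambda>(x, y) (x', y'). (x \<oplus>\<^bsub>M\<^esub> x', y \<oplus>\<^bsub>N\<^esub> y')),
     ract = (\<lambda>(x, y) a. (x \<star>\<^bsub>M\<^esub> a, y \<star>\<^bsub>N\<^esub> a))\<rparr>"

definition rmod_free :: "('r, 'x) ring_scheme \<Rightarrow> 'i set \<Rightarrow> ('r, 'i \<Rightarrow> 'r) rmodule" where
  "rmod_free R I = \<lparr>carrier = {v \<in> I \<rightarrow>\<^sub>E carrier R. finite {i \<in> I. v i \<noteq> \<zero>\<^bsub>R\<^esub>}},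
     mult = undefined, one = undefined,
     zero = (\<lambda>i\<in>I. \<zero>\<^bsub>R\<^esub>),
     add = (\<lambda>v w. \<lambda>i\<in>I. v i \<oplus>\<^bsub>R\<^esub> w i),
     ract = (\<lambda>v a. \<lambda>i\<in>I. v i \<otimes>\<^bsub>R\<^esub> a)\<rparr>"

definition rmod_finitely_generated ::
    "('r, 'x) ring_scheme \<Rightarrow> ('r, 'm, 'y) rmodule_scheme \<Rightarrow> bool" where
  "rmod_finitely_generated R M \<longleftrightarrow>
     (\<exists>S. finite S \<and> S \<subseteq> carrier M \<and>
       (\<forall>x\<in>carrier M. \<exists>a\<in>S \<rightarrow> carrier R. x = finsum M (\<lambda>s. s \<star>\<^bsub>M\<^esub> a s) S))"

text \<open>A module is projective if it is a direct summand of a free module. The types of the basis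
  \<open>I\<close> and of the complement \<open>Q\<close> are no restriction: a projective module \<open>P\<close> is a summand of the free
  module on the set \<open>carrier P\<close>, and the complement can be taken to be a submodule of it.\<close>

definition rmod_projective :: "('r, 'x) ring_scheme \<Rightarrow> ('r, 'm, 'y) rmodule_scheme \<Rightarrow> bool" where
  "rmod_projective R P \<longleftrightarrow>
     (\<exists>(I :: 'm set) (Q :: ('r, 'm \<Rightarrow> 'r) rmodule).
       right_module R Q \<and> rmod_isomorphic R (rmod_sum P Q) (rmod_free R I))"

definition rmod_stably_isomorphic :: "('r, 'x) ring_scheme \<Rightarrow> ('r, 'm, 'y) rmodule_scheme \<Rightarrow>
    ('r, 'n, 'z) rmodule_scheme \<Rightarrow> bool" where
  "rmod_stably_isomorphic R M N \<longleftrightarrow>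
     (\<exists>n::nat. rmod_isomorphic R (rmod_sum M (rmod_free R {..<n})) (rmod_sum N (rmod_free R {..<n})))"


section \<open>Basic facts\<close>

lemma aut_power_0 [simp]: "aut_power \<sigma> 0 = id"
  by (simp add: aut_power_def)

lemma aut_power_Suc:
  assumes "bij \<sigma>"
  shows "aut_power \<sigma> (i + 1) a = \<sigma> (aut_power \<sigma> i a)"
proof (cases "i \<ge> 0")
  case True
  then have "nat (i + 1) = Suc (nat i)" by linarith
  then show ?thesis using True by (simp add: aut_power_def)
next
  case False
  define k where "k = nat (- (i + 1))"
  have k: "nat (- i) = Suc k" using False unfolding k_def by linarith
  have "\<sigma> (inv_into UNIV \<sigma> x) = x" for x
    using assms by (simp add: bij_is_surj surj_f_inv_f)
  then have "\<sigma> (aut_power \<sigma> i a) = (inv_into UNIV \<sigma> ^^ k) a"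
    using False k by (simp add: aut_power_def)
  moreover have "aut_power \<sigma> (i + 1) a = (inv_into UNIV \<sigma> ^^ k) a"
    using False by (cases "i + 1 = 0") (auto simp: aut_power_def k_def)
  ultimately show ?thesis by simp
qed

lemma aut_power_induct:
  assumes "bij \<sigma>" and "P id"
    and "\<And>g. P g \<Longrightarrow> P (\<lambda>x. \<sigma> (g x))" and "\<And>g. P (\<lambda>x. \<sigma> (g x)) \<Longrightarrow> P g"
  shows "P (aut_power \<sigma> i)"
proof -
  have *: "aut_power \<sigma> (j + 1) = (\<lambda>x. \<sigma> (aut_power \<sigma> j x))" for j
    using aut_power_Suc[OF assms(1)] by blast
  show ?thesis
  proof (induction i rule: int_induct[where k = 0])
    case base
    have "aut_power \<sigma> 0 = id" by simp
    then show ?case using assms(2) by metis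
  next
    case (step1 i)
    then show ?case using assms(3) * by simp
  next
    case (step2 i)
    then show ?case using assms(4) *[of "i - 1"] by simp
  qed
qed

lemma aut_power_hom:
  assumes "ring_automorphism \<sigma>"
  shows aut_power_add: "aut_power \<sigma> i (a + b) = aut_power \<sigma> i a + aut_power \<sigma> i b"
    and aut_power_mult: "aut_power \<sigma> i (a * b) = aut_power \<sigma> i a * aut_power \<sigma> i b"
    and aut_power_one: "aut_power \<sigma> i 1 = 1"
    and aut_power_zero: "aut_power \<sigma> i 0 = 0"
proof -
  have bij: "bij \<sigma>" and h: "\<sigma> 1 = 1" "\<And>a b. \<sigma> (a + b) = \<sigma> a + \<sigma> b" "\<And>a b. \<sigma> (a * b) = \<sigma> a * \<sigma> b"
    using assms by (auto simp: ring_automorphism_def)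
  have inj: "\<sigma> x = \<sigma> y \<Longrightarrow> x = y" for x y
    using bij by (simp add: bij_is_inj inj_eq)
  show add: "aut_power \<sigma> i (a + b) = aut_power \<sigma> i a + aut_power \<sigma> i b" for a b
    by (rule aut_power_induct[OF bij, where P = "\<lambda>g. g (a + b) = g a + g b"])
       (simp_all add: h, rule inj, simp add: h)
  show "aut_power \<sigma> i (a * b) = aut_power \<sigma> i a * aut_power \<sigma> i b"
    by (rule aut_power_induct[OF bij, where P = "\<lambda>g. g (a * b) = g a * g b"])
       (simp_all add: h, rule inj, simp add: h)
  show "aut_power \<sigma> i 1 = 1"
    by (rule aut_power_induct[OF bij, where P = "\<lambda>g. g 1 = 1"])
       (simp_all add: h, rule inj, simp add: h)
  show "aut_power \<sigma> i 0 = 0"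
    using add[of 0 0] by (metis add.right_neutral add_left_cancel)
qed

lemma aut_power_add_exp:
  assumes "bij \<sigma>"
  shows "aut_power \<sigma> (i + j) a = aut_power \<sigma> i (aut_power \<sigma> j a)"
proof (induction i rule: int_induct[where k = 0])
  case base
  show ?case by simp
next
  case (step1 i)
  then show ?case
    using aut_power_Suc[OF assms, of "i + j"] aut_power_Suc[OF assms, of i] by (simp add: ac_simps)
next
  case (step2 i)
  have "\<sigma> (aut_power \<sigma> (i - 1 + j) a) = \<sigma> (aut_power \<sigma> (i - 1) (aut_power \<sigma> j a))"
    using step2 aut_power_Suc[OF assms, of "i - 1 + j"] aut_power_Suc[OF assms, of "i - 1"]
    by (simp add: algebra_simps)
  then show ?case using assms by (simp add: bij_is_inj inj_eq)
qed

lemma aut_power_sum: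
  assumes "ring_automorphism \<sigma>"
  shows "aut_power \<sigma> i (sum f A) = (\<Sum>k\<in>A. aut_power \<sigma> i (f k))"
  by (induction A rule: infinite_finite_induct)
     (simp_all add: aut_power_zero[OF assms] aut_power_add[OF assms])

lemma skew_mult_nth:
  "fls_nth (skew_mult \<sigma> f g) n =
     (\<Sum>i = fls_subdegree f..n - fls_subdegree g. fls_nth f i * aut_power \<sigma> i (fls_nth g (n - i)))"
  unfolding skew_mult_def
  by (rule nth_Abs_fls_ex_lower_bound)
     (rule exI[of _ "fls_subdegree f + fls_subdegree g"], auto)

lemma skew_mult_nth_wide:
  assumes "ring_automorphism \<sigma>"
    and "\<And>i. i < l \<Longrightarrow> fls_nth f i = 0" and "\<And>i. i > u \<Longrightarrow> fls_nth g (n - i) = 0"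
  shows "fls_nth (skew_mult \<sigma> f g) n =
     (\<Sum>i = l..u. fls_nth f i * aut_power \<sigma> i (fls_nth g (n - i)))"
proof -
  let ?t = "\<lambda>i. fls_nth f i * aut_power \<sigma> i (fls_nth g (n - i))"
  let ?l = "min l (fls_subdegree f)" and ?u = "max u (n - fls_subdegree g)"
  have z: "?t i = 0" if "i < fls_subdegree f \<or> i > n - fls_subdegree g \<or> i < l \<or> i > u" for i
    using that assms(2)[of i] assms(3)[of i] fls_eq0_below_subdegree[of i f]
      fls_eq0_below_subdegree[of "n - i" g] aut_power_zero[OF assms(1), of i]
    by (cases "i < fls_subdegree f \<or> i < l") auto
  have "sum ?t {fls_subdegree f..n - fls_subdegree g} = sum ?t {?l..?u}"
    by (rule sum.mono_neutral_left) (use z in \<open>force+\<close>)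
  also have "\<dots> = sum ?t {l..u}"
    by (rule sum.mono_neutral_right) (use z in \<open>force+\<close>)
  finally show ?thesis by (simp add: skew_mult_nth)
qed

lemma skew_mult_assoc:
  assumes "ring_automorphism \<sigma>"
  shows "skew_mult \<sigma> (skew_mult \<sigma> f g) h = skew_mult \<sigma> f (skew_mult \<sigma> g h)"
proof (rule fls_eqI)
  fix n
  define a b c where "a = fls_subdegree f" and "b = fls_subdegree g" and "c = fls_subdegree h"
  have bij: "bij \<sigma>" using assms by (simp add: ring_automorphism_def)
  have f0: "fls_nth f i = 0" if "i < a" for i using that by (simp add: a_def)
  have g0: "fls_nth g i = 0" if "i < b" for i using that by (simp add: b_def)
  have h0: "fls_nth h i = 0" if "i < c" for i using that by (simp add: c_def)
  have fg0: "fls_nth (skew_mult \<sigma> f g) i = 0" if "i < a + b" for i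
    using that by (simp add: skew_mult_nth a_def b_def)
  have gh0: "fls_nth (skew_mult \<sigma> g h) i = 0" if "i < b + c" for i
    using that by (simp add: skew_mult_nth b_def c_def)
  let ?I = "{a..n - b - c}" and ?K = "{a + b..n - c}"
  have "fls_nth (skew_mult \<sigma> (skew_mult \<sigma> f g) h) n =
      (\<Sum>k\<in>?K. fls_nth (skew_mult \<sigma> f g) k * aut_power \<sigma> k (fls_nth h (n - k)))"
    by (rule skew_mult_nth_wide[OF assms]) (auto intro: fg0 h0)
  also have "\<dots> = (\<Sum>k\<in>?K. \<Sum>i\<in>?I. fls_nth f i * aut_power \<sigma> i (fls_nth g (k - i))
      * aut_power \<sigma> k (fls_nth h (n - k)))"
  proof (rule sum.cong[OF refl])
    fix k assume k: "k \<in> ?K"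
    have "fls_nth (skew_mult \<sigma> f g) k = (\<Sum>i\<in>?I. fls_nth f i * aut_power \<sigma> i (fls_nth g (k - i)))"
      by (rule skew_mult_nth_wide[OF assms]) (use k in \<open>auto intro: f0 g0\<close>)
    then show "fls_nth (skew_mult \<sigma> f g) k * aut_power \<sigma> k (fls_nth h (n - k)) =
        (\<Sum>i\<in>?I. fls_nth f i * aut_power \<sigma> i (fls_nth g (k - i)) * aut_power \<sigma> k (fls_nth h (n - k)))"
      by (simp add: sum_distrib_right)
  qed
  also have "\<dots> = (\<Sum>i\<in>?I. \<Sum>k\<in>?K. fls_nth f i * aut_power \<sigma> i (fls_nth g (k - i))
      * aut_power \<sigma> k (fls_nth h (n - k)))"
    by (rule sum.swap)
  also have "\<dots> = (\<Sum>i\<in>?I. fls_nth f i * aut_power \<sigma> i (fls_nth (skew_mult \<sigma> g h) (n - i)))"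
  proof (rule sum.cong[OF refl])
    fix i assume i: "i \<in> ?I"
    have "fls_nth (skew_mult \<sigma> g h) (n - i) =
        (\<Sum>j = a + b - i..n - c - i. fls_nth g j * aut_power \<sigma> j (fls_nth h (n - i - j)))"
      by (rule skew_mult_nth_wide[OF assms]) (use i in \<open>auto intro: g0 h0\<close>)
    also have "\<dots> = (\<Sum>k\<in>?K. fls_nth g (k - i) * aut_power \<sigma> (k - i) (fls_nth h (n - k)))"
      by (rule sum.reindex_bij_witness[of _ "\<lambda>k. k - i" "\<lambda>j. j + i"]) (auto simp: algebra_simps)
    finally show "(\<Sum>k\<in>?K. fls_nth f i * aut_power \<sigma> i (fls_nth g (k - i))
          * aut_power \<sigma> k (fls_nth h (n - k))) =
        fls_nth f i * aut_power \<sigma> i (fls_nth (skew_mult \<sigma> g h) (n - i))"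
      using aut_power_add_exp[OF bij, of i, symmetric]
      by (simp add: aut_power_sum[OF assms] aut_power_mult[OF assms] sum_distrib_left mult.assoc)
  qed
  also have "\<dots> = fls_nth (skew_mult \<sigma> f (skew_mult \<sigma> g h)) n"
    by (rule skew_mult_nth_wide[OF assms, symmetric]) (auto intro: f0 gh0)
  finally show "fls_nth (skew_mult \<sigma> (skew_mult \<sigma> f g) h) n =
    fls_nth (skew_mult \<sigma> f (skew_mult \<sigma> g h)) n" .
qed

lemma skew_mult_distrib:
  assumes "ring_automorphism \<sigma>"
  shows "skew_mult \<sigma> (f + g) h = skew_mult \<sigma> f h + skew_mult \<sigma> g h"
    and "skew_mult \<sigma> h (f + g) = skew_mult \<sigma> h f + skew_mult \<sigma> h g"
proof -
  define l where "l = min (fls_subdegree f) (fls_subdegree g)"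
  have f0: "fls_nth f i = 0" and g0: "fls_nth g i = 0" if "i < l" for i
    using that by (auto simp: l_def)
  have h0: "fls_nth h i = 0" if "i < fls_subdegree h" for i using that by simp
  show "skew_mult \<sigma> (f + g) h = skew_mult \<sigma> f h + skew_mult \<sigma> g h"
  proof (rule fls_eqI)
    fix n
    show "fls_nth (skew_mult \<sigma> (f + g) h) n = fls_nth (skew_mult \<sigma> f h + skew_mult \<sigma> g h) n"
      using skew_mult_nth_wide[OF assms, of l _ "n - fls_subdegree h" h n] f0 g0 h0
      by (simp add: sum.distrib[symmetric] algebra_simps)
  qed
  show "skew_mult \<sigma> h (f + g) = skew_mult \<sigma> h f + skew_mult \<sigma> h g"
  proof (rule fls_eqI)
    fix n
    show "fls_nth (skew_mult \<sigma> h (f + g)) n = fls_nth (skew_mult \<sigma> h f + skew_mult \<sigma> h g) n"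
      using skew_mult_nth_wide[OF assms, of "fls_subdegree h" h "n - l" _ n] f0 g0 h0
      by (simp add: sum.distrib[symmetric] aut_power_add[OF assms] algebra_simps)
  qed
qed

lemma skew_mult_one:
  assumes "ring_automorphism \<sigma>"
  shows "skew_mult \<sigma> 1 f = f" and "skew_mult \<sigma> f 1 = f"
proof -
  show "skew_mult \<sigma> 1 f = f"
  proof (rule fls_eqI)
    fix n
    let ?u = "max 0 (n - fls_subdegree f)"
    have "fls_nth (skew_mult \<sigma> 1 f) n = (\<Sum>i = 0..?u. fls_nth 1 i * aut_power \<sigma> i (fls_nth f (n - i)))"
      by (rule skew_mult_nth_wide[OF assms]) auto
    also have "\<dots> = (\<Sum>i = 0..?u. if i = 0 then fls_nth f n else 0)"
      by (rule sum.cong) auto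
    finally show "fls_nth (skew_mult \<sigma> 1 f) n = fls_nth f n" by simp
  qed
  show "skew_mult \<sigma> f 1 = f"
  proof (rule fls_eqI)
    fix n
    let ?l = "min n (fls_subdegree f)"
    have "fls_nth (skew_mult \<sigma> f 1) n = (\<Sum>i = ?l..n. fls_nth f i * aut_power \<sigma> i (fls_nth 1 (n - i)))"
      by (rule skew_mult_nth_wide[OF assms]) auto
    also have "\<dots> = (\<Sum>i = ?l..n. if i = n then fls_nth f n else 0)"
      by (rule sum.cong) (auto simp: aut_power_one[OF assms] aut_power_zero[OF assms])
    finally show "fls_nth (skew_mult \<sigma> f 1) n = fls_nth f n" by simp
  qed
qed

lemma ring_skew_laurent:
  assumes "ring_automorphism \<sigma>"
  shows "ring (skew_laurent \<sigma>)"
proof (rule ringI)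
  show "abelian_group (skew_laurent \<sigma>)"
  proof (rule abelian_groupI)
    fix f assume "f \<in> carrier (skew_laurent \<sigma>)"
    show "\<exists>g\<in>carrier (skew_laurent \<sigma>). g \<oplus>\<^bsub>skew_laurent \<sigma>\<^esub> f = \<zero>\<^bsub>skew_laurent \<sigma>\<^esub>"
      by (rule bexI[of _ "- f"]) (simp_all add: skew_laurent_def)
  qed (simp_all add: skew_laurent_def ac_simps)
  show "Group.monoid (skew_laurent \<sigma>)"
    by (rule monoidI)
       (simp_all add: skew_laurent_def skew_mult_assoc[OF assms] skew_mult_one[OF assms])
qed (simp_all add: skew_laurent_def skew_mult_distrib[OF assms])

lemma right_module_rmod_sum:
  assumes "right_module R M" and "right_module R N"
  shows "right_module R (rmod_sum M N)"
proof -
  interpret M: right_module R M by fact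
  interpret N: right_module R N by fact
  have "abelian_group (rmod_sum M N)"
  proof (rule abelian_groupI)
    fix p assume p: "p \<in> carrier (rmod_sum M N)"
    show "\<exists>q\<in>carrier (rmod_sum M N). q \<oplus>\<^bsub>rmod_sum M N\<^esub> p = \<zero>\<^bsub>rmod_sum M N\<^esub>"
      by (rule bexI[of _ "(\<ominus>\<^bsub>M\<^esub> fst p, \<ominus>\<^bsub>N\<^esub> snd p)"])
         (use p in \<open>auto simp: rmod_sum_def M.M.l_neg N.M.l_neg\<close>)
  next
    fix p q assume "p \<in> carrier (rmod_sum M N)" "q \<in> carrier (rmod_sum M N)"
    then show "p \<oplus>\<^bsub>rmod_sum M N\<^esub> q = q \<oplus>\<^bsub>rmod_sum M N\<^esub> p"
      by (auto simp: rmod_sum_def M.M.add.m_comm N.M.add.m_comm)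
  qed (auto simp: rmod_sum_def M.M.add.m_assoc N.M.add.m_assoc)
  then show ?thesis
    by (intro right_module.intro M.R.ring_axioms right_module_axioms.intro)
       (auto simp: rmod_sum_def M.ract_closed N.ract_closed M.ract_add_left N.ract_add_left
         M.ract_add_right N.ract_add_right M.ract_mult N.ract_mult M.ract_one N.ract_one)
qed

lemma right_module_rmod_free:
  assumes "ring R"
  shows "right_module R (rmod_free R I)"
proof -
  interpret ring R by fact
  have fin: "finite {i \<in> I. u i \<noteq> \<zero>\<^bsub>R\<^esub>}"
    if "finite {i \<in> I. v i \<noteq> \<zero>\<^bsub>R\<^esub>}" "finite {i \<in> I. w i \<noteq> \<zero>\<^bsub>R\<^esub>}"
      "\<And>i. i \<in> I \<Longrightarrow> v i = \<zero>\<^bsub>R\<^esub> \<Longrightarrow> w i = \<zero>\<^bsub>R\<^esub> \<Longrightarrow> u i = \<zero>\<^bsub>R\<^esub>" for u v w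
    by (rule finite_subset[of _ "{i \<in> I. v i \<noteq> \<zero>\<^bsub>R\<^esub>} \<union> {i \<in> I. w i \<noteq> \<zero>\<^bsub>R\<^esub>}"]) (use that in auto)
  have closed_add: "v \<oplus>\<^bsub>rmod_free R I\<^esub> w \<in> carrier (rmod_free R I)"
    if "v \<in> carrier (rmod_free R I)" "w \<in> carrier (rmod_free R I)" for v w
    using that fin[of v w "\<lambda>i. v i \<oplus>\<^bsub>R\<^esub> w i"]
    by (auto simp: rmod_free_def PiE_iff extensional_def cong: conj_cong)
  have closed_act: "v \<star>\<^bsub>rmod_free R I\<^esub> a \<in> carrier (rmod_free R I)"
    if "v \<in> carrier (rmod_free R I)" "a \<in> carrier R" for v a
    using that fin[of v v "\<lambda>i. v i \<otimes>\<^bsub>R\<^esub> a"]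
    by (auto simp: rmod_free_def PiE_iff extensional_def cong: conj_cong)
  have "abelian_group (rmod_free R I)"
  proof (rule abelian_groupI)
    fix v assume v: "v \<in> carrier (rmod_free R I)"
    have "(\<lambda>i\<in>I. \<ominus>\<^bsub>R\<^esub> v i) \<in> carrier (rmod_free R I)"
      using v fin[of v v "\<lambda>i. \<ominus>\<^bsub>R\<^esub> v i"]
      by (auto simp: rmod_free_def PiE_iff extensional_def cong: conj_cong)
    then show "\<exists>w\<in>carrier (rmod_free R I). w \<oplus>\<^bsub>rmod_free R I\<^esub> v = \<zero>\<^bsub>rmod_free R I\<^esub>"
      by (rule bexI[rotated]) (use v in \<open>auto simp: rmod_free_def l_neg PiE_iff restrict_def\<close>)
  next
    fix v assume "v \<in> carrier (rmod_free R I)"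
    then show "\<zero>\<^bsub>rmod_free R I\<^esub> \<oplus>\<^bsub>rmod_free R I\<^esub> v = v"
      by (auto simp: rmod_free_def PiE_iff extensional_def fun_eq_iff)
  next
    fix v w assume "v \<in> carrier (rmod_free R I)" "w \<in> carrier (rmod_free R I)"
    then show "v \<oplus>\<^bsub>rmod_free R I\<^esub> w = w \<oplus>\<^bsub>rmod_free R I\<^esub> v"
      by (auto simp: rmod_free_def PiE_iff a_comm intro!: restrict_ext)
  next
    show "v \<oplus>\<^bsub>rmod_free R I\<^esub> w \<in> carrier (rmod_free R I)"
      if "v \<in> carrier (rmod_free R I)" "w \<in> carrier (rmod_free R I)" for v w
      by (rule closed_add[OF that])
  qed (auto simp: rmod_free_def PiE_iff a_assoc intro!: restrict_ext)
  then show ?thesis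
    by (intro right_module.intro ring_axioms right_module_axioms.intro closed_act)
       (auto simp: rmod_free_def PiE_iff l_distr r_distr m_assoc extensional_def fun_eq_iff)
qed

end

theory Submission
  imports Defs "HOL-Library.Function_Algebras" "Jordan_Normal_Form.Determinant"
begin

text \<open>Write \<open>R = D((x;\<sigma>))\<close> and \<open>L((x))\<close> for the series in \<open>R\<close> with all coefficients in an ideal
\<open>L\<close> of \<open>D\<close>; as a right \<open>R\<close>-module this is \<open>L\<close> extended from \<open>D\<close> to \<open>R\<close>. The theorem is reduced
to the corresponding statement about finitely generated projective \<open>D\<close>-modules, where it is
Steinitz' classification.

First, every nonzero right ideal of \<open>R\<close> is isomorphic to \<open>L((x))\<close>, where \<open>L\<close> is the ideal of \<open>D\<close>
formed by the leading coefficients (\<open>right_ideal_isomorphic_ser\<close>): since \<open>L\<close> is projective,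
leading coefficients can be lifted linearly, and the lifted elements generate because \<open>R\<close> is
complete for the order of series. Projecting a submodule of \<open>R\<^sup>k\<close> to one coordinate after the
other therefore splits it into summands \<open>L\<^sub>i((x))\<close> (\<open>submodule_of_free\<close>). So \<open>M\<close> comes from a
list of ideals of \<open>D\<close>, and so does \<open>M \<oplus> R\<^sup>n\<close>, with \<open>n\<close> copies of \<open>D\<close> appended.

The main point is that the list is determined by the \<open>R\<close>-module up to its length and the class
of the product of its ideals (\<open>isomorphic_dsum_serD\<close>). Let \<open>X\<close> be the direct sum of the
\<open>A\<^sub>i((x))\<close> and let \<open>F\<^sub>j \<subseteq> X\<close> consist of the vectors of order at least \<open>j\<close>. An isomorphism of \<open>X\<close>
with the sum of the \<open>B\<^sub>i((x))\<close> provides a second filtration \<open>G\<^sub>j\<close> of \<open>X\<close>. Right multiplication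
by \<open>x\<close> carries \<open>F\<^sub>j\<close> to \<open>F\<^sub>j\<^sub>+\<^sub>1\<close> and \<open>G\<^sub>j\<close> to \<open>G\<^sub>j\<^sub>+\<^sub>1\<close>, and some \<open>F\<^sub>m\<close> lies in \<open>G\<^sub>0\<close>. The
quotient \<open>Q = G\<^sub>0/F\<^sub>m\<close> is a submodule of some \<open>F\<^sub>a/F\<^sub>m\<close> and hence a projective \<open>D\<close>-module.
Refining \<open>G\<^sub>0/F\<^sub>m\<^sub>+\<^sub>1\<close> through \<open>F\<^sub>m\<close> and through \<open>G\<^sub>1\<close> shows that \<open>Q \<oplus> A\<^sub>1' \<oplus> \<dots> \<oplus> A\<^sub>r' \<cong> B\<^sub>1 \<oplus> \<dots>
\<oplus> B\<^sub>s \<oplus> Q'\<close>, where \<open>A\<^sub>i'\<close> and \<open>Q'\<close> are twists of \<open>A\<^sub>i\<close> and \<open>Q\<close> by powers of \<open>\<sigma>\<close>. By hypothesis a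
twist does not change the class of an ideal, so \<open>Q\<close> cancels from ranks and classes.

Over \<open>D\<close>, isomorphic direct sums have equal length and equivalent products because the
determinant of an isomorphism over the field of fractions carries one product to the other
(\<open>dsum_isoD\<close>), and the converse follows from \<open>I \<oplus> J \<cong> I J \<oplus> D\<close> (\<open>isomorphic_pair\<close>, \<open>dsum_isoI\<close>).
Applied to the lists of \<open>M\<close> and \<open>N\<close>, this yields a \<open>D\<close>-isomorphism that extends coefficientwise
to \<open>R\<close> (\<open>dsum_iso_ser\<close>).\<close>

section \<open>Modules over a noncommutative ring\<close>

text \<open>Submodules are sets, so a linear map is a function on the whole type whose values off \<open>U\<close>
are arbitrary.\<close>
definition linear_on ::
    "('b::plus \<Rightarrow> 'r \<Rightarrow> 'b) \<Rightarrow> ('c::plus \<Rightarrow> 'r \<Rightarrow> 'c) \<Rightarrow> 'b set \<Rightarrow> ('b \<Rightarrow> 'c) \<Rightarrow> bool" where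
  "linear_on act act' U f \<longleftrightarrow>
     (\<forall>u\<in>U. \<forall>v\<in>U. f (u + v) = f u + f v) \<and> (\<forall>u\<in>U. \<forall>a. f (act u a) = act' (f u) a)"

definition pointwise :: "('r \<Rightarrow> 's \<Rightarrow> 'r) \<Rightarrow> (nat \<Rightarrow> 'r) \<Rightarrow> 's \<Rightarrow> (nat \<Rightarrow> 'r)" where
  "pointwise act v a = (\<lambda>i. act (v i) a)"

definition submod :: "('b::monoid_add \<Rightarrow> 'r \<Rightarrow> 'b) \<Rightarrow> 'b set \<Rightarrow> bool" where
  "submod act U \<longleftrightarrow> 0 \<in> U \<and> (\<forall>u\<in>U. \<forall>v\<in>U. u + v \<in> U) \<and> (\<forall>u\<in>U. \<forall>a. act u a \<in> U)"

text \<open>Vectors are functions on all natural numbers that vanish beyond the length of the list: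
direct sums with different numbers of summands then live in one type.\<close>
definition dsum :: "'r::zero set list \<Rightarrow> (nat \<Rightarrow> 'r) set" where
  "dsum Is = {v. (\<forall>i < length Is. v i \<in> Is ! i) \<and> (\<forall>i \<ge> length Is. v i = 0)}"

definition single :: "nat \<Rightarrow> 'r::zero \<Rightarrow> nat \<Rightarrow> 'r" where
  "single i x = (\<lambda>j. if j = i then x else 0)"

text \<open>The dual basis criterion: for a right ideal it says that \<open>I\<close> is finitely generated and
projective.\<close>
definition has_dual_basis :: "('r::comm_monoid_add \<Rightarrow> 'r \<Rightarrow> 'r) \<Rightarrow> 'r set \<Rightarrow> bool" where
  "has_dual_basis mul I \<longleftrightarrow> (\<exists>(n::nat) a h. (\<forall>k<n. a k \<in> I \<and> linear_on mul mul I (h k)) \<and>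
     (\<forall>x\<in>I. x = (\<Sum>k<n. mul (a k) (h k x))))"

text \<open>A chain of submodules from \<open>U\<close> down to \<open>U'\<close> whose successive quotients are, from the top,
the right ideals in the list. Quotient modules never have to be formed: \<open>U/U'\<close> is described by
linear maps on \<open>U\<close> and their kernels.\<close>
inductive flag :: "('r::monoid_add \<Rightarrow> 's \<Rightarrow> 'r) \<Rightarrow> ('b::plus \<Rightarrow> 's \<Rightarrow> 'b) \<Rightarrow>
    'b set \<Rightarrow> 'b set \<Rightarrow> 'r set list \<Rightarrow> bool"
  for mul act where
  Nil: "flag mul act U U []"
| Cons: "\<lbrakk>linear_on act mul U f; f ` U = I; flag mul act {u \<in> U. f u = 0} U' Is\<rbrakk>
    \<Longrightarrow> flag mul act U U' (I # Is)"

lemma linear_onI: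
  assumes "\<And>u v. u \<in> U \<Longrightarrow> v \<in> U \<Longrightarrow> f (u + v) = f u + f v"
    and "\<And>u a. u \<in> U \<Longrightarrow> f (act u a) = act' (f u) a"
  shows "linear_on act act' U f"
  using assms by (simp add: linear_on_def)

lemma linear_onD:
  assumes "linear_on act act' U f"
  shows "u \<in> U \<Longrightarrow> v \<in> U \<Longrightarrow> f (u + v) = f u + f v"
    and "u \<in> U \<Longrightarrow> f (act u a) = act' (f u) a"
  using assms by (simp_all add: linear_on_def)

lemma linear_on_subset: "linear_on act act' U f \<Longrightarrow> V \<subseteq> U \<Longrightarrow> linear_on act act' V f"
  unfolding linear_on_def by blast

lemma linear_on_compose:
  assumes "linear_on act act' U f" "linear_on act' act'' V g" "f ` U \<subseteq> V"
  shows "linear_on act act'' U (\<lambda>u. g (f u))"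
proof (rule linear_onI)
  fix u v assume "u \<in> U" "v \<in> U"
  then show "g (f (u + v)) = g (f u) + g (f v)"
    using linear_onD(1)[OF assms(1)] linear_onD(1)[OF assms(2)] assms(3)
    by (metis image_subset_iff)
next
  fix u a assume "u \<in> U"
  then show "g (f (act u a)) = act'' (g (f u)) a"
    using linear_onD(2)[OF assms(1)] linear_onD(2)[OF assms(2)] assms(3)
    by (metis image_subset_iff)
qed

lemma linear_on_inv_into:
  assumes f: "linear_on act act' U f" and b: "bij_betw f U V" and U: "submod act U"
  shows "linear_on act' act V (inv_into U f)"
proof (rule linear_onI)
  have fi: "f (inv_into U f x) = x" "inv_into U f x \<in> U" if "x \<in> V" for x
    using that b by (auto simp: bij_betw_def f_inv_into_f inv_into_into)
  have if': "inv_into U f (f u) = u" if "u \<in> U" for u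
    using that b by (auto simp: bij_betw_def)
  fix u v assume uv: "u \<in> V" "v \<in> V"
  have "inv_into U f u + inv_into U f v \<in> U" using fi uv U by (auto simp: submod_def)
  from if'[OF this] show "inv_into U f (u + v) = inv_into U f u + inv_into U f v"
    using linear_onD(1)[OF f fi(2) fi(2)] fi uv by simp
next
  have fi: "f (inv_into U f x) = x" "inv_into U f x \<in> U" if "x \<in> V" for x
    using that b by (auto simp: bij_betw_def f_inv_into_f inv_into_into)
  have if': "inv_into U f (f u) = u" if "u \<in> U" for u
    using that b by (auto simp: bij_betw_def)
  fix u a assume u: "u \<in> V"
  have "act (inv_into U f u) a \<in> U" using fi u U by (auto simp: submod_def)
  from if'[OF this] show "inv_into U f (act' u a) = act (inv_into U f u) a"
    using linear_onD(2)[OF f fi(2)] fi u by simp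
qed

lemma submodD:
  assumes "submod act U"
  shows "0 \<in> U" and "u \<in> U \<Longrightarrow> v \<in> U \<Longrightarrow> u + v \<in> U" and "u \<in> U \<Longrightarrow> act u a \<in> U"
  using assms by (auto simp: submod_def)

lemma submod_sum:
  assumes "submod act U" "\<And>i. i \<in> A \<Longrightarrow> u i \<in> U"
  shows "sum u A \<in> U"
  using assms(2) by (induction A rule: infinite_finite_induct) (auto intro: submodD[OF assms(1)])

lemma dsum_Nil [simp]: "dsum [] = {0}"
  by (auto simp: dsum_def fun_eq_iff)

lemma dsum_Cons: "v \<in> dsum (I # Is) \<longleftrightarrow> v 0 \<in> I \<and> (\<lambda>i. v (Suc i)) \<in> dsum Is"
  by (auto simp: dsum_def nth_Cons split: nat.splits)
    (metis Suc_le_D Suc_le_mono)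

lemma case_nat_dsum [simp]: "case_nat x v \<in> dsum (I # Is) \<longleftrightarrow> x \<in> I \<and> v \<in> dsum Is"
  by (simp add: dsum_Cons)

lemma single_in_dsum:
  assumes "i < length Is" "x \<in> Is ! i" "\<And>I. I \<in> set Is \<Longrightarrow> 0 \<in> I"
  shows "single i x \<in> dsum Is"
  using assms by (auto simp: dsum_def single_def)

lemma sum_fun_apply [simp]: "(sum f A) i = (\<Sum>k\<in>A. f k i)" for f :: "'k \<Rightarrow> 'i \<Rightarrow> 'c::comm_monoid_add"
  by (induction A rule: infinite_finite_induct) auto

lemma dsum_eq_sum_single:
  fixes v :: "nat \<Rightarrow> 'r::comm_monoid_add"
  assumes "v \<in> dsum Is"
  shows "v = (\<Sum>i<length Is. single i (v i))"
proof
  fix j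
  show "v j = (\<Sum>i<length Is. single i (v i)) j"
    using assms by (cases "j < length Is") (auto simp: dsum_def single_def)
qed

text \<open>Right modules over a noncommutative ring whose carrier is a whole type. The same lemmas
serve the ring \<open>R\<close>, acting on itself and on vectors of series, and the ring \<open>D\<close>, acting on
vectors over \<open>D\<close> and on vectors of series.\<close>
locale module_action =
  fixes mul :: "'r::ab_group_add \<Rightarrow> 'r \<Rightarrow> 'r" and unit :: 'r
    and act :: "'b::ab_group_add \<Rightarrow> 'r \<Rightarrow> 'b"
  assumes mul_assoc: "mul (mul a b) c = mul a (mul b c)"
    and mul_add_left: "mul (a + b) c = mul a c + mul b c"
    and mul_add_right: "mul a (b + c) = mul a b + mul a c"
    and mul_unit_right: "mul a unit = a"
    and mul_unit_left: "mul unit a = a"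
    and act_add_left: "act (u + v) c = act u c + act v c"
    and act_add_right: "act u (b + c) = act u b + act u c"
    and act_mul: "act u (mul b c) = act (act u b) c"
    and act_unit: "act u unit = u"
begin

lemma act_zero_left [simp]: "act 0 a = 0"
  using act_add_left[of 0 0 a] by simp

lemma act_zero_right [simp]: "act u 0 = 0"
  using act_add_right[of u 0 0] by simp

lemma act_uminus_unit: "act u (- unit) = - u"
  using act_add_right[of u unit "- unit"] by (simp add: act_unit eq_neg_iff_add_eq_0 add.commute)

lemma act_diff_left: "act (u - v) a = act u a - act v a"
  using act_add_left[of "u - v" v a] by (simp add: algebra_simps)

lemma act_sum_left: "act (sum u A) a = (\<Sum>i\<in>A. act (u i) a)"
  by (induction A rule: infinite_finite_induct) (simp_all add: act_add_left)

lemma submod_uminus: "submod act U \<Longrightarrow> u \<in> U \<Longrightarrow> - u \<in> U"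
  using submodD(3)[of act U u "- unit"] by (simp add: act_uminus_unit)

lemma submod_diff: "submod act U \<Longrightarrow> u \<in> U \<Longrightarrow> v \<in> U \<Longrightarrow> u - v \<in> U"
  using submodD(2)[of act U u "- v"] submod_uminus by simp

lemma linear_on_zero: 
  fixes f :: "'b \<Rightarrow> 'c::group_add"
  assumes "linear_on act act' U f" "submod act U" shows "f 0 = 0"
proof -
  have "f 0 + f 0 = f 0 + 0"
    using linear_onD(1)[OF assms(1), of 0 0] submodD(1)[OF assms(2)] by simp
  then show ?thesis by (rule add_left_imp_eq)
qed

lemma linear_on_diff:
  fixes f :: "'b \<Rightarrow> 'c::group_add"
  assumes "linear_on act act' U f" "submod act U" "u \<in> U" "v \<in> U"
  shows "f (u - v) = f u - f v"
  using linear_onD(1)[OF assms(1) submod_diff[OF assms(2-4)] assms(4)] by (simp add: eq_diff_eq)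

lemma linear_on_sum:
  fixes f :: "'b \<Rightarrow> 'c::ab_group_add"
  assumes "linear_on act act' U f" "submod act U" "\<And>i. i \<in> A \<Longrightarrow> u i \<in> U"
  shows "f (sum u A) = (\<Sum>i\<in>A. f (u i))"
  using assms(3)
proof (induction A rule: infinite_finite_induct)
  case (insert i A)
  then show ?case
    using linear_onD(1)[OF assms(1), of "u i" "sum u A"] submod_sum[OF assms(2), of A u] by simp
qed (simp_all add: linear_on_zero[OF assms(1,2)])

lemma linear_on_inj:
  fixes f :: "'b \<Rightarrow> 'c::group_add"
  assumes "linear_on act act' U f" "submod act U" "\<And>u. u \<in> U \<Longrightarrow> f u = 0 \<Longrightarrow> u = 0"
  shows "inj_on f U"
proof (rule inj_onI)
  fix u v assume uv: "u \<in> U" "v \<in> U" "f u = f v"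
  then have "f (u - v) = 0" using linear_on_diff[OF assms(1,2)] by simp
  then have "u - v = 0" using assms(3) submod_diff[OF assms(2)] uv by blast
  then show "u = v" by simp
qed

lemma submod_kernel:
  assumes "linear_on act mul U f" "submod act U"
  shows "submod act {u \<in> U. f u = 0}"
proof -
  have "mul 0 a = 0" for a using mul_add_left[of 0 0 a] by simp
  then show ?thesis
    using linear_on_zero[OF assms] linear_onD[OF assms(1)] submodD[OF assms(2)]
    by (auto simp: submod_def)
qed

lemma submod_image:
  assumes "linear_on act mul U f" "submod act U"
  shows "submod mul (f ` U)"
  unfolding submod_def
proof (intro conjI ballI allI)
  show "0 \<in> f ` U" using linear_on_zero[OF assms] submodD(1)[OF assms(2)] by force
  fix x assume "x \<in> f ` U"
  then obtain u where u: "u \<in> U" "x = f u" by auto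
  show "mul x a \<in> f ` U" for a
    using u linear_onD(2)[OF assms(1) u(1), of a] submodD(3)[OF assms(2) u(1), of a]
    by (metis image_eqI)
  fix y assume "y \<in> f ` U"
  then obtain v where v: "v \<in> U" "y = f v" by auto
  show "x + y \<in> f ` U"
    using u v linear_onD(1)[OF assms(1) u(1) v(1)] submodD(2)[OF assms(2) u(1) v(1)]
    by (metis image_eqI)
qed

lemma flag_append:
  "flag mul act U U' Is \<Longrightarrow> flag mul act U' U'' Js \<Longrightarrow> flag mul act U U'' (Is @ Js)"
  by (induction rule: flag.induct) (auto intro: flag.intros)

text \<open>Intersecting the chain with \<open>V\<close> replaces each quotient by a right ideal contained in it.
The zero ideal can occur, and then the step is dropped.\<close>
lemma flag_submodule:
  assumes "flag mul act U U' Is" "submod act U" "submod act V" "U' \<subseteq> V" "V \<subseteq> U"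
  shows "\<exists>Js. flag mul act V U' Js \<and> (\<forall>J\<in>set Js. submod mul J \<and> J \<noteq> {0})"
  using assms
proof (induction arbitrary: V rule: flag.induct)
  case (Nil U)
  then have "V = U" by simp
  then show ?case using flag.Nil by (intro exI[of _ "[]"]) auto
next
  case (Cons U f I U' Is)
  have fV: "linear_on act mul V f" using Cons by (auto intro: linear_on_subset)
  let ?V = "{u \<in> V. f u = 0}"
  have sub: "submod act {u \<in> U. f u = 0}" "submod act ?V"
    using submod_kernel[OF Cons.hyps(1)] submod_kernel[OF fV] Cons.prems by auto
  have "U' \<subseteq> {u \<in> U. f u = 0}"
    using Cons.hyps(3)
  proof (induction "{u \<in> U. f u = 0}" U' Is arbitrary: U f rule: flag.induct)
    case (Cons g J U'' Js)
    then show ?case by blast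
  qed auto
  then obtain Js where Js: "flag mul act ?V U' Js" "\<forall>J\<in>set Js. submod mul J \<and> J \<noteq> {0}"
    using Cons.IH[OF sub] Cons.prems by blast
  show ?case
  proof (cases "f ` V = {0}")
    case True
    then have "?V = V" by auto
    then show ?thesis using Js by metis
  next
    case False
    have "flag mul act V U' (f ` V # Js)" by (rule flag.Cons[OF fV refl Js(1)])
    then show ?thesis using Js(2) False submod_image[OF fV] Cons.prems
      by (intro exI[of _ "f ` V # Js"]) auto
  qed
qed

text \<open>A surjection onto a projective right ideal splits: send the dual basis to preimages of the
generators.\<close>
lemma section_exists:
  assumes f: "linear_on act mul U f" and U: "submod act U" and I: "has_dual_basis mul (f ` U)"
  obtains s where "linear_on mul act (f ` U) s" "\<And>x. x \<in> f ` U \<Longrightarrow> s x \<in> U"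
    "\<And>x. x \<in> f ` U \<Longrightarrow> f (s x) = x"
proof -
  obtain n a h where ah: "\<And>k. k < (n::nat) \<Longrightarrow> a k \<in> f ` U"
      "\<And>k. k < n \<Longrightarrow> linear_on mul mul (f ` U) (h k)"
    and x: "\<And>x. x \<in> f ` U \<Longrightarrow> x = (\<Sum>k<n. mul (a k) (h k x))"
    using I unfolding has_dual_basis_def by blast
  define w where "w k = inv_into U f (a k)" for k
  have w: "w k \<in> U \<and> f (w k) = a k" if "k < n" for k
    unfolding w_def using ah(1)[OF that] by (simp add: f_inv_into_f inv_into_into)
  define s where "s x = (\<Sum>k<n. act (w k) (h k x))" for x
  have mem: "act (w k) b \<in> U" if "k < n" for k b using w[OF that] submodD(3)[OF U, of "w k" b]
    by simp
  show ?thesis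
  proof
    show "linear_on mul act (f ` U) s"
      by (rule linear_onI) (auto simp: s_def act_add_right act_sum_left act_mul sum.distrib
          linear_onD(1)[OF ah(2)] linear_onD(2)[OF ah(2)])
    show "s x \<in> U" for x unfolding s_def by (rule submod_sum[OF U]) (use mem in auto)
    show "f (s x) = x" if "x \<in> f ` U" for x
    proof -
      have "f (s x) = (\<Sum>k<n. f (act (w k) (h k x)))"
        unfolding s_def by (rule linear_on_sum[OF f U]) (use mem in auto)
      also have "\<dots> = (\<Sum>k<n. mul (a k) (h k x))"
        by (rule sum.cong) (use w linear_onD(2)[OF f] in auto)
      finally show ?thesis using x[OF that] by simp
    qed
  qed
qed

text \<open>If the quotients are projective then \<open>U/U'\<close> is their direct sum.\<close>
lemma flag_splits:
  assumes "flag mul act U U' Is" "submod act U" "\<And>I. I \<in> set Is \<Longrightarrow> has_dual_basis mul I"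
  shows "\<exists>f. linear_on act (pointwise mul) U f \<and> f ` U = dsum Is \<and> {u \<in> U. f u = 0} = U'"
  using assms
proof (induction rule: flag.induct)
  case (Nil U)
  have "mul 0 a = 0" for a using mul_add_left[of 0 0 a] by simp
  moreover have "(\<lambda>_. 0 :: nat \<Rightarrow> 'r) ` U = {0}"
    using submodD(1)[OF Nil(1)] by (simp add: image_constant_conv) blast
  ultimately show ?case
    by (intro exI[of _ "\<lambda>_. 0"]) (auto simp: linear_on_def pointwise_def fun_eq_iff)
next
  case (Cons U f I U' Is)
  let ?V = "{u \<in> U. f u = 0}"
  have "has_dual_basis mul (f ` U)" using Cons by auto
  then obtain s where s: "linear_on mul act I s" "\<And>x. x \<in> I \<Longrightarrow> s x \<in> U" "\<And>x. x \<in> I \<Longrightarrow> f (s x) = x"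
    using section_exists[OF Cons.hyps(1) Cons.prems(1)] Cons.hyps(2) by metis
  have V: "submod act ?V" using submod_kernel Cons by blast
  obtain g where g: "linear_on act (pointwise mul) ?V g" "g ` ?V = dsum Is" "{u \<in> ?V. g u = 0} = U'"
    using Cons.IH[OF V] Cons.prems(2) by (meson list.set_intros(2))
  have "0 \<in> I"
    using submodD(1)[OF submod_image[OF Cons.hyps(1) Cons.prems(1)]] Cons.hyps(2) by simp
  then have sI: "s 0 = 0" using linear_onD(1)[OF s(1), of 0 0] by simp
  define p where "p u = u - s (f u)" for u
  have fI: "f u \<in> I" if "u \<in> U" for u using that Cons.hyps(2) by auto
  have pV: "p u \<in> ?V" if "u \<in> U" for u
    using that s fI[OF that] submod_diff[OF Cons.prems(1)] linear_on_diff[OF Cons.hyps(1) Cons.prems(1)]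
    by (auto simp: p_def)
  have p: "linear_on act act U p"
    by (rule linear_onI) (auto simp: p_def linear_onD[OF Cons.hyps(1)] linear_onD[OF s(1)] fI act_diff_left)
  have gp: "linear_on act (pointwise mul) U (\<lambda>u. g (p u))"
    by (rule linear_on_compose[OF p g(1)]) (use pV in auto)
  define F where "F u = case_nat (f u) (g (p u))" for u
  have F: "linear_on act (pointwise mul) U F"
    by (rule linear_onI)
      (auto simp: F_def pointwise_def fun_eq_iff linear_onD[OF Cons.hyps(1)] linear_onD[OF gp] split: nat.splits)
  have gV: "g v \<in> dsum Is" if "v \<in> ?V" for v using that g(2) by blast
  have "F ` U = dsum (I # Is)"
  proof (intro equalityI subsetI)
    fix v assume "v \<in> F ` U"
    then show "v \<in> dsum (I # Is)" using fI pV gV unfolding F_def by fastforce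
  next
    fix v assume v: "v \<in> dsum (I # Is)"
    then have "(\<lambda>i. v (Suc i)) \<in> g ` ?V" unfolding g(2) by (simp add: dsum_Cons)
    then obtain w where w: "w \<in> ?V" "g w = (\<lambda>i. v (Suc i))" by fastforce
    have v0: "v 0 \<in> I" using v by (simp add: dsum_Cons)
    let ?u = "s (v 0) + w"
    have u: "?u \<in> U" using w s(2)[OF v0] submodD(2)[OF Cons.prems(1)] by simp
    have fu: "f ?u = v 0" using w s(2,3)[OF v0] linear_onD(1)[OF Cons.hyps(1)] by simp
    then have "F ?u = v" by (auto simp: F_def p_def w fun_eq_iff split: nat.splits)
    then show "v \<in> F ` U" using u by (metis image_eqI)
  qed
  moreover have "{u \<in> U. F u = 0} = U'"
  proof -
    have "F u = 0 \<longleftrightarrow> f u = 0 \<and> g u = 0" if "u \<in> U" for u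
    proof -
      have "F u = 0 \<longleftrightarrow> (\<forall>i. F u i = 0)" by (simp add: fun_eq_iff)
      also have "\<dots> \<longleftrightarrow> F u 0 = 0 \<and> (\<forall>i. F u (Suc i) = 0)" by (metis not0_implies_Suc)
      also have "\<dots> \<longleftrightarrow> f u = 0 \<and> g (p u) = 0" by (simp add: F_def fun_eq_iff)
      finally have "F u = 0 \<longleftrightarrow> f u = 0 \<and> g (p u) = 0" .
      then show ?thesis using sI by (auto simp: p_def)
    qed
    then show ?thesis using g(3) by auto
  qed
  ultimately show ?case using F by metis
qed

lemma flag_of_linear_surjection:
  assumes "linear_on act (pointwise mul) U f" "f ` U = dsum Is" "\<And>I. I \<in> set Is \<Longrightarrow> 0 \<in> I"
  shows "flag mul act U {u \<in> U. f u = 0} Is"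
  using assms
proof (induction Is arbitrary: U f)
  case Nil
  then have "{u \<in> U. f u = 0} = U" by auto
  then show ?case using flag.Nil by metis
next
  case (Cons I Is)
  let ?V = "{u \<in> U. f u 0 = 0}" and ?g = "\<lambda>u i. f u (Suc i)"
  have 1: "linear_on act mul U (\<lambda>u. f u 0)"
    by (rule linear_onI) (auto simp: linear_onD[OF Cons.prems(1)] pointwise_def)
  have Z: "0 \<in> dsum Is" using Cons.prems(3) by (auto simp: dsum_def)
  have 2: "(\<lambda>u. f u 0) ` U = I"
  proof (intro equalityI subsetI)
    fix x assume x: "x \<in> I"
    then have "case_nat x 0 \<in> dsum (I # Is)" using Z by simp
    then obtain u where "u \<in> U" "f u = case_nat x 0" using Cons.prems(2) by (metis imageE)
    then show "x \<in> (\<lambda>u. f u 0) ` U" by (intro image_eqI[of _ _ u]) auto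
  qed (use Cons.prems(2) dsum_Cons in blast)
  have 3: "linear_on act (pointwise mul) ?V ?g"
    by (rule linear_onI) (auto simp: linear_onD[OF Cons.prems(1)] pointwise_def)
  have 4: "?g ` ?V = dsum Is"
  proof (intro equalityI subsetI)
    fix v assume v: "v \<in> dsum Is"
    then have "case_nat 0 v \<in> dsum (I # Is)" using Cons.prems(3) by simp
    then obtain u where "u \<in> U" "f u = case_nat 0 v" using Cons.prems(2) by (metis imageE)
    then show "v \<in> ?g ` ?V" by (intro image_eqI[of _ _ u]) auto
  qed (use Cons.prems(2) dsum_Cons in blast)
  have 5: "{u \<in> ?V. ?g u = 0} = {u \<in> U. f u = 0}"
    by (auto simp: fun_eq_iff) (metis not0_implies_Suc)
  have "flag mul act ?V {u \<in> U. f u = 0} Is"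
    using Cons.IH[OF 3 4] Cons.prems(3) unfolding 5 by simp
  then show ?case by (rule flag.Cons[OF 1 2])
qed

end

definition isomorphic_submods ::
    "('b::plus \<Rightarrow> 'r \<Rightarrow> 'b) \<Rightarrow> ('c::plus \<Rightarrow> 'r \<Rightarrow> 'c) \<Rightarrow> 'b set \<Rightarrow> 'c set \<Rightarrow> bool" where
  "isomorphic_submods act act' U V \<longleftrightarrow> (\<exists>f. linear_on act act' U f \<and> bij_betw f U V)"

lemma isomorphic_submodsI:
  assumes "linear_on act act' U f" "\<And>u. u \<in> U \<Longrightarrow> f u \<in> V" "\<And>v. v \<in> V \<Longrightarrow> g v \<in> U"
    "\<And>u. u \<in> U \<Longrightarrow> g (f u) = u" "\<And>v. v \<in> V \<Longrightarrow> f (g v) = v"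
  shows "isomorphic_submods act act' U V"
  unfolding isomorphic_submods_def
proof (intro exI conjI)
  show "linear_on act act' U f" by fact
  show "bij_betw f U V" by (rule bij_betw_byWitness[where f' = g]) (use assms in auto)
qed

lemma isomorphic_submods_refl: "isomorphic_submods act act U U"
  by (rule isomorphic_submodsI[where f = "\<lambda>u. u" and g = "\<lambda>u. u"]) (auto simp: linear_on_def)

lemma isomorphic_submods_trans:
  assumes "isomorphic_submods act act' U V" "isomorphic_submods act' act'' V W"
  shows "isomorphic_submods act act'' U W"
proof -
  obtain f g where f: "linear_on act act' U f" "bij_betw f U V" 
    and g: "linear_on act' act'' V g" "bij_betw g V W"
    using assms by (auto simp: isomorphic_submods_def)
  have "linear_on act act'' U (\<lambda>u. g (f u))"
    by (rule linear_on_compose[OF f(1) g(1)]) (use f(2) in \<open>auto simp: bij_betw_def\<close>)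
  moreover have "bij_betw (\<lambda>u. g (f u)) U W"
    using bij_betw_trans[OF f(2) g(2)] by (simp add: comp_def)
  ultimately show ?thesis by (auto simp: isomorphic_submods_def)
qed

lemma isomorphic_submods_sym:
  assumes "isomorphic_submods act act' U V" "submod act U"
  shows "isomorphic_submods act' act V U"
proof -
  obtain f where f: "linear_on act act' U f" "bij_betw f U V"
    using assms(1) by (auto simp: isomorphic_submods_def)
  then show ?thesis
    using linear_on_inv_into[OF f assms(2)] bij_betw_inv_into[OF f(2)]
    by (auto simp: isomorphic_submods_def)
qed

lemma submod_dsum:
  assumes "\<And>I. I \<in> set Is \<Longrightarrow> submod mul I" "\<And>a. mul 0 a = 0"
  shows "submod (pointwise mul) (dsum Is)"
  using assms by (auto simp: submod_def dsum_def pointwise_def)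

lemma isomorphic_submodsE:
  assumes "isomorphic_submods act act' U V"
  obtains f g where "linear_on act act' U f" "\<And>u. u \<in> U \<Longrightarrow> f u \<in> V" "\<And>v. v \<in> V \<Longrightarrow> g v \<in> U"
    "\<And>u. u \<in> U \<Longrightarrow> g (f u) = u" "\<And>v. v \<in> V \<Longrightarrow> f (g v) = v"
proof -
  obtain f where f: "linear_on act act' U f" "bij_betw f U V"
    using assms by (auto simp: isomorphic_submods_def)
  show ?thesis
    by (rule that[of f "inv_into U f", OF f(1)])
      (use f(2) in \<open>auto simp: bij_betw_def f_inv_into_f inv_into_into\<close>)
qed

lemma isomorphic_dsum_Cons:
  fixes mul :: "'r::monoid_add \<Rightarrow> 'r \<Rightarrow> 'r"
  assumes "isomorphic_submods mul mul I J"
    and "isomorphic_submods (pointwise mul) (pointwise mul) (dsum Is) (dsum Js)"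
  shows "isomorphic_submods (pointwise mul) (pointwise mul) (dsum (I # Is)) (dsum (J # Js))"
proof -
  obtain f g where f: "linear_on mul mul I f" "\<And>u. u \<in> I \<Longrightarrow> f u \<in> J" "\<And>v. v \<in> J \<Longrightarrow> g v \<in> I"
    "\<And>u. u \<in> I \<Longrightarrow> g (f u) = u" "\<And>v. v \<in> J \<Longrightarrow> f (g v) = v"
    using assms(1) by (rule isomorphic_submodsE) blast
  obtain h k where h: "linear_on (pointwise mul) (pointwise mul) (dsum Is) h"
    "\<And>u. u \<in> dsum Is \<Longrightarrow> h u \<in> dsum Js" "\<And>v. v \<in> dsum Js \<Longrightarrow> k v \<in> dsum Is"
    "\<And>u. u \<in> dsum Is \<Longrightarrow> k (h u) = u" "\<And>v. v \<in> dsum Js \<Longrightarrow> h (k v) = v"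
    using assms(2) by (rule isomorphic_submodsE) blast
  have tail: "(\<lambda>i. (u + v) (Suc i)) = (\<lambda>i. u (Suc i)) + (\<lambda>i. v (Suc i))"
    "(\<lambda>i. pointwise mul u a (Suc i)) = pointwise mul (\<lambda>i. u (Suc i)) a" for u v :: "nat \<Rightarrow> 'r" and a
    by (auto simp: pointwise_def fun_eq_iff)
  define F where "F v = case_nat (f (v 0)) (h (\<lambda>i. v (Suc i)))" for v
  define G where "G v = case_nat (g (v 0)) (k (\<lambda>i. v (Suc i)))" for v
  have "linear_on (pointwise mul) (pointwise mul) (dsum (I # Is)) F"
  proof (rule linear_onI)
    fix u v assume "u \<in> dsum (I # Is)" "v \<in> dsum (I # Is)"
    then show "F (u + v) = F u + F v"
      unfolding F_def tail using linear_onD(1)[OF f(1)] linear_onD(1)[OF h(1)]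
      by (simp add: dsum_Cons) (simp add: fun_eq_iff split: nat.split)
  next
    fix u a assume "u \<in> dsum (I # Is)"
    then show "F (pointwise mul u a) = pointwise mul (F u) a"
      unfolding F_def tail using linear_onD(2)[OF f(1)] linear_onD(2)[OF h(1)]
      by (simp add: dsum_Cons) (simp add: fun_eq_iff pointwise_def split: nat.split)
  qed
  moreover have "F u \<in> dsum (J # Js)" "G (F u) = u" if "u \<in> dsum (I # Is)" for u
    using that f h by (simp_all add: F_def G_def dsum_Cons fun_eq_iff split: nat.split)
  moreover have "G u \<in> dsum (I # Is)" "F (G u) = u" if "u \<in> dsum (J # Js)" for u
    using that f h by (simp_all add: F_def G_def dsum_Cons fun_eq_iff split: nat.split)
  ultimately show ?thesis by (intro isomorphic_submodsI[where f = F and g = G])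
qed

text \<open>Both direct sums are isomorphic to \<open>U/U'\<close>.\<close>
lemma (in module_action) flags_isomorphic:
  assumes U: "submod act U" and I: "flag mul act U U' Is" "\<And>I. I \<in> set Is \<Longrightarrow> has_dual_basis mul I"
    and J: "flag mul act U U' Js" "\<And>J. J \<in> set Js \<Longrightarrow> has_dual_basis mul J"
  shows "isomorphic_submods (pointwise mul) (pointwise mul) (dsum Is) (dsum Js)"
proof -
  obtain f where f: "linear_on act (pointwise mul) U f" "f ` U = dsum Is" "{u \<in> U. f u = 0} = U'"
    using flag_splits[OF I(1) U I(2)] by blast
  obtain g where g: "linear_on act (pointwise mul) U g" "g ` U = dsum Js" "{u \<in> U. g u = 0} = U'"
    using flag_splits[OF J(1) U J(2)] by blast
  have fg: "f u = f v \<longleftrightarrow> g u = g v" if uv: "u \<in> U" "v \<in> U" for u v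
  proof -
    have d: "u - v \<in> U" by (rule submod_diff[OF U uv])
    have "f u = f v \<longleftrightarrow> f (u - v) = 0" by (simp add: linear_on_diff[OF f(1) U uv])
    also have "\<dots> \<longleftrightarrow> u - v \<in> U'" using f(3) d by blast
    also have "\<dots> \<longleftrightarrow> g (u - v) = 0" using g(3) d by blast
    also have "\<dots> \<longleftrightarrow> g u = g v" by (simp add: linear_on_diff[OF g(1) U uv])
    finally show ?thesis .
  qed
  define f' where "f' = inv_into U f"
  define g' where "g' = inv_into U g"
  have f': "f' x \<in> U" "f (f' x) = x" if "x \<in> dsum Is" for x
    using that unfolding f'_def f(2)[symmetric] by (auto simp: f_inv_into_f inv_into_into)
  have g': "g' x \<in> U" "g (g' x) = x" if "x \<in> dsum Js" for x
    using that unfolding g'_def g(2)[symmetric] by (auto simp: f_inv_into_f inv_into_into)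
  have gf': "g (f' x) = g u" if "u \<in> U" "f u = x" for u x
  proof -
    have "x \<in> dsum Is" using that f(2) by blast
    then have "f (f' x) = f u" using f'(2) that(2) by simp
    then show ?thesis using fg[OF f'(1) that(1)] \<open>x \<in> dsum Is\<close> by blast
  qed
  have fg': "f (g' x) = f u" if "u \<in> U" "g u = x" for u x
  proof -
    have "x \<in> dsum Js" using that g(2) by blast
    then have "g (g' x) = g u" using g'(2) that(2) by simp
    then show ?thesis using fg[OF g'(1) that(1)] \<open>x \<in> dsum Js\<close> by blast
  qed
  show ?thesis
  proof (rule isomorphic_submodsI[where f = "\<lambda>x. g (f' x)" and g = "\<lambda>x. f (g' x)"])
    show "linear_on (pointwise mul) (pointwise mul) (dsum Is) (\<lambda>x. g (f' x))"
    proof (rule linear_onI)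
      fix x y assume xy: "x \<in> dsum Is" "y \<in> dsum Is"
      have "f' x + f' y \<in> U" "f (f' x + f' y) = x + y"
        using f' xy submodD(2)[OF U] by (simp_all add: linear_onD(1)[OF f(1)])
      from gf'[OF this] show "g (f' (x + y)) = g (f' x) + g (f' y)"
        using f' xy by (simp add: linear_onD(1)[OF g(1)])
    next
      fix x a assume x: "x \<in> dsum Is"
      have "act (f' x) a \<in> U" "f (act (f' x) a) = pointwise mul x a"
        using f' x submodD(3)[OF U] by (simp_all add: linear_onD(2)[OF f(1)])
      from gf'[OF this] show "g (f' (pointwise mul x a)) = pointwise mul (g (f' x)) a"
        using f' x by (simp add: linear_onD(2)[OF g(1)])
    qed
    show "g (f' x) \<in> dsum Js" if "x \<in> dsum Is" for x using f'(1)[OF that] g(2) by blast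
    show "f (g' x) \<in> dsum Is" if "x \<in> dsum Js" for x using g'(1)[OF that] f(2) by blast
    show "f (g' (g (f' x))) = x" if "x \<in> dsum Is" for x
      using fg'[OF f'(1)[OF that] refl] f'(2)[OF that] by simp
    show "g (f' (f (g' x))) = x" if "x \<in> dsum Js" for x
      using gf'[OF g'(1)[OF that] refl] g'(2)[OF that] by simp
  qed
qed

section \<open>Ideals of a Dedekind domain\<close>

lemma submod_mult_iff_dom_ideal: "dom_ideal I \<longleftrightarrow> submod (*) I"
proof -
  have "Modules.module ((*) :: 'a \<Rightarrow> 'a \<Rightarrow> 'a::idom)" by unfold_locales (auto simp: algebra_simps)
  from Modules.module.subspace_def[OF this] show ?thesis
    by (simp add: dom_ideal_def submod_def) (metis mult.commute)
qed

lemma to_frac_simps: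
  "to_frac (a + b) = to_frac a + to_frac b" "to_frac (a * b) = to_frac a * to_frac b"
  "to_frac 0 = 0" "to_frac 1 = 1" "to_frac (- a) = - to_frac a"
  "to_frac a = to_frac b \<longleftrightarrow> a = b" "to_frac a = 0 \<longleftrightarrow> a = 0"
  by (simp_all add: eq_fract Zero_fract_def One_fract_def)

lemma to_frac_sum: "to_frac (sum f A) = (\<Sum>i\<in>A. to_frac (f i))"
  by (induction A rule: infinite_finite_induct) (simp_all add: to_frac_simps(1,3) del: add_fract)

lemma to_frac_prod: "to_frac (prod f A) = (\<Prod>i\<in>A. to_frac (f i))"
  by (induction A rule: infinite_finite_induct) (simp_all add: to_frac_simps(2,4) del: mult_fract)

lemma module_frac_scale: "Modules.module (frac_scale :: 'a::idom \<Rightarrow> 'a fract \<Rightarrow> 'a fract)"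
  by unfold_locales (simp_all only: to_frac_simps distrib_left distrib_right mult.assoc mult_1_left)

text \<open>The products \<open>x y\<close> span the product ideal over \<open>D\<close>; if \<open>I\<close> absorbs scalars, the
coefficients can be moved into the first factors.\<close>
lemma fractional_ideal_prod_sum:
  assumes "z \<in> fractional_ideal_prod I J"
    and "\<And>(c::'a::idom) x. x \<in> I \<Longrightarrow> frac_scale c x \<in> I"
  shows "\<exists>(n::nat) x y. (\<forall>k<n. x k \<in> I \<and> y k \<in> J) \<and> z = (\<Sum>k<n. x k * y k)"
proof -
  interpret Modules.module "frac_scale :: 'a \<Rightarrow> 'a fract \<Rightarrow> 'a fract" by (rule module_frac_scale)
  define S where "S = {z. \<exists>ps. set ps \<subseteq> I \<times> J \<and> z = (\<Sum>p\<leftarrow>ps. fst p * snd p)}"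
  have "subspace S"
  proof (rule subspaceI)
    show "0 \<in> S" unfolding S_def by (rule CollectI, rule exI[of _ "[]"]) simp
  next
    fix u v assume "u \<in> S" "v \<in> S"
    then obtain ps qs where "set ps \<subseteq> I \<times> J" "set qs \<subseteq> I \<times> J"
      "u = (\<Sum>p\<leftarrow>ps. fst p * snd p)" "v = (\<Sum>p\<leftarrow>qs. fst p * snd p)" by (auto simp: S_def)
    then show "u + v \<in> S" unfolding S_def by (intro CollectI exI[of _ "ps @ qs"]) simp
  next
    fix c u assume "u \<in> S"
    then obtain ps where ps: "set ps \<subseteq> I \<times> J" "u = (\<Sum>p\<leftarrow>ps. fst p * snd p)" by (auto simp: S_def)
    let ?qs = "map (\<lambda>p. (frac_scale c (fst p), snd p)) ps"
    have "set ?qs \<subseteq> I \<times> J" using ps(1) assms(2) by auto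
    moreover have "frac_scale c u = (\<Sum>p\<leftarrow>?qs. fst p * snd p)"
      unfolding ps(2) by (simp add: sum_list_const_mult[symmetric] o_def mult.assoc del: mult_fract)
    ultimately show "frac_scale c u \<in> S" unfolding S_def by blast
  qed
  moreover have "{x * y | x y. x \<in> I \<and> y \<in> J} \<subseteq> S"
  proof clarify
    fix x y assume "x \<in> I" "y \<in> J"
    then show "x * y \<in> S" unfolding S_def by (intro CollectI exI[of _ "[(x, y)]"]) simp
  qed
  ultimately have "z \<in> S" using assms(1) span_minimal unfolding fractional_ideal_prod_def by blast
  then obtain ps where ps: "set ps \<subseteq> I \<times> J" "z = (\<Sum>p\<leftarrow>ps. fst p * snd p)" by (auto simp: S_def)
  show ?thesis
  proof (intro exI conjI allI impI)
    show "fst (ps ! k) \<in> I" "snd (ps ! k) \<in> J" if "k < length ps" for k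
      using ps(1) nth_mem[OF that] by (auto simp: mem_Times_iff)
    show "z = (\<Sum>k<length ps. fst (ps ! k) * snd (ps ! k))"
      unfolding ps(2) by (simp add: sum_list_sum_nth atLeast0LessThan)
  qed
qed

text \<open>From \<open>1 = \<Sum>k. a\<^sub>k y\<^sub>k\<close> with \<open>a\<^sub>k \<in> I\<close> and \<open>y\<^sub>k\<close> in the inverse, the coordinate functions
are the multiplications by \<open>y\<^sub>k\<close>, which map \<open>I\<close> into the domain.\<close>
lemma invertible_ideal_has_dual_basis:
  assumes I: "submod (*) (I :: 'a::idom set)" and inv: "invertible_ideal I"
  shows "has_dual_basis (*) I"
proof -
  obtain J where J: "fractional_ideal J" "fractional_ideal_prod (to_frac ` I) J = range to_frac"
    using inv by (auto simp: invertible_ideal_def)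
  then obtain d where d: "d \<noteq> 0" "\<And>y. y \<in> J \<Longrightarrow> frac_scale d y \<in> range to_frac"
    by (auto simp: fractional_ideal_def)
  interpret M: Modules.module "frac_scale :: 'a \<Rightarrow> 'a fract \<Rightarrow> 'a fract" by (rule module_frac_scale)
  have "frac_scale c x \<in> to_frac ` I" if "x \<in> to_frac ` I" for c x
    using that submodD(3)[OF I] by (auto simp: mult.commute)
  moreover have "1 \<in> fractional_ideal_prod (to_frac ` I) J"
    unfolding J(2) by (metis to_frac_simps(4) rangeI)
  ultimately obtain n :: nat and x y where xy: "\<And>k. k < n \<Longrightarrow> x k \<in> to_frac ` I \<and> y k \<in> J"
      and one: "1 = (\<Sum>k<n. x k * y k)"
    using fractional_ideal_prod_sum[of 1 "to_frac ` I" J] by blast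
  have IJ: "to_frac a * y \<in> range to_frac" if "a \<in> I" "y \<in> J" for a y
  proof -
    have "to_frac a * y \<in> fractional_ideal_prod (to_frac ` I) J"
      unfolding fractional_ideal_prod_def using that by (intro M.span_base) blast
    then show ?thesis using J(2) by simp
  qed
  define a where "a k = (SOME a. a \<in> I \<and> x k = to_frac a)" for k
  have a: "a k \<in> I \<and> x k = to_frac (a k)" if "k < n" for k
    unfolding a_def by (rule someI_ex) (use xy[OF that] in blast)
  define h where "h k z = (SOME q. to_frac z * y k = to_frac q)" for k z
  have h: "to_frac z * y k = to_frac (h k z)" if "k < n" "z \<in> I" for k z
    unfolding h_def by (rule someI_ex) (use IJ that xy in blast)
  have "linear_on (*) (*) I (h k)" if k: "k < n" for k
  proof (rule linear_onI)
    fix u v assume uv: "u \<in> I" "v \<in> I"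
    have "to_frac (h k (u + v)) = to_frac (u + v) * y k"
      using h[OF k submodD(2)[OF I uv]] by simp
    also have "\<dots> = to_frac (h k u) + to_frac (h k v)"
      unfolding to_frac_simps(1) distrib_right h[OF k uv(1)] h[OF k uv(2)] ..
    also have "\<dots> = to_frac (h k u + h k v)" by (rule to_frac_simps(1)[symmetric])
    finally show "h k (u + v) = h k u + h k v" unfolding to_frac_simps(6) .
  next
    fix u c assume u: "u \<in> I"
    have "to_frac (h k (u * c)) = to_frac (u * c) * y k"
      using h[OF k submodD(3)[OF I u]] by simp
    also have "\<dots> = to_frac u * y k * to_frac c"
      unfolding to_frac_simps(2) by (simp only: ac_simps)
    also have "\<dots> = to_frac (h k u * c)" unfolding to_frac_simps(2) h[OF k u] ..
    finally show "h k (u * c) = h k u * c" unfolding to_frac_simps(6) .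
  qed
  moreover have "z = (\<Sum>k<n. a k * h k z)" if "z \<in> I" for z
  proof -
    have "to_frac (\<Sum>k<n. a k * h k z) = (\<Sum>k<n. x k * (to_frac z * y k))"
      unfolding to_frac_sum to_frac_simps(2) by (rule sum.cong) (use a h that in auto)
    also have "\<dots> = to_frac z * (\<Sum>k<n. x k * y k)"
      unfolding sum_distrib_left by (rule sum.cong) (simp_all only: ac_simps)
    finally have "to_frac (\<Sum>k<n. a k * h k z) = to_frac z" unfolding one[symmetric]
      by (simp only: mult_1_right)
    then show ?thesis unfolding to_frac_simps(6) by (rule sym)
  qed
  ultimately show ?thesis using a unfolding has_dual_basis_def by blast
qed

text \<open>The product as the least ideal that contains the products of elements; inclusions of
products then reduce to elements without finite sums.\<close>
definition iprod :: "'a::comm_ring_1 set \<Rightarrow> 'a set \<Rightarrow> 'a set" where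
  "iprod I J = \<Inter>{K. submod (*) K \<and> (\<forall>x\<in>I. \<forall>y\<in>J. x * y \<in> K)}"

lemma submod_iprod: "submod (*) (iprod I J)"
  by (auto simp: iprod_def submod_def)

lemma iprodI: "x \<in> I \<Longrightarrow> y \<in> J \<Longrightarrow> x * y \<in> iprod I J"
  by (auto simp: iprod_def)

lemma iprod_least:
  assumes "submod (*) K" "\<And>x y. x \<in> I \<Longrightarrow> y \<in> J \<Longrightarrow> x * y \<in> K"
  shows "iprod I J \<subseteq> K"
  using assms by (auto simp: iprod_def)

lemma submod_UNIV [simp]: "submod act UNIV"
  by (simp add: submod_def)

lemma submod_mult_left: "submod (*) I \<Longrightarrow> x \<in> I \<Longrightarrow> c * x \<in> I" for c :: "'a::comm_ring_1"
  using submodD(3)[of "(*)" I x c] by (simp add: mult.commute)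

lemma iprod_commute: "iprod I J = iprod J I"
proof -
  have "(\<forall>x\<in>I. \<forall>y\<in>J. x * y \<in> K) = (\<forall>x\<in>J. \<forall>y\<in>I. x * y \<in> K)" for K
    by (metis mult.commute)
  then show ?thesis by (simp add: iprod_def)
qed

lemma iprod_mono: "I \<subseteq> I' \<Longrightarrow> J \<subseteq> J' \<Longrightarrow> iprod I J \<subseteq> iprod I' J'"
  by (rule iprod_least[OF submod_iprod]) (auto intro: iprodI)

lemma submod_colon:
  assumes K: "submod (*) (K :: 'a::comm_ring_1 set)"
  shows "submod (*) {z. \<forall>x\<in>J. z * x \<in> K}"
proof -
  have "u * a * x \<in> K" if "u * x \<in> K" for u a x
    using submodD(3)[OF K that, of a] by (simp add: ac_simps)
  then show ?thesis using submodD(1,2)[OF K] by (auto simp: submod_def distrib_right)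
qed

lemma iprod_assoc_subset: "iprod (iprod I J) K \<subseteq> iprod I (iprod J K)"
proof (rule iprod_least[OF submod_iprod])
  fix z k assume zk: "z \<in> iprod I J" "k \<in> K"
  have "iprod I J \<subseteq> {z. \<forall>k\<in>K. z * k \<in> iprod I (iprod J K)}"
    by (rule iprod_least[OF submod_colon[OF submod_iprod]])
      (use iprodI[OF _ iprodI] in \<open>auto simp: mult.assoc\<close>)
  then show "z * k \<in> iprod I (iprod J K)" using zk by blast
qed

lemma iprod_assoc: "iprod (iprod I J) K = iprod I (iprod J K)"
  using iprod_assoc_subset[of I J K] iprod_assoc_subset[of K J I] by (simp add: iprod_commute)

lemma iprod_UNIV: "submod (*) I \<Longrightarrow> iprod I UNIV = I"
proof
  assume I: "submod (*) I"
  show "iprod I UNIV \<subseteq> I" by (rule iprod_least[OF I submodD(3)[OF I]])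
  show "I \<subseteq> iprod I UNIV" using iprodI[of _ I 1 UNIV] by auto
qed

lemma iprod_subset: "submod (*) I \<Longrightarrow> iprod I J \<subseteq> I" "submod (*) J \<Longrightarrow> iprod I J \<subseteq> J"
  by (rule iprod_least; auto intro: submodD(3) submod_mult_left)+

lemma submod_scale: "submod (*) I \<Longrightarrow> submod (*) ((*) d ` I)" for d :: "'a::comm_ring_1"
proof -
  assume I: "submod (*) I"
  have "d * 0 \<in> (*) d ` I" using submodD(1)[OF I] by (rule imageI)
  moreover have "d * (x + y) \<in> (*) d ` I" if "x \<in> I" "y \<in> I" for x y
    using submodD(2)[OF I that] by (rule imageI)
  moreover have "d * (x * a) \<in> (*) d ` I" if "x \<in> I" for x a
    using submodD(3)[OF I that] by (rule imageI)
  ultimately show ?thesis by (auto simp: submod_def distrib_left mult.assoc)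
qed

lemma submod_ideal_sum:
  assumes A: "submod (*) A" and B: "submod (*) (B :: 'a::comm_ring_1 set)"
  shows "submod (*) {x + y | x y. x \<in> A \<and> y \<in> B}"
  unfolding submod_def
proof (intro conjI ballI allI)
  show "0 \<in> {x + y | x y. x \<in> A \<and> y \<in> B}" using submodD(1)[OF A] submodD(1)[OF B] by force
  fix u assume "u \<in> {x + y | x y. x \<in> A \<and> y \<in> B}"
  then obtain x y where u: "u = x + y" "x \<in> A" "y \<in> B" by blast
  show "u * a \<in> {x + y | x y. x \<in> A \<and> y \<in> B}" for a
    using submodD(3)[OF A u(2), of a] submodD(3)[OF B u(3), of a] u(1) by (auto simp: distrib_right)
  fix v assume "v \<in> {x + y | x y. x \<in> A \<and> y \<in> B}"
  then obtain x' y' where v: "v = x' + y'" "x' \<in> A" "y' \<in> B" by blast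
  have "u + v = (x + x') + (y + y')" by (simp add: u(1) v(1))
  then show "u + v \<in> {x + y | x y. x \<in> A \<and> y \<in> B}"
    using submodD(2)[OF A u(2) v(2)] submodD(2)[OF B u(3) v(3)] by blast
qed

lemma submod_principal: "submod (*) (range ((*) d))" for d :: "'a::comm_ring_1"
  by (rule submod_scale) simp

lemma iprod_scale: "iprod ((*) d ` I) J = (*) d ` iprod I J"
proof
  show "iprod ((*) d ` I) J \<subseteq> (*) d ` iprod I J"
    by (rule iprod_least[OF submod_scale[OF submod_iprod]]) (auto simp: mult.assoc intro: iprodI)
  have "submod (*) {z. d * z \<in> iprod ((*) d ` I) J}"
    using submodD[OF submod_iprod[of "(*) d ` I" J]] 
    by (auto simp: submod_def distrib_left mult.assoc[symmetric])
  then have "iprod I J \<subseteq> {z. d * z \<in> iprod ((*) d ` I) J}"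
    by (rule iprod_least) (auto simp: mult.assoc[symmetric] intro: iprodI)
  then show "(*) d ` iprod I J \<subseteq> iprod ((*) d ` I) J" by blast
qed

lemma iprod_principal: "submod (*) J \<Longrightarrow> iprod (range ((*) d)) J = (*) d ` J"
  by (simp add: iprod_scale iprod_commute[of UNIV] iprod_UNIV)

lemma scale_subset_iff: "d \<noteq> 0 \<Longrightarrow> (*) d ` I \<subseteq> (*) d ` J \<longleftrightarrow> I \<subseteq> J" for d :: "'a::idom"
  by (rule inj_image_subset_iff) (simp add: inj_on_def)

lemma scale_eq_iff: "d \<noteq> 0 \<Longrightarrow> (*) d ` I = (*) d ` J \<longleftrightarrow> I = J" for d :: "'a::idom"
  by (rule inj_image_eq_iff) (simp add: inj_on_def)

definition nonzero_ideal :: "'a::comm_ring_1 set \<Rightarrow> bool" where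
  "nonzero_ideal I \<longleftrightarrow> submod (*) I \<and> I \<noteq> {0}"

lemma nonzero_idealE:
  assumes "nonzero_ideal I"
  obtains c where "c \<in> I" "c \<noteq> 0" "submod (*) I"
  using assms submodD(1) unfolding nonzero_ideal_def by blast

lemma nonzero_ideal_superset:
  assumes "nonzero_ideal I" "I \<subseteq> J" "submod (*) J" shows "nonzero_ideal J"
proof -
  obtain c where "c \<in> I" "c \<noteq> 0" using assms(1) by (rule nonzero_idealE)
  then have "J \<noteq> {0}" using assms(2) by blast
  then show ?thesis using assms(3) by (simp add: nonzero_ideal_def)
qed

lemma nonzero_ideal_UNIV [simp]: "nonzero_ideal (UNIV :: 'a::comm_ring_1 set)"
  unfolding nonzero_ideal_def by (metis UNIV_I singletonD submod_UNIV zero_neq_one)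

lemma nonzero_ideal_iprod:
  assumes "nonzero_ideal I" "nonzero_ideal J" shows "nonzero_ideal (iprod I (J :: 'a::idom set))"
proof -
  obtain c where c: "c \<in> I" "c \<noteq> 0" using assms(1) by (rule nonzero_idealE)
  obtain d where d: "d \<in> J" "d \<noteq> 0" using assms(2) by (rule nonzero_idealE)
  have "c * d \<in> iprod I J" "c * d \<noteq> 0" using c d by (simp_all add: iprodI)
  then have "iprod I J \<noteq> {0}" by blast
  then show ?thesis by (simp add: nonzero_ideal_def submod_iprod)
qed

locale dedekind =
  fixes T :: "'a::idom itself"
  assumes dedekind: "dedekind_domain TYPE('a)"
begin

lemma dual_basis:
  assumes "nonzero_ideal (I :: 'a set)" shows "has_dual_basis (*) I"
proof (rule invertible_ideal_has_dual_basis)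
  show I: "submod (*) I" using assms by (simp add: nonzero_ideal_def)
  then show "invertible_ideal I"
    using assms dedekind unfolding nonzero_ideal_def dedekind_domain_def submod_mult_iff_dom_ideal
    by blast
qed

text \<open>The inverse of \<open>I\<close> up to the factor \<open>d\<close>, as an ideal of \<open>D\<close>; this keeps the ideal
arithmetic away from the field of fractions. Any nonzero \<open>d \<in> I\<close> serves as a common denominator.\<close>
lemma inverse_ideal:
  assumes "nonzero_ideal (I :: 'a set)"
  obtains I' d where "nonzero_ideal I'" "d \<noteq> 0" "iprod I I' = range ((*) d)"
proof -
  obtain d where d: "d \<in> I" "d \<noteq> 0" and I: "submod (*) I" using assms by (rule nonzero_idealE)
  obtain n a h where h: "\<And>k. k < (n::nat) \<Longrightarrow> a k \<in> I" "\<And>k. k < n \<Longrightarrow> linear_on (*) (*) I (h k)"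
    and x: "\<And>x. x \<in> I \<Longrightarrow> x = (\<Sum>k<n. a k * h k x)"
    using dual_basis[OF assms] unfolding has_dual_basis_def by blast
  define I' where "I' = {b. \<forall>x\<in>I. b * x \<in> range ((*) d)}"
  note P = submod_principal[of d]
  have I': "submod (*) I'" unfolding I'_def by (rule submod_colon[OF P])
  have hd: "h k d \<in> I'" if "k < n" for k
  proof -
    have "h k d * x = d * h k x" if "x \<in> I" for x
      using linear_onD(2)[OF h(2)[OF \<open>k < n\<close>] d(1), of x] linear_onD(2)[OF h(2)[OF \<open>k < n\<close>] that, of d]
      by (simp add: mult.commute)
    then show ?thesis unfolding I'_def by auto
  qed
  have "(\<Sum>k<n. a k * h k d) \<in> iprod I I'"
    by (rule submod_sum[OF submod_iprod]) (use iprodI[OF h(1) hd] in auto)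
  then have d': "d \<in> iprod I I'" using x[OF d(1)] by simp
  show ?thesis
  proof (rule that[OF _ d(2)])
    have "x * y \<in> range ((*) d)" if "x \<in> I" "y \<in> I'" for x y
      using that unfolding I'_def by (subst mult.commute) blast
    from iprod_least[OF P this] show "iprod I I' = range ((*) d)"
      using submodD(3)[OF submod_iprod d'] by blast
    have "I' \<noteq> {0}"
    proof
      assume "I' = {0}"
      then have "iprod I I' \<subseteq> {0}" by (intro iprod_least) (auto simp: submod_def)
      then show False using d' d by blast
    qed
    then show "nonzero_ideal I'" using I' by (simp add: nonzero_ideal_def)
  qed
qed

lemma iprod_cancel_subset:
  assumes "nonzero_ideal (I :: 'a set)" "submod (*) A" "submod (*) B" "iprod I A \<subseteq> iprod I B"
  shows "A \<subseteq> B"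
proof -
  obtain I' d where I': "d \<noteq> 0" "iprod I I' = range ((*) d)" using inverse_ideal[OF assms(1)] .
  have "iprod I' (iprod I A) \<subseteq> iprod I' (iprod I B)" by (rule iprod_mono) (use assms(4) in auto)
  then have "iprod (iprod I I') A \<subseteq> iprod (iprod I I') B"
    by (simp add: iprod_assoc[symmetric] iprod_commute[of I'])
  then show ?thesis using assms(2,3) I' by (simp add: iprod_principal scale_subset_iff)
qed

text \<open>To contain is to divide: if \<open>I I' = d D\<close>, then \<open>C'\<close> is \<open>C I'/d\<close>.\<close>
lemma iprod_divides:
  assumes "nonzero_ideal (I :: 'a set)" "nonzero_ideal C" "C \<subseteq> I"
  obtains C' where "nonzero_ideal C'" "C = iprod I C'"
proof -
  obtain I' d where I': "nonzero_ideal I'" "d \<noteq> 0" "iprod I I' = range ((*) d)"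
    using inverse_ideal[OF assms(1)] .
  have C: "submod (*) C" using assms(2) by (simp add: nonzero_ideal_def)
  define C' where "C' = {y. d * y \<in> iprod C I'}"
  have "submod (*) C'" using submodD[OF submod_iprod[of C I']]
    unfolding C'_def by (auto simp: submod_def distrib_left mult.assoc[symmetric])
  have "iprod C I' \<subseteq> range ((*) d)" using iprod_mono[OF assms(3), of I' I'] I' by simp
  then have dC': "(*) d ` C' = iprod C I'" unfolding C'_def by auto
  have "(*) d ` iprod I C' = iprod ((*) d ` C') I" by (simp add: iprod_scale iprod_commute[of I])
  also have "\<dots> = iprod (iprod I I') C"
    unfolding dC' by (metis iprod_assoc iprod_commute)
  also have "\<dots> = (*) d ` C" using I' C by (simp add: iprod_principal)
  finally have eq: "C = iprod I C'" using I'(2) by (simp add: scale_eq_iff)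
  have "C' \<noteq> {0}"
  proof
    assume "C' = {0}"
    then have "iprod I C' \<subseteq> {0}" by (intro iprod_least) (auto simp: submod_def)
    then show False using eq assms(2) nonzero_idealE by blast
  qed
  then show ?thesis using that eq \<open>submod (*) C'\<close> nonzero_ideal_def by blast
qed

text \<open>The Noetherian property: the union of a chain of ideals has a dual basis, and its finitely
many generators lie in one member of the chain.\<close>
lemma wf_ideals: "wf {(J :: 'a set, I). nonzero_ideal I \<and> nonzero_ideal J \<and> I \<subset> J}"
  unfolding wf_iff_no_infinite_down_chain
proof
  assume "\<exists>f :: nat \<Rightarrow> 'a set. \<forall>i. (f (Suc i), f i) \<in> {(J, I). nonzero_ideal I \<and> nonzero_ideal J \<and>
    I \<subset> J}"
  then obtain f :: "nat \<Rightarrow> 'a set"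
    where f_all: "\<forall>i. (f (Suc i), f i) \<in> {(J, I). nonzero_ideal I \<and> nonzero_ideal J \<and> I \<subset> J}"
      by blast
  have f: "nonzero_ideal (f i)" "f i \<subset> f (Suc i)" for i using f_all by auto
  have mono: "f i \<subseteq> f j" if "i \<le> j" for i j using that f(2)
    by (metis lift_Suc_mono_le psubset_imp_subset)
  define U where "U = (\<Union>i. f i)"
  have fs: "submod (*) (f i)" for i using f(1) by (simp add: nonzero_ideal_def)
  have "submod (*) U" unfolding submod_def
  proof (intro conjI ballI allI)
    show "0 \<in> U" using submodD(1)[OF fs] by (auto simp: U_def)
    show "u * a \<in> U" if "u \<in> U" for u a using that submodD(3)[OF fs] by (auto simp: U_def)
    fix u v assume "u \<in> U" "v \<in> U"
    then obtain i j where "u \<in> f i" "v \<in> f j" by (auto simp: U_def)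
    then have "u \<in> f (max i j)" "v \<in> f (max i j)" using mono[of i "max i j"] mono[of j "max i j"]
      by auto
    then show "u + v \<in> U" using submodD(2)[OF fs] by (auto simp: U_def)
  qed
  moreover have "U \<noteq> {0}" using f(1)[of 0] submodD(1)[OF fs[of 0]]
    by (auto simp: U_def nonzero_ideal_def)
  ultimately obtain n a h where a: "\<And>k. k < (n::nat) \<Longrightarrow> a k \<in> U"
    and x: "\<And>x. x \<in> U \<Longrightarrow> x = (\<Sum>k<n. a k * h k x)"
    using dual_basis[of U] unfolding has_dual_basis_def nonzero_ideal_def by metis
  have "\<forall>k\<in>{..<n}. \<exists>i. a k \<in> f i" using a by (auto simp: U_def)
  then obtain i where i: "\<And>k. k < n \<Longrightarrow> a k \<in> f (i k)" by (metis lessThan_iff)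
  define N where "N = Max (insert 0 (i ` {..<n}))"
  have "a k \<in> f N" if "k < n" for k using i[OF that] mono[of "i k" N] that unfolding N_def by auto
  then have "(\<Sum>k<n. a k * h k x) \<in> f N" for x by (intro submod_sum[OF fs] submodD(3)[OF fs]) auto
  then have "U \<subseteq> f N" by (intro subsetI, subst x) simp_all
  then show False using f(2)[of N] by (auto simp: U_def)
qed

definition maximal_ideal :: "'a set \<Rightarrow> bool" where
  "maximal_ideal p \<longleftrightarrow> nonzero_ideal p \<and> p \<noteq> UNIV \<and> (\<forall>J. submod (*) J \<longrightarrow> p \<subset> J \<longrightarrow> J = UNIV)"

lemma maximal_ideal_subset_eq: "maximal_ideal q \<Longrightarrow> maximal_ideal p \<Longrightarrow> q \<subseteq> p \<Longrightarrow> q = p"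
  unfolding maximal_ideal_def nonzero_ideal_def by (metis psubsetI)

lemma exists_maximal_ideal:
  assumes "nonzero_ideal I" "I \<noteq> UNIV"
  obtains p where "maximal_ideal p" "I \<subseteq> p"
proof -
  let ?Q = "{J. nonzero_ideal J \<and> I \<subseteq> J \<and> J \<noteq> UNIV}"
  obtain p where p: "p \<in> ?Q" "\<And>J. (J, p) \<in> {(J, I). nonzero_ideal I \<and> nonzero_ideal J \<and> I \<subset> J} \<Longrightarrow>
    J \<notin> ?Q"
    using wfE_min[OF wf_ideals, of I ?Q] assms by blast
  have "J = UNIV" if "submod (*) J" "p \<subset> J" for J
  proof -
    have "nonzero_ideal J" using nonzero_ideal_superset[of p J] that p(1) by blast
    then show ?thesis using p that by blast
  qed
  then show ?thesis using that p(1) maximal_ideal_def by blast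
qed

lemma maximal_ideal_comaximal:
  assumes "maximal_ideal p" "t \<notin> p"
  obtains c s where "c \<in> p" "c + t * s = 1"
proof -
  have p: "submod (*) p" using assms by (simp add: maximal_ideal_def nonzero_ideal_def)
  let ?J = "{c + y | c y. c \<in> p \<and> y \<in> range ((*) t)}"
  have "submod (*) ?J" by (rule submod_ideal_sum[OF p submod_principal])
  moreover have "c \<in> ?J" if "c \<in> p" for c
    using that submodD(1)[OF submod_principal] by (intro CollectI exI[of _ c] exI[of _ 0]) auto
  moreover have "t \<in> ?J" using submodD(1)[OF p]
    by (intro CollectI exI[of _ 0] exI[of _ "t * 1"]) auto
  ultimately have "?J = UNIV" using assms unfolding maximal_ideal_def by blast
  then have "1 \<in> ?J" by simp
  then obtain c s where "1 = c + t * s" "c \<in> p" by blast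
  then show ?thesis using that by metis
qed

lemma maximal_ideal_prime:
  assumes "maximal_ideal p" "x * t \<in> p" "t \<notin> p" shows "x \<in> p"
proof -
  have p: "submod (*) p" using assms by (simp add: maximal_ideal_def nonzero_ideal_def)
  obtain c s where c: "c \<in> p" "c + t * s = 1" using maximal_ideal_comaximal assms by blast
  have "x = x * (c + t * s)" using c by simp
  also have "\<dots> = c * x + x * t * s" by (simp add: algebra_simps)
  finally have "x = c * x + x * t * s" .
  moreover have "c * x + x * t * s \<in> p" by (intro submodD(2)[OF p] submodD(3)[OF p] c(1) assms(2))
  ultimately show ?thesis by simp
qed

text \<open>Noetherian induction: if \<open>J = p J'\<close> with \<open>p\<close> maximal, then a maximal ideal above \<open>J\<close> is
\<open>p\<close> or lies above \<open>J'\<close>.\<close>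
lemma finite_maximal_ideals_above:
  assumes "nonzero_ideal (J :: 'a set)"
  shows "finite {p. maximal_ideal p \<and> J \<subseteq> p}"
  using wf_ideals assms
proof (induction J rule: wf_induct_rule)
  case (less J)
  show ?case
  proof (cases "J = UNIV")
    case True
    then have "{p. maximal_ideal p \<and> J \<subseteq> p} = {}" by (auto simp: maximal_ideal_def)
    then show ?thesis by (simp only: finite.emptyI)
  next
    case False
    then obtain p where p: "maximal_ideal p" "J \<subseteq> p" using exists_maximal_ideal less.prems by blast
    then have np: "nonzero_ideal p" by (simp add: maximal_ideal_def)
    obtain J' where J': "nonzero_ideal J'" "J = iprod p J'"
      using iprod_divides[OF np less.prems p(2)] .
    have sub: "submod (*) J'" "submod (*) p" using J' np by (auto simp: nonzero_ideal_def)
    have "J \<subseteq> J'" using iprod_subset(2)[OF sub(1), of p] J' by simp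
    moreover have "J \<noteq> J'"
    proof
      assume "J = J'"
      then have "iprod J' UNIV \<subseteq> iprod J' p" using J' sub by (simp add: iprod_UNIV iprod_commute)
      then have "UNIV \<subseteq> p" using iprod_cancel_subset[OF J'(1)] sub by simp
      then show False using p by (auto simp: maximal_ideal_def)
    qed
    ultimately have fin: "finite {p. maximal_ideal p \<and> J' \<subseteq> p}" using less J' by blast
    have "q = p \<or> J' \<subseteq> q" if q: "maximal_ideal q" "J \<subseteq> q" for q
    proof (rule ccontr)
      assume "\<not> (q = p \<or> J' \<subseteq> q)"
      moreover have "p \<subseteq> q \<Longrightarrow> q = p" using maximal_ideal_subset_eq[OF p(1) q(1)] by simp
      ultimately obtain x y where "x \<in> p" "x \<notin> q" "y \<in> J'" "y \<notin> q" by blast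
      then show False using maximal_ideal_prime[OF q(1), of x y] iprodI[of x p y J'] q(2) J'(2)
        by blast
    qed
    then have "{p. maximal_ideal p \<and> J \<subseteq> p} \<subseteq> insert p {p. maximal_ideal p \<and> J' \<subseteq> p}" by blast
    then show ?thesis using fin finite_subset by blast
  qed
qed

text \<open>The elements of \<open>I\<close> outside all \<open>I p\<close> are those that generate \<open>I\<close> locally at every \<open>p \<in>
P\<close>.\<close>
lemma exists_avoiding_maximal_ideals:
  assumes "finite P" "\<And>p. p \<in> P \<Longrightarrow> maximal_ideal p" and I: "nonzero_ideal I"
  shows "\<exists>b\<in>I. \<forall>p\<in>P. b \<notin> iprod I p"
  using assms(1,2)
proof (induction P rule: finite_induct)
  case empty
  then show ?case using I nonzero_idealE by blast
next
  case (insert p P)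
  have Is: "submod (*) I" using I by (simp add: nonzero_ideal_def)
  obtain b where b: "b \<in> I" "\<And>q. q \<in> P \<Longrightarrow> b \<notin> iprod I q" using insert by blast
  have p: "maximal_ideal p" using insert by blast
  then have ps: "submod (*) p" by (simp add: maximal_ideal_def nonzero_ideal_def)
  show ?case
  proof (cases "b \<in> iprod I p")
    case False
    then show ?thesis using b by blast
  next
    case True
    \<comment> \<open>Here \<open>b\<close> is corrected by \<open>x t\<close>, where \<open>x \<in> I\<close> lies outside \<open>I p\<close>, and \<open>t\<close> lies in all
      ideals in \<open>P\<close> but not in \<open>p\<close>.\<close>
    have "\<exists>t. t \<in> q \<and> t \<notin> p" if "q \<in> P" for q
    proof (rule ccontr)
      assume "\<nexists>t. t \<in> q \<and> t \<notin> p"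
      then have "q \<subseteq> p" by blast
      then have "q = p" using maximal_ideal_subset_eq p insert.prems that by blast
      then show False using insert.hyps that by simp
    qed
    then obtain t where t: "\<And>q. q \<in> P \<Longrightarrow> t q \<in> q \<and> t q \<notin> p" by metis
    have "prod t Q \<notin> p" if "Q \<subseteq> P" for Q
      using finite_subset[OF that insert.hyps(1)] that
    proof (induction Q rule: finite_induct)
      case empty
      have "1 \<in> p \<Longrightarrow> p = UNIV" using submodD(3)[OF ps, of 1] by auto
      then show ?case using p by (auto simp: maximal_ideal_def)
    next
      case (insert q Q)
      then show ?case using maximal_ideal_prime[OF p, of "t q" "prod t Q"] t by auto
    qed
    then have tp: "prod t P \<notin> p" by simp
    have tq: "prod t P \<in> q" if "q \<in> P" for q
    proof -
      have "submod (*) q" using insert.prems that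
        by (auto simp: maximal_ideal_def nonzero_ideal_def)
      then show ?thesis using t[OF that] submodD(3) prod.remove[OF insert.hyps(1) that, of t]
        by metis
    qed
    have "\<not> iprod I UNIV \<subseteq> iprod I p" using iprod_cancel_subset[OF I _ ps, of UNIV] p
      by (auto simp: maximal_ideal_def)
    then obtain x where x: "x \<in> I" "x \<notin> iprod I p" using Is by (auto simp: iprod_UNIV)
    have xt: "x * prod t P \<notin> iprod I p"
    proof
      assume xt: "x * prod t P \<in> iprod I p"
      obtain c s where c: "c \<in> p" "c + prod t P * s = 1" using maximal_ideal_comaximal[OF p tp] .
      have "x = x * (c + prod t P * s)" using c by simp
      also have "\<dots> = x * c + x * prod t P * s" by (simp add: algebra_simps)
      also have "\<dots> \<in> iprod I p"
        by (intro submodD(2)[OF submod_iprod] submodD(3)[OF submod_iprod] iprodI x(1) c(1) xt)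
      finally show False using x by simp
    qed
    have minus: "u \<in> iprod I q" if "u + v \<in> iprod I q" "v \<in> iprod I q" for u v q
      using submodD(2)[OF submod_iprod that(1) submodD(3)[OF submod_iprod that(2), of "-1"]] by simp
    show ?thesis
    proof (intro bexI ballI)
      show "b + x * prod t P \<in> I" using b x Is by (intro submodD(2)[OF Is] submodD(3)[OF Is])
      fix q assume q: "q \<in> insert p P"
      show "b + x * prod t P \<notin> iprod I q"
      proof (cases "q = p")
        case True
        then show ?thesis using minus[of "x * prod t P" b p] xt \<open>b \<in> iprod I p\<close>
          by (auto simp: add.commute)
      next
        case False
        then show ?thesis using minus[of b "x * prod t P" q] b q iprodI[OF x(1) tq] by auto
      qed
    qed
  qed
qed

text \<open>That is, \<open>I = b D + I J\<close>. If \<open>b\<close> lies in no \<open>I p\<close> for the maximal ideals \<open>p\<close> above \<open>J\<close>,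
write the right-hand side as \<open>I C'\<close>; then \<open>C'\<close> contains \<open>J\<close> and no maximal ideal contains \<open>C'\<close>.\<close>
lemma generated_modulo_multiple:
  assumes I: "nonzero_ideal (I :: 'a set)" and J: "nonzero_ideal J"
  obtains b where "b \<in> I" "\<And>x. x \<in> I \<Longrightarrow> \<exists>r. \<exists>t\<in>iprod I J. x = b * r + t"
proof -
  have Is: "submod (*) I" and Js: "submod (*) J" using I J by (auto simp: nonzero_ideal_def)
  let ?P = "{p. maximal_ideal p \<and> J \<subseteq> p}"
  obtain b where b: "b \<in> I" "\<And>p. p \<in> ?P \<Longrightarrow> b \<notin> iprod I p"
    using exists_avoiding_maximal_ideals[OF finite_maximal_ideals_above[OF J] _ I] by blast
  define C where "C = {x + t | x t. x \<in> range ((*) b) \<and> t \<in> iprod I J}"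
  have "submod (*) C" unfolding C_def by (rule submod_ideal_sum[OF submod_principal submod_iprod])
  have bC: "b \<in> C"
    using submodD(1)[OF submod_iprod] unfolding C_def
    by (intro CollectI exI[of _ "b * 1"] exI[of _ 0]) auto
  have IJC: "iprod I J \<subseteq> C"
    using submodD(1)[OF submod_principal] unfolding C_def by force
  have CI: "C \<subseteq> I" using submodD[OF Is] b(1) iprod_subset(1)[OF Is, of J] unfolding C_def by blast
  have "nonzero_ideal (iprod I J)" by (rule nonzero_ideal_iprod[OF I J])
  then have "nonzero_ideal C" using nonzero_ideal_superset[OF _ IJC] \<open>submod (*) C\<close> by blast
  then obtain C' where C': "nonzero_ideal C'" "C = iprod I C'" using iprod_divides[OF I _ CI]
    by blast
  then have C's: "submod (*) C'" by (simp add: nonzero_ideal_def)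
  have "C' = UNIV"
  proof (rule ccontr)
    assume "C' \<noteq> UNIV"
    then obtain p where p: "maximal_ideal p" "C' \<subseteq> p" using exists_maximal_ideal C'(1) by blast
    have "J \<subseteq> C'" using iprod_cancel_subset[OF I Js C's] IJC C'(2) by simp
    then have "b \<notin> iprod I p" using b(2) p by blast
    then show False using bC C'(2) iprod_mono[OF subset_refl p(2), of I] by blast
  qed
  then have "I = C" using C'(2) Is by (simp add: iprod_UNIV)
  then show ?thesis using that[OF b(1)] unfolding C_def by blast
qed

end

section \<open>Finite direct sums of ideals\<close>

abbreviation dsum_iso :: "'a::idom set list \<Rightarrow> 'a set list \<Rightarrow> bool" where
  "dsum_iso Is Js \<equiv> isomorphic_submods (pointwise (*)) (pointwise (*)) (dsum Is) (dsum Js)"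

text \<open>Equality in the ideal class group, with the fraction \<open>b/a\<close> cleared of its denominator.\<close>
definition ideal_equiv :: "'a::idom set \<Rightarrow> 'a set \<Rightarrow> bool" where
  "ideal_equiv I J \<longleftrightarrow> (\<exists>a b. a \<noteq> 0 \<and> b \<noteq> 0 \<and> (*) a ` I = (*) b ` J)"

definition iprods :: "'a::idom set list \<Rightarrow> 'a set" where
  "iprods Is = foldr iprod Is UNIV"

lemma iprods_simps [simp]: "iprods [] = UNIV" "iprods (I # Is) = iprod I (iprods Is)"
  by (simp_all add: iprods_def)

lemma submod_iprods: "submod (*) (iprods Is)"
  by (cases Is) (simp_all add: submod_iprod)

lemma nonzero_ideal_iprods: "(\<And>I. I \<in> set Is \<Longrightarrow> nonzero_ideal I) \<Longrightarrow> nonzero_ideal (iprods Is)"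
  by (induction Is) (auto intro: nonzero_ideal_iprod)

lemma iprods_append: "iprods (Is @ Js) = iprod (iprods Is) (iprods Js)"
  by (induction Is) (simp_all add: iprod_assoc iprod_commute[of UNIV] iprod_UNIV submod_iprods)

lemma ideal_equiv_refl: "ideal_equiv I I"
  unfolding ideal_equiv_def by (intro exI[of _ 1]) auto

lemma ideal_equiv_sym: "ideal_equiv I J \<Longrightarrow> ideal_equiv J I"
  unfolding ideal_equiv_def by metis

lemma scale_scale: "(*) a ` (*) b ` I = (*) (a * b) ` I" for a :: "'a::comm_ring_1"
  by (auto simp: image_image mult.assoc)

lemma ideal_equiv_trans:
  assumes "ideal_equiv I J" "ideal_equiv J K" shows "ideal_equiv I K"
proof -
  obtain a b c d where *: "a \<noteq> 0" "b \<noteq> 0" "c \<noteq> 0" "d \<noteq> 0" "(*) a ` I = (*) b ` J"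
    "(*) c ` J = (*) d ` K"
    using assms unfolding ideal_equiv_def by metis
  have "(*) (c * a) ` I = (*) c ` (*) b ` J" by (simp add: scale_scale[symmetric] *)
  also have "\<dots> = (*) b ` (*) c ` J" by (simp only: scale_scale mult.commute[of c])
  also have "\<dots> = (*) (b * d) ` K" by (simp add: * scale_scale)
  finally show ?thesis unfolding ideal_equiv_def using *
    by (intro exI[of _ "c * a"] exI[of _ "b * d"]) simp
qed

lemma ideal_equiv_iprod:
  assumes "ideal_equiv I I'" "ideal_equiv J J'" shows "ideal_equiv (iprod I J) (iprod I' J')"
proof -
  have *: "ideal_equiv (iprod A K) (iprod B K)" if "ideal_equiv A B" for A B K :: "'a set"
  proof -
    obtain a b where "a \<noteq> 0" "b \<noteq> 0" "(*) a ` A = (*) b ` B" using \<open>ideal_equiv A B\<close>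
      by (auto simp: ideal_equiv_def)
    then show ?thesis unfolding ideal_equiv_def using iprod_scale[of a A K] iprod_scale[of b B K]
      by metis
  qed
  show ?thesis using ideal_equiv_trans[OF *[OF assms(1), of J] *[OF assms(2), of I', unfolded iprod_commute[of _ I']]] .
qed

lemma ideal_equiv_iprods:
  "list_all2 ideal_equiv Is Js \<Longrightarrow> ideal_equiv (iprods Is) (iprods Js)"
  by (induction rule: list_all2_induct) (auto intro: ideal_equiv_iprod ideal_equiv_refl)

lemma (in dedekind) ideal_equiv_cancel:
  assumes Q: "nonzero_ideal Q" and I: "submod (*) (I :: 'a set)" and J: "submod (*) J"
    and eq: "ideal_equiv (iprod Q I) (iprod Q J)"
  shows "ideal_equiv I J"
proof -
  obtain Q' d where d: "d \<noteq> 0" "iprod Q Q' = range ((*) d)" using inverse_ideal[OF Q] .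
  have *: "iprod (iprod Q K) Q' = (*) d ` K" if "submod (*) K" for K
  proof -
    have "iprod (iprod Q K) Q' = iprod (iprod Q Q') K" by (metis iprod_assoc iprod_commute)
    then show ?thesis using iprod_principal[OF that] d(2) by simp
  qed
  have dK: "ideal_equiv K ((*) d ` K)" for K
    unfolding ideal_equiv_def using d(1) by (intro exI[of _ d] exI[of _ 1]) simp
  have "ideal_equiv ((*) d ` I) ((*) d ` J)"
    using ideal_equiv_iprod[OF eq ideal_equiv_refl[of Q']] unfolding *[OF I] *[OF J] .
  then show ?thesis using dK ideal_equiv_trans ideal_equiv_sym by blast
qed

lemma ideal_equiv_isomorphic:
  assumes eq: "ideal_equiv I J" and I: "submod (*) (I :: 'a::idom set)"
  shows "isomorphic_submods (*) (*) I J"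
proof -
  obtain a b where ab: "a \<noteq> 0" "b \<noteq> 0" "(*) a ` I = (*) b ` J" using eq
    by (auto simp: ideal_equiv_def)
  have "\<exists>y. y \<in> J \<and> a * x = b * y" if "x \<in> I" for x
  proof -
    have "a * x \<in> (*) b ` J" using that ab(3) by blast
    then show ?thesis by blast
  qed
  then obtain g where g: "\<And>x. x \<in> I \<Longrightarrow> g x \<in> J \<and> a * x = b * g x" by metis
  have "\<exists>x. x \<in> I \<and> a * x = b * y" if "y \<in> J" for y
  proof -
    have "b * y \<in> (*) a ` I" using that ab(3) by blast
    then show ?thesis by auto
  qed
  then obtain k where k: "\<And>y. y \<in> J \<Longrightarrow> k y \<in> I \<and> a * k y = b * y" by metis
  have g_eq: "g x = y" if "x \<in> I" "a * x = b * y" for x y using g[OF that(1)] that(2) ab(2) by simp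
  show ?thesis
  proof (rule isomorphic_submodsI[where f = g and g = k])
    show "linear_on (*) (*) I g"
    proof (rule linear_onI)
      fix x y assume "x \<in> I" "y \<in> I"
      then show "g (x + y) = g x + g y"
        using g submodD(2)[OF I] by (intro g_eq) (simp_all add: distrib_left)
    next
      fix x c assume "x \<in> I"
      then show "g (x * c) = g x * c"
        using g submodD(3)[OF I] by (intro g_eq) (simp_all add: mult.assoc[symmetric])
    qed
    show "k (g x) = x" if "x \<in> I" for x
    proof -
      have "a * k (g x) = a * x" using g[OF that] k by simp
      then show ?thesis using ab(1) by simp
    qed
    show "g (k y) = y" if "y \<in> J" for y using k[OF that] by (intro g_eq) simp_all
  qed (use g k in auto)
qed

context dedekind
begin

text \<open>Let \<open>I I' = d D\<close> and choose \<open>b \<in> I'\<close> with \<open>I' = b D + I' J\<close>, that is, \<open>D = (b/d) I + J\<close>.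
Then there are \<open>u \<in> I\<close> and \<open>c \<in> J\<close> with \<open>(b/d) u + c = 1\<close>, and the matrix with rows \<open>(c, -u)\<close>
and \<open>(b/d, 1)\<close>, which has determinant \<open>1\<close>, maps \<open>I \<oplus> J\<close> onto \<open>I J \<oplus> D\<close>.\<close>
lemma isomorphic_pair:
  assumes I: "nonzero_ideal (I :: 'a set)" and J: "nonzero_ideal J"
  shows "dsum_iso (I # J # Ts) (iprod I J # UNIV # Ts)"
proof -
  have Is: "submod (*) I" and Js: "submod (*) J" using I J by (auto simp: nonzero_ideal_def)
  obtain I' d where I': "nonzero_ideal I'" "d \<noteq> 0" "iprod I I' = range ((*) d)"
    using inverse_ideal[OF I] .
  obtain b where b: "b \<in> I'" "\<And>x. x \<in> I' \<Longrightarrow> \<exists>r. \<exists>t\<in>iprod I' J. x = b * r + t"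
    using generated_modulo_multiple[OF I'(1) J] by blast
  have "iprod I (iprod I' J) = (*) d ` J"
    unfolding iprod_assoc[symmetric] I'(3) by (rule iprod_principal[OF Js])
  then have II'J: "x * t \<in> (*) d ` J" if "x \<in> I" "t \<in> iprod I' J" for x t
    using iprodI[OF that] by simp
  define S where "S = {x + y | x y. x \<in> (*) b ` I \<and> y \<in> (*) d ` J}"
  have "submod (*) S" unfolding S_def
    by (rule submod_ideal_sum[OF submod_scale[OF Is] submod_scale[OF Js]])
  moreover have "x * y \<in> S" if xy: "x \<in> I" "y \<in> I'" for x y
  proof -
    obtain r t where rt: "t \<in> iprod I' J" "y = b * r + t" using b(2)[OF xy(2)] by blast
    obtain j where j: "j \<in> J" "x * t = d * j" using II'J[OF xy(1) rt(1)] by blast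
    have "x * y = b * (x * r) + d * j" using rt(2) j(2) by (simp add: algebra_simps)
    then show ?thesis unfolding S_def using submodD(3)[OF Is xy(1)] j(1) by blast
  qed
  ultimately have "iprod I I' \<subseteq> S" by (rule iprod_least)
  moreover have "d \<in> range ((*) d)" by (rule range_eqI[of _ _ 1]) simp
  ultimately have "d \<in> S" using I'(3) by blast
  then obtain u c where uc: "u \<in> I" "c \<in> J" "b * u + d * c = d" unfolding S_def by force
  have "\<exists>q. b * x = d * q" if "x \<in> I" for x
    using iprodI[OF that b(1)] unfolding I'(3) by (auto simp: mult.commute)
  then obtain t where t: "\<And>x. x \<in> I \<Longrightarrow> b * x = d * t x" by metis
  have t_eq: "t x = y" if "x \<in> I" "b * x = d * y" for x y
    using t[OF that(1)] that(2) I'(2) by simp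
  have t_add: "t (x + y) = t x + t y" if "x \<in> I" "y \<in> I" for x y
    by (rule t_eq[OF submodD(2)[OF Is that]]) (simp add: distrib_left t that)
  have t_mult: "t (x * a) = t x * a" if "x \<in> I" for x a
    by (rule t_eq[OF submodD(3)[OF Is that]]) (simp add: mult.assoc[symmetric] t that)
  have t_J: "z \<in> I \<and> t z \<in> J" if "z \<in> iprod I J" for z
  proof -
    have "submod (*) {z \<in> I. t z \<in> J}"
      using submodD[OF Is] submodD[OF Js] t_add t_mult t_mult[OF submodD(1)[OF Is], of 0]
      unfolding submod_def by simp
    moreover have "x * y \<in> {z \<in> I. t z \<in> J}" if "x \<in> I" "y \<in> J" for x y
      using that submodD(3)[OF Is that(1)] submod_mult_left[OF Js that(2)] t_mult[OF that(1)]
      by simp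
    ultimately have "iprod I J \<subseteq> {z \<in> I. t z \<in> J}" by (rule iprod_least)
    then show ?thesis using that by blast
  qed
  have dsum2: "v \<in> dsum (A # B # Ts) \<longleftrightarrow> v 0 \<in> A \<and> v 1 \<in> B \<and> (\<lambda>i. v (Suc (Suc i))) \<in> dsum Ts"
    for v A B
    by (simp add: dsum_Cons)
  define F where "F v = (\<lambda>i. if i = 0 then c * v 0 - u * v 1 else if i =
    1 then t (v 0) + v 1 else v i)"
    for v :: "nat \<Rightarrow> 'a"
  define G where "G v = (\<lambda>i. if i = 0 then v 0 + u * v 1 else if i =
    1 then c * v 1 - t (v 0) else v i)"
    for v :: "nat \<Rightarrow> 'a"
  have diffI: "x - y \<in> A" if "submod (*) A" "x \<in> A" "y \<in> A" for x y and A :: "'a set"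
    using submodD(2)[OF that(1,2) submodD(3)[OF that(1,3), of "-1"]] by simp
  have "linear_on (pointwise (*)) (pointwise (*)) (dsum (I # J # Ts)) F"
    by (rule linear_onI)
      (auto simp: F_def pointwise_def dsum2 t_add t_mult fun_eq_iff distrib_left distrib_right left_diff_distrib mult.assoc)
  moreover have "F v \<in> dsum (iprod I J # UNIV # Ts)" if v: "v \<in> dsum (I # J # Ts)" for v
  proof -
    have "c * v 0 - u * v 1 \<in> iprod I J"
      using v uc by (intro diffI[OF submod_iprod]) (auto simp: dsum2 mult.commute[of c] intro: iprodI)
    then show ?thesis using v by (simp add: F_def dsum2)
  qed
  moreover have "G v \<in> dsum (I # J # Ts)" if v: "v \<in> dsum (iprod I J # UNIV # Ts)" for v
  proof -
    have "v 0 + u * v 1 \<in> I" using v t_J submodD[OF Is] uc(1) by (auto simp: dsum2)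
    moreover have "c * v 1 - t (v 0) \<in> J"
      using v t_J submodD(3)[OF Js uc(2)] by (intro diffI[OF Js]) (auto simp: dsum2)
    ultimately show ?thesis using v by (simp add: G_def dsum2)
  qed
  moreover have "G (F v) = v" if v: "v \<in> dsum (I # J # Ts)" for v
  proof -
    define x y where "x = v 0" and "y = v 1"
    have x: "x \<in> I" using v by (simp add: x_def dsum2)
    have "x = c * x + u * t x"
    proof -
      have "d * (c * x + u * t x) = (b * u + d * c) * x" using t[OF x] by (simp add: algebra_simps)
      then have "d * (c * x + u * t x) = d * x" unfolding uc(3) .
      then show ?thesis using I'(2) by simp
    qed
    moreover have "c * (t x + y) - t (c * x - u * y) = y"
    proof -
      have m: "c * x \<in> I" "u * y \<in> I" using submod_mult_left[OF Is x] submodD(3)[OF Is uc(1)]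
        by auto
      have "d * t (c * x - u * y) = b * (c * x - u * y)" using t[OF diffI[OF Is m]] by simp
      then have "d * (c * (t x + y) - t (c * x - u * y)) =
        (d * t x) * c + d * c * y - b * (c * x - u * y)"
        by (simp add: algebra_simps)
      also have "\<dots> = (b * u + d * c) * y" unfolding t[OF x, symmetric] by (simp add: algebra_simps)
      finally have "d * (c * (t x + y) - t (c * x - u * y)) = d * y" unfolding uc(3) .
      then show ?thesis using I'(2) by simp
    qed
    ultimately show ?thesis unfolding x_def y_def
      by (auto simp: F_def G_def fun_eq_iff algebra_simps)
  qed
  moreover have "F (G v) = v" if v: "v \<in> dsum (iprod I J # UNIV # Ts)" for v
  proof -
    define z w where "z = v 0" and "w = v 1"
    have z: "z \<in> I" using v t_J by (simp add: z_def dsum2)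
    have e1: "c * (z + u * w) - u * (c * w - t z) = z"
    proof -
      have "d * (c * (z + u * w) - u * (c * w - t z)) = (d * c) * z + u * (d * t z)"
        by (simp add: algebra_simps)
      also have "\<dots> = (b * u + d * c) * z" unfolding t[OF z, symmetric] by (simp add: algebra_simps)
      finally have "d * (c * (z + u * w) - u * (c * w - t z)) = d * z" unfolding uc(3) .
      then show ?thesis using I'(2) by simp
    qed
    have e2: "t (z + u * w) + (c * w - t z) = w"
    proof -
      have "t (z + u * w) = t z + t u * w"
        using t_add[OF z submodD(3)[OF Is uc(1)]] t_mult[OF uc(1)] by simp
      then have "d * (t (z + u * w) + (c * w - t z)) = (d * t u) * w + d * c * w"
        by (simp add: algebra_simps)
      also have "\<dots> = (b * u + d * c) * w" unfolding t[OF uc(1), symmetric]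
        by (simp add: algebra_simps)
      finally have "d * (t (z + u * w) + (c * w - t z)) = d * w" unfolding uc(3) .
      then show ?thesis using I'(2) by simp
    qed
    show ?thesis using e1 e2 unfolding z_def w_def by (auto simp: F_def G_def fun_eq_iff)
  qed
  ultimately show ?thesis by (intro isomorphic_submodsI[where f = F and g = G])
qed

lemma isomorphic_normal_form:
  assumes "\<And>J. J \<in> set (I # Is) \<Longrightarrow> nonzero_ideal (J :: 'a set)"
  shows "dsum_iso (I # Is) (iprods (I # Is) # replicate (length Is) UNIV)"
  using assms
proof (induction Is arbitrary: I)
  case Nil
  then have "iprods [I] = I" by (simp add: iprod_UNIV nonzero_ideal_def)
  then show ?case by (simp add: isomorphic_submods_refl)
next
  case (Cons J Js)
  have "nonzero_ideal (iprods (J # Js))" by (rule nonzero_ideal_iprods) (use Cons.prems in auto)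
  then have "dsum_iso (I # iprods (J # Js) # replicate (length Js) UNIV)
      (iprod I (iprods (J # Js)) # UNIV # replicate (length Js) UNIV)"
    using Cons.prems by (intro isomorphic_pair) auto
  moreover have "dsum_iso (I # J # Js) (I # iprods (J # Js) # replicate (length Js) UNIV)"
    by (rule isomorphic_dsum_Cons[OF isomorphic_submods_refl Cons.IH]) (use Cons.prems in auto)
  ultimately show ?case using isomorphic_submods_trans by fastforce
qed

text \<open>The existence half of Steinitz' classification.\<close>
theorem dsum_isoI:
  assumes "length Is = length Js" "ideal_equiv (iprods Is) (iprods Js)"
    and "\<And>I. I \<in> set Is \<Longrightarrow> nonzero_ideal (I :: 'a set)" "\<And>J. J \<in> set Js \<Longrightarrow> nonzero_ideal J"
  shows "dsum_iso Is Js"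
proof (cases Is)
  case Nil
  then show ?thesis using assms(1) by (simp add: isomorphic_submods_refl)
next
  case (Cons I Is')
  then obtain J Js' where J: "Js = J # Js'" using assms(1) by (cases Js) auto
  have "dsum_iso (iprods Is # replicate (length Is') UNIV) (iprods Js # replicate (length Js') UNIV)"
    using isomorphic_dsum_Cons[OF ideal_equiv_isomorphic[OF assms(2) submod_iprods] isomorphic_submods_refl]
      assms(1) Cons J by simp
  moreover have "dsum_iso Is (iprods Is # replicate (length Is') UNIV)"
    using isomorphic_normal_form[of I Is'] assms(3) Cons by simp
  moreover have "dsum_iso (iprods Js # replicate (length Js') UNIV) Js"
  proof (rule isomorphic_submods_sym)
    show "dsum_iso Js (iprods Js # replicate (length Js') UNIV)"
      using isomorphic_normal_form[of J Js'] assms(4) J by simp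
    show "submod (pointwise (*)) (dsum Js)"
      by (rule submod_dsum) (use assms(4) in \<open>auto simp: nonzero_ideal_def\<close>)
  qed
  ultimately show ?thesis using isomorphic_submods_trans by blast
qed

end

lemma module_action_pointwise_mult:
  "module_action (*) (1 :: 'a::comm_ring_1) (pointwise (*))"
  by unfold_locales (auto simp: pointwise_def fun_eq_iff algebra_simps)

text \<open>Over the field of fractions every linear map between direct sums of ideals is a matrix.
Its \<open>j\<close>th column can be read off from any nonzero element of the \<open>j\<close>th ideal.\<close>
lemma linear_coefficients:
  fixes Is :: "'a::idom set list"
  assumes f: "linear_on (pointwise (*)) (pointwise (*)) (dsum Is) f"
    and Is: "\<And>I. I \<in> set Is \<Longrightarrow> nonzero_ideal I"
  obtains A :: "nat \<Rightarrow> nat \<Rightarrow> 'a fract" where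
    "\<And>x i. x \<in> dsum Is \<Longrightarrow> to_frac (f x i) = (\<Sum>j<length Is. A i j * to_frac (x j))"
proof -
  interpret module_action "(*) :: 'a \<Rightarrow> 'a \<Rightarrow> 'a" 1 "pointwise (*)"
    by (rule module_action_pointwise_mult)
  have sub: "submod (*) I" if "I \<in> set Is" for I using Is[OF that] by (simp add: nonzero_ideal_def)
  have D: "submod (pointwise (*)) (dsum Is)" by (rule submod_dsum) (simp_all add: sub)
  have zero: "0 \<in> I" if "I \<in> set Is" for I using submodD(1)[OF sub[OF that]] .
  have "\<forall>j\<in>{..<length Is}. \<exists>c. c \<in> Is ! j \<and> c \<noteq> 0"
    using Is by (meson lessThan_iff nonzero_idealE nth_mem)
  then obtain c where c: "\<And>j. j < length Is \<Longrightarrow> c j \<in> Is ! j \<and> c j \<noteq> 0" by (metis lessThan_iff)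
  define A where "A i j = to_frac (f (single j (c j)) i) / to_frac (c j)" for i j
  have *: "to_frac (f (single j y) i) = A i j * to_frac y" if j: "j < length Is" "y \<in> Is ! j"
    for i j y
  proof -
    have "pointwise (*) (single j y) (c j) = pointwise (*) (single j (c j)) y"
      by (auto simp: pointwise_def single_def)
    moreover have "single j y \<in> dsum Is" "single j (c j) \<in> dsum Is"
      using j c by (auto intro!: single_in_dsum zero)
    ultimately have "pointwise (*) (f (single j y)) (c j) = pointwise (*) (f (single j (c j))) y"
      using linear_onD(2)[OF f] by metis
    then have "f (single j y) i * c j = f (single j (c j)) i * y"
      unfolding pointwise_def by (rule fun_cong)
    then have "to_frac (f (single j y) i) * to_frac (c j) =
      to_frac (f (single j (c j)) i) * to_frac y"
      unfolding to_frac_simps(2)[symmetric] by simp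
    moreover have "to_frac (c j) \<noteq> 0" using c[OF j(1)] unfolding to_frac_simps(7) by simp
    ultimately show ?thesis unfolding A_def by (metis nonzero_eq_divide_eq times_divide_eq_left)
  qed
  show ?thesis
  proof (rule that[of A])
    fix x i assume x: "x \<in> dsum Is"
    have xj: "x j \<in> Is ! j" if "j < length Is" for j using x that by (simp add: dsum_def)
    have "f x = (\<Sum>j<length Is. f (single j (x j)))"
      by (subst dsum_eq_sum_single[OF x], rule linear_on_sum[OF f D])
        (use xj in \<open>auto intro!: single_in_dsum zero\<close>)
    then have "to_frac (f x i) = (\<Sum>j<length Is. to_frac (f (single j (x j)) i))"
      by (simp add: to_frac_sum)
    also have "\<dots> = (\<Sum>j<length Is. A i j * to_frac (x j))"
      by (rule sum.cong) (use * xj in auto)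
    finally show "to_frac (f x i) = (\<Sum>j<length Is. A i j * to_frac (x j))" .
  qed
qed

lemma prod_in_iprods:
  "(\<And>i. i < length Is \<Longrightarrow> z i \<in> Is ! i) \<Longrightarrow> (\<Prod>i<length Is. z i) \<in> iprods Is"
proof (induction Is arbitrary: z)
  case (Cons I Is)
  have "(\<Prod>i<length Is. z (Suc i)) \<in> iprods Is" by (rule Cons.IH) (use Cons.prems in force)
  moreover have "z 0 \<in> I" using Cons.prems[of 0] by simp
  ultimately show ?case by (simp add: prod.lessThan_Suc_shift iprodI del: prod.lessThan_Suc)
qed simp

lemma iprods_least:
  assumes "submod (*) K" "\<And>z. (\<And>i. i < length Is \<Longrightarrow> z i \<in> Is ! i) \<Longrightarrow> (\<Prod>i<length Is. z i) \<in> K"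
  shows "iprods Is \<subseteq> K"
  using assms
proof (induction Is arbitrary: K)
  case Nil
  then have "1 \<in> K" by simp
  then show ?case using submodD(3)[OF Nil(1), of 1] by auto
next
  case (Cons I Is)
  have "x * y \<in> K" if xy: "x \<in> I" "y \<in> iprods Is" for x y
  proof -
    have "iprods Is \<subseteq> {y. \<forall>x\<in>I. y * x \<in> K}"
    proof (rule Cons.IH[OF submod_colon[OF Cons.prems(1)]])
      fix z :: "nat \<Rightarrow> 'a" assume z: "\<And>i. i < length Is \<Longrightarrow> z i \<in> Is ! i"
      have "(\<Prod>i<length (I # Is). case_nat x z i) \<in> K" if "x \<in> I" for x
        by (rule Cons.prems(2)) (use that z in \<open>auto split: nat.splits\<close>)
      then show "prod z {..<length Is} \<in> {y. \<forall>x\<in>I. y * x \<in> K}"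
        by (simp add: prod.lessThan_Suc_shift mult.commute del: prod.lessThan_Suc)
    qed
    then show ?thesis using xy by (auto simp: mult.commute)
  qed
  then show ?case using iprod_least[OF Cons.prems(1)] by simp
qed

text \<open>In the Leibniz expansion of \<open>det A \<cdot> \<Prod>i. z\<^sub>i\<close> with \<open>z\<^sub>i\<close> in the \<open>i\<close>th ideal, each term is,
up to sign, the product of the entries \<open>A\<^bsub>i,p(i)\<^esub> z\<^bsub>p(i)\<^esub>\<close>, and the \<open>i\<close>th of them lies in the
\<open>i\<close>th target ideal.\<close>
lemma det_maps_iprods:
  fixes Is :: "'a::idom set list"
  assumes f: "linear_on (pointwise (*)) (pointwise (*)) (dsum Is) f" "f ` dsum Is \<subseteq> dsum Js"
    and len: "length Is = n" "length Js = n"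
    and Is: "\<And>I. I \<in> set Is \<Longrightarrow> nonzero_ideal I"
    and A: "\<And>x i. x \<in> dsum Is \<Longrightarrow> to_frac (f x i) = (\<Sum>j<length Is. A i j * to_frac (x j))"
    and y: "y \<in> iprods Is"
  shows "det (mat n n (\<lambda>(i, j). A i j)) * to_frac y \<in> to_frac ` iprods Js"
proof -
  let ?d = "det (mat n n (\<lambda>(i, j). A i j))" and ?P = "to_frac ` iprods Js"
  have P: "0 \<in> ?P" "u + v \<in> ?P" "- u \<in> ?P" "u * to_frac a \<in> ?P" if "u \<in> ?P" "v \<in> ?P" for u v a
  proof -
    obtain u' v' where uv: "u' \<in> iprods Js" "u = to_frac u'" "v' \<in> iprods Js" "v = to_frac v'"
      using \<open>u \<in> ?P\<close> \<open>v \<in> ?P\<close> by blast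
    note S = submodD[OF submod_iprods[of Js]]
    have "to_frac 0 \<in> ?P" "to_frac (u' + v') \<in> ?P" "to_frac (u' * (- 1)) \<in> ?P"
      "to_frac (u' * a) \<in> ?P"
      using S(1) S(2)[OF uv(1,3)] S(3)[OF uv(1)] by blast+
    then show "0 \<in> ?P" "u + v \<in> ?P" "- u \<in> ?P" "u * to_frac a \<in> ?P"
      unfolding uv(2,4) to_frac_simps by (simp_all del: add_fract mult_fract minus_fract)
  qed
  have P0: "0 \<in> ?P" using submodD(1)[OF submod_iprods] to_frac_simps(3) by (metis imageI)
  have Psum: "sum u S \<in> ?P" if "\<And>p. p \<in> S \<Longrightarrow> u p \<in> ?P" for u and S :: "(nat \<Rightarrow> nat) set"
    using that by (induction S rule: infinite_finite_induct) (simp_all add: P0 P(2))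
  have "submod (*) {y. ?d * to_frac y \<in> ?P}"
    unfolding submod_def mem_Collect_eq to_frac_simps distrib_left mult.assoc[symmetric]
    using P P0 by (simp del: add_fract mult_fract)
  moreover have "?d * to_frac (\<Prod>i<n. z i) \<in> ?P" if z: "\<And>i. i < n \<Longrightarrow> z i \<in> Is ! i" for z
  proof -
    have zero: "0 \<in> I" if "I \<in> set Is" for I using Is[OF that] submodD(1)
      by (auto simp: nonzero_ideal_def)
    have Az: "A i j * to_frac (z j) = to_frac (f (single j (z j)) i)" if "j < n" for i j
    proof -
      have "single j (z j) \<in> dsum Is" using that z len by (intro single_in_dsum zero) auto
      from A[OF this, of i] have "to_frac (f (single j (z j)) i) =
          (\<Sum>l<n. A i l * to_frac (single j (z j) l))" using len by simp
      also have "\<dots> = (\<Sum>l<n. if l = j then A i j * to_frac (z j) else 0)"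
        by (rule sum.cong) (auto simp: single_def to_frac_simps)
      finally show ?thesis using that by simp
    qed
    have fz: "f (single j (z j)) i \<in> Js ! i" if "i < n" "j < n" for i j
    proof -
      have "single j (z j) \<in> dsum Is" using that z len by (intro single_in_dsum zero) auto
      then have "f (single j (z j)) \<in> dsum Js" using f(2) by blast
      then show ?thesis using that len by (simp add: dsum_def)
    qed
    have "?d * to_frac (\<Prod>i<n. z i) = (\<Sum>p | p permutes {0..<n}.
        signof p * (\<Prod>i = 0..<n. A i (p i)) * to_frac (\<Prod>i<n. z i))"
      by (subst det_def'[of _ n]) (auto simp: sum_distrib_right intro!: sum.cong prod.cong simp: permutes_in_image)
    also have "\<dots> \<in> ?P"
    proof (rule Psum)
      fix p assume "p \<in> {p. p permutes {0..<n}}"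
      then have p: "p permutes {..<n}" by (simp add: atLeast0LessThan)
      have pn: "p i < n" if "i < n" for i using permutes_in_image[OF p, of i] that by simp
      have "to_frac (\<Prod>i<n. z i) = (\<Prod>i<n. to_frac (z (p i)))"
        unfolding to_frac_prod using prod.permute[OF p, of "\<lambda>i. to_frac (z i)"]
          by (simp add: comp_def)
      then have "(\<Prod>i = 0..<n. A i (p i)) * to_frac (\<Prod>i<n. z i) =
        (\<Prod>i<n. A i (p i) * to_frac (z (p i)))"
        by (simp add: atLeast0LessThan prod.distrib)
      also have "\<dots> = (\<Prod>i<n. to_frac (f (single (p i) (z (p i))) i))"
        by (rule prod.cong) (use Az pn in auto)
      also have "\<dots> = to_frac (\<Prod>i<length Js. f (single (p i) (z (p i))) i)"
        by (simp add: to_frac_prod len)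
      also have "\<dots> \<in> ?P" by (intro imageI prod_in_iprods) (use fz pn len in auto)
      finally have in_P: "(\<Prod>i = 0..<n. A i (p i)) * to_frac (\<Prod>i<n. z i) \<in> ?P" .
      show "signof p * (\<Prod>i = 0..<n. A i (p i)) * to_frac (\<Prod>i<n. z i) \<in> ?P"
        using in_P P(3)[OF in_P in_P] by (cases p rule: sign_cases) (simp_all add: mult.assoc)
    qed
    finally show ?thesis .
  qed
  ultimately have "iprods Is \<subseteq> {y. ?d * to_frac y \<in> ?P}" using len by (intro iprods_least) auto
  then show ?thesis using y by blast
qed

lemma coefficients_inverse:
  fixes Is :: "'a::idom set list"
  assumes fg: "\<And>x. x \<in> dsum Is \<Longrightarrow> f x \<in> dsum Js \<and> g (f x) = x"
    and Is: "\<And>I. I \<in> set Is \<Longrightarrow> nonzero_ideal I"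
    and A: "\<And>x i. x \<in> dsum Is \<Longrightarrow> to_frac (f x i) = (\<Sum>j<length Is. A i j * to_frac (x j))"
    and B: "\<And>x i. x \<in> dsum Js \<Longrightarrow> to_frac (g x i) = (\<Sum>j<length Js. B i j * to_frac (x j))"
    and kj: "k < length Is" "j < length Is"
  shows "(\<Sum>i<length Js. B k i * A i j) = (if k = j then 1 else 0)"
proof -
  obtain c where c: "c \<in> Is ! j" "c \<noteq> 0" using Is kj(2) by (meson nonzero_idealE nth_mem)
  have zero: "0 \<in> I" if "I \<in> set Is" for I using Is[OF that] submodD(1)
    by (auto simp: nonzero_ideal_def)
  define x where "x = single j c"
  have x: "x \<in> dsum Is" unfolding x_def using c kj by (intro single_in_dsum zero) auto
  have fx: "to_frac (f x i) = A i j * to_frac c" for i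
  proof -
    have "to_frac (f x i) = (\<Sum>l<length Is. if l = j then A i j * to_frac c else 0)"
      unfolding A[OF x] by (rule sum.cong) (auto simp: x_def single_def to_frac_simps)
    then show ?thesis using kj by simp
  qed
  have "to_frac (x k) = (\<Sum>i<length Js. B k i * to_frac (f x i))"
    using B[of "f x" k] fg[OF x] by simp
  also have "\<dots> = (\<Sum>i<length Js. B k i * A i j) * to_frac c"
    unfolding fx sum_distrib_right by (simp only: mult.assoc)
  finally have eq: "(\<Sum>i<length Js. B k i * A i j) * to_frac c = (if k =
    j then 1 else 0) * to_frac c"
    by (auto simp: x_def single_def to_frac_simps)
  have "to_frac c \<noteq> 0" using c(2) unfolding to_frac_simps(7) .
  from mult_right_cancel[OF this, THEN iffD1, OF eq] show ?thesis .
qed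

text \<open>Invariance of rank: otherwise both matrices can be padded with zeros to inverse square
matrices, one of which has a zero row.\<close>
lemma rank_le_of_right_inverse:
  fixes A B :: "nat \<Rightarrow> nat \<Rightarrow> 'k::field"
  assumes AB: "\<And>i k. i < s \<Longrightarrow> k < s \<Longrightarrow> (\<Sum>j<r. A i j * B j k) = (if i = k then 1 else 0)"
  shows "s \<le> r"
proof (rule ccontr)
  assume "\<not> s \<le> r"
  then have r: "r < s" by simp
  define A' where "A' = mat s s (\<lambda>(i, j). if j < r then A i j else 0)"
  define B' where "B' = mat s s (\<lambda>(i, j). if i < r then B i j else 0)"
  have AB': "A' \<in> carrier_mat s s" "B' \<in> carrier_mat s s" by (simp_all add: A'_def B'_def)
  have "A' * B' = 1\<^sub>m s"
  proof (rule eq_matI)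
    fix i k assume ik: "i < dim_row (1\<^sub>m s :: 'k mat)" "k < dim_col (1\<^sub>m s :: 'k mat)"
    then have "(A' * B') $$ (i, k) = (\<Sum>j = 0..<s. if j < r then A i j * B j k else 0)"
      by (auto simp: A'_def B'_def scalar_prod_def intro!: sum.cong)
    also have "\<dots> = (\<Sum>j<r. A i j * B j k)"
      using r by (intro sum.mono_neutral_cong_right) auto
    finally show "(A' * B') $$ (i, k) = (1\<^sub>m s :: 'k mat) $$ (i, k)" using AB ik by simp
  qed (use AB' in auto)
  then have "B' * A' = 1\<^sub>m s" by (rule mat_mult_left_right_inverse[OF AB'])
  then have "(B' * A') $$ (r, r) = 1" using r by simp
  moreover have "(B' * A') $$ (r, r) = 0" using r by (simp add: A'_def B'_def scalar_prod_def)
  ultimately show False by simp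
qed

text \<open>The uniqueness half of Steinitz' classification: the determinant \<open>p/q\<close> of an isomorphism
maps the product of the first list onto the product of the second.\<close>
theorem dsum_isoD:
  fixes Is Js :: "'a::idom set list"
  assumes iso: "dsum_iso Is Js"
    and Is: "\<And>I. I \<in> set Is \<Longrightarrow> nonzero_ideal I" and Js: "\<And>J. J \<in> set Js \<Longrightarrow> nonzero_ideal J"
  shows "length Is = length Js" "ideal_equiv (iprods Is) (iprods Js)"
proof -
  obtain f where f: "linear_on (pointwise (*)) (pointwise (*)) (dsum Is) f"
    "bij_betw f (dsum Is) (dsum Js)"
    using iso by (auto simp: isomorphic_submods_def)
  define g where "g = inv_into (dsum Is) f"
  have D: "submod (pointwise (*)) (dsum Is)"
    by (rule submod_dsum) (use Is in \<open>auto simp: nonzero_ideal_def\<close>)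
  have g: "linear_on (pointwise (*)) (pointwise (*)) (dsum Js) g"
    unfolding g_def by (rule linear_on_inv_into[OF f D])
  have fg: "f x \<in> dsum Js \<and> g (f x) = x" if "x \<in> dsum Is" for x
    using f(2) that by (auto simp: g_def bij_betw_def)
  have gf: "g x \<in> dsum Is \<and> f (g x) = x" if "x \<in> dsum Js" for x
    using f(2) that by (auto simp: g_def bij_betw_def f_inv_into_f inv_into_into)
  obtain A where A: "\<And>x i. x \<in> dsum Is \<Longrightarrow> to_frac (f x i) = (\<Sum>j<length Is. A i j * to_frac (x j))"
    using linear_coefficients[OF f(1) Is] by metis
  obtain B where B: "\<And>x i. x \<in> dsum Js \<Longrightarrow> to_frac (g x i) = (\<Sum>j<length Js. B i j * to_frac (x j))"
    using linear_coefficients[OF g Js] by metis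
  note BA = coefficients_inverse[of Is f Js g A B, OF fg Is A B]
  note AB = coefficients_inverse[of Js g Is f B A, OF gf Js B A]
  show len: "length Is = length Js"
    using rank_le_of_right_inverse[where A = B and B = A and r = "length Js" and s = "length Is"] BA
      rank_le_of_right_inverse[where A = A and B = B and r = "length Is" and s = "length Js"] AB
    by (meson le_antisym)
  define n where "n = length Is"
  define MA where "MA = mat n n (\<lambda>(i, j). A i j)"
  define MB where "MB = mat n n (\<lambda>(i, j). B i j)"
  have M: "MA \<in> carrier_mat n n" "MB \<in> carrier_mat n n" by (simp_all add: MA_def MB_def)
  have "MA * MB = 1\<^sub>m n"
  proof (rule eq_matI)
    fix i k assume ik: "i < dim_row (1\<^sub>m n :: 'a fract mat)" "k < dim_col (1\<^sub>m n :: 'a fract mat)"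
    then have "(MA * MB) $$ (i, k) = (\<Sum>j = 0..<n. A i j * B j k)"
      by (auto simp: MA_def MB_def scalar_prod_def intro!: sum.cong)
    then show "(MA * MB) $$ (i, k) = (1\<^sub>m n :: 'a fract mat) $$ (i, k)"
      using AB[of i k] ik len by (simp add: n_def atLeast0LessThan)
  qed (use M in auto)
  then have dAB: "det MA * det MB = 1" using det_mult[OF M] by simp
  obtain p q where pq: "det MA = Fraction_Field.Fract p q" "q \<noteq> 0" by (cases "det MA") auto
  have tq: "to_frac q \<noteq> 0" using pq(2) unfolding to_frac_simps(7) .
  have dA: "to_frac q * det MA = to_frac p" unfolding pq(1) using pq(2) by (simp add: eq_fract)
  have "det MA \<noteq> 0" using dAB by auto
  then have "to_frac p \<noteq> 0" using dA tq by (metis mult_eq_0_iff)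
  then have p0: "p \<noteq> 0" unfolding to_frac_simps(7) .
  have mul: "p * y = q * z" if "det MA * to_frac y = to_frac z" for y z
  proof -
    have "to_frac (p * y) = to_frac q * (det MA * to_frac y)"
      unfolding to_frac_simps(2) dA[symmetric] by (simp only: mult.assoc)
    then have "to_frac (p * y) = to_frac (q * z)" unfolding that to_frac_simps(2) .
    then show ?thesis unfolding to_frac_simps(6) .
  qed
  have "(*) p ` iprods Is \<subseteq> (*) q ` iprods Js"
  proof clarify
    fix y assume "y \<in> iprods Is"
    then have "det MA * to_frac y \<in> to_frac ` iprods Js"
      unfolding MA_def using fg A Is len by (intro det_maps_iprods[OF f(1)]) (auto simp: n_def)
    then show "p * y \<in> (*) q ` iprods Js" using mul by blast
  qed
  moreover have "(*) q ` iprods Js \<subseteq> (*) p ` iprods Is"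
  proof clarify
    fix z assume "z \<in> iprods Js"
    then have "det MB * to_frac z \<in> to_frac ` iprods Is"
      unfolding MB_def using gf B Js len by (intro det_maps_iprods[OF g]) (auto simp: n_def)
    then obtain y where y: "y \<in> iprods Is" "det MB * to_frac z = to_frac y" by blast
    have "det MA * to_frac y = to_frac z"
      unfolding y(2)[symmetric] mult.assoc[symmetric] dAB by (simp only: mult_1_left)
    from mul[OF this] show "q * z \<in> (*) p ` iprods Is" using y(1) by (metis imageI)
  qed
  ultimately show "ideal_equiv (iprods Is) (iprods Js)"
    unfolding ideal_equiv_def using p0 pq(2) by blast
qed

section \<open>Right ideals of the skew Laurent series ring\<close>

definition monomial :: "'a::zero \<Rightarrow> int \<Rightarrow> 'a fls" where
  "monomial a k = fls_shift (- k) (fls_const a)"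

lemma monomial_nth [simp]: "fls_nth (monomial a k) n = (if n = k then a else 0)"
  by (auto simp: monomial_def)

text \<open>The series in \<open>D[[x;\<sigma>]] x\<^sup>m\<close>. The predicate also holds for \<open>0\<close>, for which the subdegree
carries no information.\<close>
definition vanishes_below :: "int \<Rightarrow> 'a::zero fls \<Rightarrow> bool" where
  "vanishes_below m f \<longleftrightarrow> (\<forall>n<m. fls_nth f n = 0)"

lemma vanishes_belowD: "vanishes_below m f \<Longrightarrow> n < m \<Longrightarrow> fls_nth f n = 0"
  by (simp add: vanishes_below_def)

lemma vanishes_below_antimono: "vanishes_below m f \<Longrightarrow> n \<le> m \<Longrightarrow> vanishes_below n f"
  by (simp add: vanishes_below_def)

lemma exists_vanishes_below: "\<exists>m. vanishes_below m f"
  by (rule exI[of _ "fls_subdegree f"]) (simp add: vanishes_below_def)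

definition ser :: "'a::zero set \<Rightarrow> 'a fls set" where
  "ser L = {f. \<forall>n. fls_nth f n \<in> L}"

lemma ser_UNIV [simp]: "ser UNIV = UNIV"
  by (simp add: ser_def)

locale skew_dedekind = dedekind T for T :: "'a::idom itself" +
  fixes \<sigma> :: "'a \<Rightarrow> 'a"
  assumes aut: "ring_automorphism \<sigma>"
begin

abbreviation smul :: "'a fls \<Rightarrow> 'a fls \<Rightarrow> 'a fls" where "smul \<equiv> skew_mult \<sigma>"

abbreviation vmul :: "(nat \<Rightarrow> 'a fls) \<Rightarrow> 'a fls \<Rightarrow> nat \<Rightarrow> 'a fls" where "vmul \<equiv> pointwise smul"

abbreviation spow :: "int \<Rightarrow> 'a \<Rightarrow> 'a" where "spow \<equiv> aut_power \<sigma>"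

abbreviation ser_iso :: "'a set list \<Rightarrow> 'a set list \<Rightarrow> bool" where
  "ser_iso As Bs \<equiv>
     isomorphic_submods vmul vmul (dsum (map ser As)) (dsum (map ser Bs))"

lemma bij_sigma: "bij \<sigma>"
  using aut by (simp add: ring_automorphism_def)

lemmas spow_simps = aut_power_zero[OF aut] aut_power_one[OF aut] aut_power_add[OF aut]
  aut_power_mult[OF aut] aut_power_sum[OF aut]

lemma spow_inverse [simp]: "spow (- k) (spow k a) = a" "spow k (spow (- k) a) = a"
  using aut_power_add_exp[OF bij_sigma, of "- k" k a] aut_power_add_exp[OF bij_sigma, of k "- k" a]
  by simp_all

lemma spow_eq_0_iff [simp]: "spow k a = 0 \<longleftrightarrow> a = 0"
  by (metis spow_inverse(1) spow_simps(1))

lemma smul_nth_leading: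
  assumes "vanishes_below a f" "vanishes_below b g"
  shows "vanishes_below (a + b) (smul f g)"
    and "fls_nth (smul f g) (a + b) = fls_nth f a * spow a (fls_nth g b)"
proof -
  have *: "fls_nth (smul f g) n = (\<Sum>i = a..n - b. fls_nth f i * spow i (fls_nth g (n - i)))" for n
    by (rule skew_mult_nth_wide[OF aut]) (use assms in \<open>auto intro: vanishes_belowD\<close>)
  show "vanishes_below (a + b) (smul f g)" by (auto simp: vanishes_below_def *)
  show "fls_nth (smul f g) (a + b) = fls_nth f a * spow a (fls_nth g b)" by (simp add: *)
qed

lemma smul_monomial_nth: "fls_nth (smul f (monomial a k)) n = fls_nth f (n - k) * spow (n - k) a"
proof -
  have "fls_nth (smul f (monomial a k)) n =
      (\<Sum>i = min (fls_subdegree f) (n - k)..n - k. fls_nth f i * spow i (fls_nth (monomial a k) (n - i)))"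
    by (rule skew_mult_nth_wide[OF aut]) auto
  also have "\<dots> = (\<Sum>i = min (fls_subdegree f) (n - k)..n - k. if i =
    n - k then fls_nth f i * spow i a else 0)"
    by (rule sum.cong) (auto simp: spow_simps)
  finally show ?thesis by simp
qed

lemma smul_const_left_nth: "fls_nth (smul (monomial a 0) f) n = a * fls_nth f n"
proof -
  let ?u = "max 0 (n - fls_subdegree f)"
  have "fls_nth (smul (monomial a 0) f) n =
      (\<Sum>i = 0..?u. fls_nth (monomial a 0) i * spow i (fls_nth f (n - i)))"
    by (rule skew_mult_nth_wide[OF aut]) auto
  also have "\<dots> = (\<Sum>i = 0..?u. if i = 0 then a * fls_nth f n else 0)"
    by (rule sum.cong) auto
  finally show ?thesis by simp
qed

lemma smul_monomial_inverse [simp]: "smul (smul f (monomial 1 k)) (monomial 1 (- k)) = f"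
  "smul (smul f (monomial 1 (- k))) (monomial 1 k) = f"
  by (rule fls_eqI; simp add: smul_monomial_nth spow_simps)+

lemma smul_zero_left [simp]: "smul 0 f = 0"
  by (rule fls_eqI) (simp add: skew_mult_nth)

text \<open>The right action of \<open>D \<subseteq> R\<close> on series. It is twisted: on the coefficient of \<open>x\<^sup>n\<close> the
element \<open>d\<close> acts through \<open>\<sigma>\<^sup>n\<close>.\<close>
definition dmul :: "'a fls \<Rightarrow> 'a \<Rightarrow> 'a fls" where
  "dmul f d = smul f (monomial d 0)"

abbreviation vdmul :: "(nat \<Rightarrow> 'a fls) \<Rightarrow> 'a \<Rightarrow> nat \<Rightarrow> 'a fls" where "vdmul \<equiv> pointwise dmul"

lemma dmul_nth [simp]: "fls_nth (dmul f d) n = fls_nth f n * spow n d"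
  by (simp add: dmul_def smul_monomial_nth)

sublocale R: module_action smul 1 smul
  by unfold_locales (simp_all add: skew_mult_assoc[OF aut] skew_mult_distrib[OF aut] skew_mult_one[OF aut])

sublocale RV: module_action smul 1 vmul
  by unfold_locales
    (simp_all add: pointwise_def fun_eq_iff skew_mult_assoc[OF aut] skew_mult_distrib[OF aut] skew_mult_one[OF aut])

sublocale DV: module_action "(*)" 1 vdmul
  by unfold_locales
    (auto simp: pointwise_def fun_eq_iff spow_simps algebra_simps intro!: fls_eqI)

lemma submod_dmul: "submod vmul V \<Longrightarrow> submod vdmul V"
  by (auto simp: submod_def dmul_def pointwise_def)

lemma linear_on_dmul: "linear_on vmul vmul V f \<Longrightarrow> linear_on vdmul vdmul V f"
  by (auto simp: linear_on_def dmul_def[abs_def] pointwise_def)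

lemma submod_ser: 
  assumes "submod (*) L" shows "submod smul (ser L)"
  unfolding submod_def ser_def mem_Collect_eq skew_mult_nth
  using submodD[OF assms] by (auto intro!: submod_sum[OF assms])

definition coeffs_at :: "(nat \<Rightarrow> 'a fls) \<Rightarrow> int \<Rightarrow> nat \<Rightarrow> 'a" where
  "coeffs_at v n = (\<lambda>i. fls_nth (v i) n)"

definition bounded_below :: "(nat \<Rightarrow> 'a fls) \<Rightarrow> bool" where
  "bounded_below v \<longleftrightarrow> (\<exists>N. \<forall>i. vanishes_below N (v i))"

lemma bounded_below_dsum:
  assumes "v \<in> dsum Is" shows "bounded_below v"
proof -
  define N where "N = Min (insert 0 ((\<lambda>i. fls_subdegree (v i)) ` {..<length Is}))"
  have "vanishes_below N (v i)" for i
  proof (cases "i < length Is")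
    case True
    then have "N \<le> fls_subdegree (v i)" unfolding N_def by (intro Min_le) auto
    then show ?thesis by (simp add: vanishes_below_def)
  next
    case False
    then show ?thesis using assms by (simp add: dsum_def vanishes_below_def)
  qed
  then show ?thesis by (auto simp: bounded_below_def)
qed

text \<open>The extension of a \<open>D\<close>-linear functional to vectors of series, applied to the
coefficients. Each coefficient of \<open>v g\<close> is a \<open>D\<close>-linear combination of coefficients of \<open>v\<close>, so
the extension is linear for the right action of \<open>R\<close>.\<close>
definition lift :: "((nat \<Rightarrow> 'a) \<Rightarrow> 'a) \<Rightarrow> (nat \<Rightarrow> 'a fls) \<Rightarrow> 'a fls" where
  "lift h v = Abs_fls (\<lambda>n. h (coeffs_at v n))"

context
  fixes h :: "(nat \<Rightarrow> 'a) \<Rightarrow> 'a" and V :: "(nat \<Rightarrow> 'a) set"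
  assumes h: "linear_on (pointwise (*)) (*) V h" and V: "submod (pointwise (*)) V"
begin

lemma lift_nth:
  assumes "bounded_below v" shows "fls_nth (lift h v) n = h (coeffs_at v n)"
proof -
  interpret M: module_action "(*)" "1::'a" "pointwise (*)" by (rule module_action_pointwise_mult)
  obtain N where "\<And>i. vanishes_below N (v i)" using assms by (auto simp: bounded_below_def)
  then have "h (coeffs_at v n) = 0" if "n < N" for n
    using M.linear_on_zero[OF h V] that by (simp add: coeffs_at_def vanishes_below_def zero_fun_def)
  then show ?thesis unfolding lift_def by (intro nth_Abs_fls_ex_lower_bound) auto
qed

lemma lift_linear:
  assumes W: "\<And>v. v \<in> W \<Longrightarrow> bounded_below v \<and> (\<forall>n. coeffs_at v n \<in> V)" and WS: "submod vmul W"
  shows "linear_on vmul smul W (lift h)"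
proof (rule linear_onI)
  fix u v assume uv: "u \<in> W" "v \<in> W"
  have *: "coeffs_at (u + v) n = coeffs_at u n + coeffs_at v n" for n
    by (simp add: coeffs_at_def fun_eq_iff)
  show "lift h (u + v) = lift h u + lift h v"
    by (rule fls_eqI) (use uv W submodD(2)[OF WS uv] in \<open>simp add: lift_nth * linear_onD(1)[OF h]\<close>)
next
  interpret M: module_action "(*)" "1::'a" "pointwise (*)" by (rule module_action_pointwise_mult)
  fix v and g :: "'a fls" assume v: "v \<in> W"
  then obtain N where N: "\<And>i. vanishes_below N (v i)" using W[OF v] unfolding bounded_below_def
    by blast
  obtain b where b: "vanishes_below b g" using exists_vanishes_below by blast
  have vg: "vmul v g \<in> W" using submodD(3)[OF WS v] .
  have N': "vanishes_below N (lift h v)"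
    using N W[OF v] M.linear_on_zero[OF h V]
    by (simp add: vanishes_below_def lift_nth coeffs_at_def zero_fun_def[symmetric])
  show "lift h (vmul v g) = smul (lift h v) g"
  proof (rule fls_eqI)
    fix n
    let ?t = "\<lambda>i. spow i (fls_nth g (n - i))"
    have mem: "pointwise (*) (coeffs_at v i) c \<in> V" for i c using submodD(3)[OF V] W[OF v] by blast
    have "coeffs_at (vmul v g) n = (\<Sum>i = N..n - b. pointwise (*) (coeffs_at v i) (?t i))"
    proof
      fix j
      have "fls_nth (smul (v j) g) n = (\<Sum>i = N..n - b. fls_nth (v j) i * ?t i)"
        by (rule skew_mult_nth_wide[OF aut]) (use N b in \<open>auto intro: vanishes_belowD\<close>)
      then show "coeffs_at (vmul v g) n j = (\<Sum>i = N..n - b. pointwise (*) (coeffs_at v i) (?t i)) j"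
        by (simp add: coeffs_at_def pointwise_def)
    qed
    then have "fls_nth (lift h (vmul v g)) n = h (\<Sum>i =
      N..n - b. pointwise (*) (coeffs_at v i) (?t i))"
      using W[OF vg] by (simp add: lift_nth)
    also have "\<dots> = (\<Sum>i = N..n - b. h (pointwise (*) (coeffs_at v i) (?t i)))"
      by (rule M.linear_on_sum[OF h V mem])
    also have "\<dots> = (\<Sum>i = N..n - b. fls_nth (lift h v) i * ?t i)"
      using W[OF v] by (simp add: lift_nth linear_onD(2)[OF h])
    also have "\<dots> = fls_nth (smul (lift h v) g) n"
      by (rule skew_mult_nth_wide[OF aut, symmetric]) (use N' b in \<open>auto intro: vanishes_belowD\<close>)
    finally show "fls_nth (lift h (vmul v g)) n = fls_nth (smul (lift h v) g) n" .
  qed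
qed

end

text \<open>The case of a single series, obtained from constant vectors.\<close>
lemma linear_on_ser_coefficientwise:
  assumes h: "linear_on (*) (*) L h" and L: "submod (*) L"
  obtains H where "linear_on smul smul (ser L) H"
    "\<And>f n. f \<in> ser L \<Longrightarrow> fls_nth (H f) n = h (fls_nth f n)"
proof -
  let ?V = "{w :: nat \<Rightarrow> 'a. \<forall>i. w i \<in> L}"
    and ?W = "{v :: nat \<Rightarrow> 'a fls. bounded_below v \<and> (\<forall>n. \<forall>i. fls_nth (v i) n \<in> L)}"
  let ?h = "\<lambda>w :: nat \<Rightarrow> 'a. h (w 0)" and ?c = "\<lambda>f :: 'a fls. (\<lambda>i :: nat. f)"
  have h': "linear_on (pointwise (*)) (*) ?V ?h"
    by (rule linear_onI) (auto simp: pointwise_def linear_onD[OF h])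
  have V: "submod (pointwise (*)) ?V" using submodD[OF L] by (auto simp: submod_def pointwise_def)
  let ?U = "?c ` ser L"
  have c: "submod vmul ?U"
    using submodD[OF submod_ser[OF L]] unfolding submod_def
    by (auto simp: pointwise_def plus_fun_def zero_fun_def image_iff)
  have b: "bounded_below (?c f)" for f using exists_vanishes_below by (auto simp: bounded_below_def)
  have U: "bounded_below v \<and> (\<forall>n. coeffs_at v n \<in> ?V)" if "v \<in> ?U" for v
    using that b by (auto simp: coeffs_at_def ser_def)
  have lin: "linear_on vmul smul ?U (lift ?h)" by (rule lift_linear[OF h' V U c])
  show ?thesis
  proof (rule that[of "\<lambda>f. lift ?h (?c f)"])
    show "fls_nth (lift ?h (?c f)) n = h (fls_nth f n)" for f n
      using lift_nth[OF h' V b] by (simp add: coeffs_at_def)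
    show "linear_on smul smul (ser L) (\<lambda>f. lift ?h (?c f))"
      by (rule linear_on_compose[OF _ lin]) (auto simp: linear_on_def pointwise_def plus_fun_def)
  qed
qed

text \<open>The dual basis of \<open>L\<close> extends to \<open>L((x))\<close> coefficientwise; the coordinate functions then
respect the order of series.\<close>
lemma ser_dual_basis:
  assumes L: "nonzero_ideal L"
  shows "\<exists>(n::nat) a H. (\<forall>k<n. a k \<in> L \<and> linear_on smul smul (ser L) (H k) \<and>
      (\<forall>f\<in>ser L. \<forall>m. vanishes_below m f \<longrightarrow> vanishes_below m (H k f))) \<and>
    (\<forall>f\<in>ser L. \<forall>m. fls_nth f m = (\<Sum>k<n. a k * fls_nth (H k f) m))"
proof -
  have Ls: "submod (*) L" using L by (simp add: nonzero_ideal_def)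
  obtain n a h where ah: "\<And>k. k < (n::nat) \<Longrightarrow> a k \<in> L" "\<And>k. k < n \<Longrightarrow> linear_on (*) (*) L (h k)"
    and x: "\<And>x. x \<in> L \<Longrightarrow> x = (\<Sum>k<n. a k * h k x)"
    using dual_basis[OF L] unfolding has_dual_basis_def by blast
  have "\<exists>H. linear_on smul smul (ser L) H \<and> (\<forall>f\<in>ser L. \<forall>m. fls_nth (H f) m = h k (fls_nth f m))"
    if "k < n" for k
    using linear_on_ser_coefficientwise[OF ah(2)[OF that] Ls] by metis
  then obtain H where H: "\<And>k. k < n \<Longrightarrow> linear_on smul smul (ser L) (H k)"
    "\<And>k f m. k < n \<Longrightarrow> f \<in> ser L \<Longrightarrow> fls_nth (H k f) m = h k (fls_nth f m)" by metis
  interpret M: module_action "(*)" "1::'a" "(*)" by unfold_locales (auto simp: algebra_simps)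
  have "fls_nth f m = (\<Sum>k<n. a k * fls_nth (H k f) m)" if f: "f \<in> ser L" for f m
  proof -
    have "fls_nth f m \<in> L" using f by (simp add: ser_def)
    from x[OF this] show ?thesis using H(2) f by simp
  qed
  moreover have "vanishes_below m (H k f)" if "k < n" "f \<in> ser L" "vanishes_below m f" for k f m
    using that H(2) M.linear_on_zero[OF ah(2) Ls] by (simp add: vanishes_below_def)
  ultimately show ?thesis
    using ah(1) H(1) by (intro exI[of _ n] exI[of _ a] exI[of _ H]) blast
qed

lemma monomial_in_ser: "submod (*) L \<Longrightarrow> a \<in> L \<Longrightarrow> monomial a k \<in> ser L"
  using submodD(1) by (auto simp: ser_def)

lemma has_dual_basis_ser:
  assumes "nonzero_ideal L" shows "has_dual_basis smul (ser L)"
proof -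
  have Ls: "submod (*) L" using assms by (simp add: nonzero_ideal_def)
  obtain n :: nat and a H where aH: "\<And>k. k < n \<Longrightarrow> a k \<in> L"
    "\<And>k. k < n \<Longrightarrow> linear_on smul smul (ser L) (H k)"
    and f: "\<And>f m. f \<in> ser L \<Longrightarrow> fls_nth f m = (\<Sum>k<n. a k * fls_nth (H k f) m)"
    using ser_dual_basis[OF assms] by blast
  have "f = (\<Sum>k<n. smul (monomial (a k) 0) (H k f))" if "f \<in> ser L" for f
    by (rule fls_eqI) (simp add: fls_nth_sum smul_const_left_nth f[OF that])
  then show ?thesis unfolding has_dual_basis_def
    using aH monomial_in_ser[OF Ls]
    by (intro exI[of _ n] exI[of _ "\<lambda>k. monomial (a k) 0"] exI[of _ H]) auto
qed

lemma smul_monomial_one_nth: "fls_nth (smul f (monomial 1 k)) n = fls_nth f (n - k)"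
  by (simp add: smul_monomial_nth spow_simps)

lemma vanishes_below_shift: "vanishes_below (m + k) (smul f (monomial 1 k)) \<longleftrightarrow> vanishes_below m f"
proof
  assume *: "vanishes_below (m + k) (smul f (monomial 1 k))"
  have "fls_nth f n = 0" if "n < m" for n
    using vanishes_belowD[OF *, of "n + k"] that by (simp add: smul_monomial_one_nth)
  then show "vanishes_below m f" by (simp add: vanishes_below_def)
qed (auto simp: vanishes_below_def smul_monomial_one_nth)

text \<open>Let \<open>L\<close> be the ideal of leading coefficients, with generators \<open>a\<^sub>k\<close> and coordinate
functions \<open>h\<^sub>k\<close>, and choose \<open>F\<^sub>k\<close> in \<open>I \<inter> D[[x;\<sigma>]]\<close> with constant coefficient \<open>a\<^sub>k\<close>. The map \<open>S
c = \<Sum>k. F\<^sub>k (h\<^sub>k c)\<close> from \<open>L((x))\<close> to \<open>I\<close> preserves leading terms, because \<open>\<Sum>k. a\<^sub>k (h\<^sub>k y) = y\<close>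
for \<open>y \<in> L\<close>. Hence it is injective, and a preimage of \<open>g\<close> is found by removing one leading term
after the other; \<open>R\<close> is complete, so this converges.\<close>
theorem right_ideal_isomorphic_ser:
  assumes I: "submod smul I" "I \<noteq> {0}"
  shows "\<exists>L. nonzero_ideal L \<and> isomorphic_submods smul smul I (ser L)"
proof -
  define I0 where "I0 = {f \<in> I. vanishes_below 0 f}"
  define L where "L = (\<lambda>f. fls_nth f 0) ` I0"
  have lead_in_L: "fls_nth f m \<in> L" if "f \<in> I" "vanishes_below m f" for f m
  proof -
    let ?g = "smul f (monomial 1 (- m))"
    have "?g \<in> I0" using that submodD(3)[OF I(1)] vanishes_below_shift[of m "- m" f]
      by (simp add: I0_def)
    moreover have "fls_nth ?g 0 = fls_nth f m" by (simp add: smul_monomial_one_nth)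
    ultimately show ?thesis unfolding L_def by (metis imageI)
  qed
  have Ls: "submod (*) L" unfolding submod_def
  proof (intro conjI ballI allI)
    have "vanishes_below 0 (0 :: 'a fls)" by (simp add: vanishes_below_def)
    from lead_in_L[OF submodD(1)[OF I(1)] this] show "0 \<in> L" by simp
    fix x assume "x \<in> L"
    then obtain f where f: "f \<in> I0" "x = fls_nth f 0" unfolding L_def by blast
    have "dmul f a \<in> I" "vanishes_below 0 (dmul f a)" for a
      using f submodD(3)[OF I(1)] by (auto simp: I0_def vanishes_below_def) (simp add: dmul_def)
    from lead_in_L[OF this] show "x * a \<in> L" for a using f by simp
    fix y assume "y \<in> L"
    then obtain g where g: "g \<in> I0" "y = fls_nth g 0" unfolding L_def by blast
    have "f + g \<in> I" "vanishes_below 0 (f + g)"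
      using f g submodD(2)[OF I(1)] by (auto simp: I0_def vanishes_below_def)
    from lead_in_L[OF this] show "x + y \<in> L" using f g by simp
  qed
  obtain f0 where f0: "f0 \<in> I" "f0 \<noteq> 0" using I submodD(1)[OF I(1)] by blast
  have "fls_nth f0 (fls_subdegree f0) \<in> L" using f0
    by (intro lead_in_L) (auto simp: vanishes_below_def)
  moreover have "fls_nth f0 (fls_subdegree f0) \<noteq> 0" using f0 by simp
  ultimately have L: "nonzero_ideal L" using Ls by (auto simp: nonzero_ideal_def)
  obtain n :: nat and a H where aH: "\<And>k. k < n \<Longrightarrow> a k \<in> L"
    "\<And>k. k < n \<Longrightarrow> linear_on smul smul (ser L) (H k)"
    "\<And>f m k. k < n \<Longrightarrow> f \<in> ser L \<Longrightarrow> vanishes_below m f \<Longrightarrow> vanishes_below m (H k f)"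
    and x: "\<And>f m. f \<in> ser L \<Longrightarrow> fls_nth f m = (\<Sum>k<n. a k * fls_nth (H k f) m)"
    using ser_dual_basis[OF L] by blast
  define F where "F k = (SOME f. f \<in> I0 \<and> a k = fls_nth f 0)" for k
  have F: "F k \<in> I0 \<and> a k = fls_nth (F k) 0" if "k < n" for k
    unfolding F_def by (rule someI_ex) (use aH(1)[OF that] in \<open>auto simp: L_def\<close>)
  define S where "S c = (\<Sum>k<n. smul (F k) (H k c))" for c
  have S_lin: "linear_on smul smul (ser L) S"
    by (rule linear_onI) (auto simp: S_def R.act_add_right R.act_sum_left R.act_mul sum.distrib
        linear_onD(1)[OF aH(2)] linear_onD(2)[OF aH(2)])
  have S_I: "S c \<in> I" for c
    unfolding S_def by (rule submod_sum[OF I(1)]) (use F submodD(3)[OF I(1)] in \<open>auto simp: I0_def\<close>)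
  have serL: "submod smul (ser L)" by (rule submod_ser[OF Ls])
  have S_lead: "vanishes_below m (S c)" "fls_nth (S c) m = fls_nth c m"
    if c: "c \<in> ser L" "vanishes_below m c" for c m
  proof -
    have *: "vanishes_below m (smul (F k) (H k c))"
      "fls_nth (smul (F k) (H k c)) m = a k * fls_nth (H k c) m"
      if "k < n" for k
      using smul_nth_leading[of 0 "F k" m "H k c"] F[OF that] aH(3)[OF that c]
      by (auto simp: I0_def)
    show "vanishes_below m (S c)" using *(1) by (simp add: S_def vanishes_below_def fls_nth_sum)
    have "fls_nth (S c) m = (\<Sum>k<n. a k * fls_nth (H k c) m)" by (simp add: S_def fls_nth_sum *(2))
    then show "fls_nth (S c) m = fls_nth c m" using x[OF c(1)] by simp
  qed
  have inj: "inj_on S (ser L)"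
  proof (rule R.linear_on_inj[OF S_lin serL])
    fix c assume c: "c \<in> ser L" "S c = 0"
    show "c = 0"
    proof (rule ccontr)
      assume "c \<noteq> 0"
      moreover have "vanishes_below (fls_subdegree c) c" by (simp add: vanishes_below_def)
      ultimately show False using S_lead(2)[OF c(1), of "fls_subdegree c"] c(2) by simp
    qed
  qed
  have surj0: "g \<in> S ` ser L" if g: "g \<in> I" "vanishes_below 0 g" for g
  proof -
    \<comment> \<open>The \<open>m\<close>th approximation leaves a remainder of order at least \<open>m\<close>, whose coefficient at
      \<open>m\<close> is added next.\<close>
    define C where "C = rec_nat 0 (\<lambda>m c. c + monomial (fls_nth (g - S c) (int m)) (int m))"
    have C_simps: "C 0 = 0" "C (Suc m) = C m + monomial (fls_nth (g - S (C m)) (int m)) (int m)"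
      for m
      by (simp_all add: C_def)
    have S0: "S 0 = 0" by (rule R.linear_on_zero[OF S_lin serL])
    have inv: "C m \<in> ser L \<and> vanishes_below (int m) (g - S (C m)) \<and> vanishes_below 0 (C m) \<and>
        (\<forall>i\<ge>int m. fls_nth (C m) i = 0)" for m
    proof (induction m)
      case 0
      then show ?case using g(2) submodD(1)[OF serL]
        by (simp add: C_simps S0) (simp add: vanishes_below_def)
    next
      case (Suc m)
      let ?r = "g - S (C m)"
      let ?t = "monomial (fls_nth ?r (int m)) (int m)"
      have r: "?r \<in> I" by (rule R.submod_diff[OF I(1) g(1) S_I])
      have tL: "?t \<in> ser L" using lead_in_L[OF r] Suc by (intro monomial_in_ser[OF Ls]) auto
      have tv: "vanishes_below (int m) ?t" by (simp add: vanishes_below_def)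
      have eq: "g - S (C (Suc m)) = ?r - S ?t"
        using linear_onD(1)[OF S_lin, of "C m" ?t] Suc tL by (simp add: C_simps)
      have zero: "fls_nth (?r - S ?t) i = 0" if i: "i < int (Suc m)" for i
      proof (cases "i = int m")
        case True
        then show ?thesis using S_lead(2)[OF tL tv] by simp
      next
        case False
        then have "i < int m" using i by simp
        then show ?thesis using S_lead(1)[OF tL tv] Suc by (simp add: vanishes_below_def)
      qed
      have "vanishes_below (int (Suc m)) (g - S (C (Suc m)))"
        unfolding eq vanishes_below_def using zero by blast
      moreover have "C (Suc m) \<in> ser L"
        unfolding C_simps(2) using Suc tL by (intro submodD(2)[OF serL]) auto
      moreover have "vanishes_below 0 (C (Suc m))" "\<forall>i\<ge>int (Suc m). fls_nth (C (Suc m)) i = 0"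
        unfolding C_simps(2) vanishes_below_def using Suc by (auto simp: vanishes_below_def)
      ultimately show ?case by blast
    qed
    have stable: "fls_nth (C (m + j)) i = fls_nth (C m) i" if "i < int m" for i m j
      using that by (induction j) (simp_all add: C_simps)
    define c where "c = Abs_fls (\<lambda>i. if i < 0 then 0 else fls_nth (C (Suc (nat i))) i)"
    have c_nth: "fls_nth c i = (if i < 0 then 0 else fls_nth (C (Suc (nat i))) i)" for i
      unfolding c_def by (rule nth_Abs_fls_ex_lower_bound) (rule exI[of _ 0], simp)
    have cC: "fls_nth c i = fls_nth (C m) i" if "i < int m" for i m
    proof (cases "i < 0")
      case True
      then show ?thesis using inv[of m] by (simp add: c_nth vanishes_below_def)
    next
      case False
      then have "Suc (nat i) + (m - Suc (nat i)) = m" using that by linarith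
      then show ?thesis using False stable[of i "Suc (nat i)" "m - Suc (nat i)"]
        by (simp add: c_nth)
    qed
    have cL: "c \<in> ser L" using inv submodD(1)[OF Ls] by (auto simp: ser_def c_nth)
    have "fls_nth (g - S c) i = 0" for i
    proof -
      define m where "m = Suc (nat i)"
      have im: "i < int m" unfolding m_def by linarith
      have d: "c - C m \<in> ser L" "vanishes_below (int m) (c - C m)"
        using R.submod_diff[OF serL cL] inv[of m] cC by (auto simp: vanishes_below_def)
      have "S (c - C m) = S c - S (C m)" using R.linear_on_diff[OF S_lin serL cL] inv[of m] by blast
      then have eq: "g - S c = (g - S (C m)) - S (c - C m)" by simp
      have "fls_nth (g - S (C m)) i = 0" "fls_nth (S (c - C m)) i = 0"
        using vanishes_belowD[OF _ im] inv[of m] S_lead(1)[OF d] by blast+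
      then show ?thesis unfolding eq fls_minus_nth[of "g - S (C m)"] by (simp only: diff_0_right)
    qed
    then have "g - S c = 0" by (intro fls_eqI) simp
    then show ?thesis using cL by auto
  qed
  have "I \<subseteq> S ` ser L"
  proof
    fix g assume g: "g \<in> I"
    obtain m where m: "vanishes_below m g" using exists_vanishes_below by blast
    let ?g = "smul g (monomial 1 (- m))"
    have "?g \<in> S ` ser L"
      using g m submodD(3)[OF I(1)] vanishes_below_shift[of m "- m" g] by (intro surj0) auto
    then obtain c where c: "c \<in> ser L" "S c = ?g" by auto
    have "S (smul c (monomial 1 m)) = g" using linear_onD(2)[OF S_lin c(1)] c(2) by simp
    then show "g \<in> S ` ser L" using submodD(3)[OF serL c(1)] by (metis imageI)
  qed
  then have "bij_betw S (ser L) I" using inj S_I by (auto simp: bij_betw_def)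
  then have "isomorphic_submods smul smul (ser L) I" using S_lin
    by (auto simp: isomorphic_submods_def)
  then show ?thesis using isomorphic_submods_sym[OF _ serL] L by blast
qed

lemma submod_dsum_ser: "(\<And>L. L \<in> set Ls \<Longrightarrow> nonzero_ideal L) \<Longrightarrow> submod vmul (dsum (map ser Ls))"
  by (rule submod_dsum) (auto simp: nonzero_ideal_def intro!: submod_ser)

lemma flag_replace_ser:
  assumes "flag smul act U U' Is" "\<forall>I\<in>set Is. submod smul I \<and> I \<noteq> {0}"
  shows "\<exists>Ls. flag smul act U U' (map ser Ls) \<and> (\<forall>L\<in>set Ls. nonzero_ideal L)"
  using assms
proof (induction rule: flag.induct)
  case (Nil U)
  then show ?case using flag.Nil by (intro exI[of _ "[]"]) auto
next
  case (Cons U f I U' Is)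
  then obtain Ls where Ls: "flag smul act {u \<in> U. f u = 0} U' (map ser Ls)"
    "\<forall>L\<in>set Ls. nonzero_ideal L" by auto
  have I: "submod smul I" using Cons.prems by simp
  obtain L t where L: "nonzero_ideal L" and t: "linear_on smul smul I t" "bij_betw t I (ser L)"
    using right_ideal_isomorphic_ser[of I] Cons.prems by (auto simp: isomorphic_submods_def)
  have 1: "linear_on act smul U (\<lambda>u. t (f u))"
    by (rule linear_on_compose[OF Cons.hyps(1) t(1)]) (use Cons.hyps(2) in auto)
  have 2: "(\<lambda>u. t (f u)) ` U = ser L"
    using Cons.hyps(2) t(2) by (auto simp: bij_betw_def image_image[symmetric])
  have 3: "{u \<in> U. t (f u) = 0} = {u \<in> U. f u = 0}"
  proof -
    have "t x = 0 \<longleftrightarrow> x = 0" if "x \<in> I" for x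
      using that t(2) R.linear_on_zero[OF t(1) I] submodD(1)[OF I]
      by (metis bij_betw_def inj_on_eq_iff)
    then show ?thesis using Cons.hyps(2) by blast
  qed
  have "flag smul act U U' (ser L # map ser Ls)"
    by (rule flag.Cons[OF 1 2]) (simp only: 3 Ls(1))
  then show ?case using L Ls(2) by (intro exI[of _ "L # Ls"]) simp
qed

text \<open>The flag of \<open>R\<^sup>k\<close> given by the coordinates induces a flag of \<open>W\<close> whose quotients are right
ideals. They are projective, so the flag splits.\<close>
theorem submodule_of_free:
  assumes W: "submod vmul W" "\<And>v i. v \<in> W \<Longrightarrow> i \<ge> k \<Longrightarrow> v i = 0"
  shows "\<exists>Ls. (\<forall>L\<in>set Ls. nonzero_ideal L) \<and>
    isomorphic_submods vmul vmul W (dsum (map ser Ls))"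
proof -
  let ?V = "dsum (replicate k UNIV) :: (nat \<Rightarrow> 'a fls) set"
  have V: "submod vmul ?V" by (rule submod_dsum) auto
  have "flag smul vmul ?V {u \<in> ?V. u = 0} (replicate k UNIV)"
    by (rule RV.flag_of_linear_surjection) (auto simp: linear_on_def)
  moreover have "{u \<in> ?V. u = 0} = {0}" using submodD(1)[OF V] by blast
  ultimately have "flag smul vmul ?V {0} (replicate k UNIV)" by simp
  moreover have "{0} \<subseteq> W" "W \<subseteq> ?V" using submodD(1)[OF W(1)] W(2) by (auto simp: dsum_def)
  ultimately obtain Is where "flag smul vmul W {0} Is" "\<forall>I\<in>set Is. submod smul I \<and> I \<noteq> {0}"
    using RV.flag_submodule[OF _ V W(1)] by blast
  then obtain Ls where Ls: "flag smul vmul W {0} (map ser Ls)" "\<forall>L\<in>set Ls. nonzero_ideal L"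
    using flag_replace_ser[of "vmul" W "{0}"] by blast
  then obtain f where f: "linear_on vmul vmul W f" "f ` W = dsum (map ser Ls)"
      "{u \<in> W. f u = 0} = {0}"
    using RV.flag_splits[OF Ls(1) W(1)] has_dual_basis_ser by auto
  have "inj_on f W" by (rule RV.linear_on_inj[OF f(1) W(1)]) (use f(3) in blast)
  then show ?thesis using f Ls(2) by (auto simp: isomorphic_submods_def bij_betw_def)
qed

theorem dsum_iso_ser:
  assumes iso: "dsum_iso Is Js" and Is: "\<And>I. I \<in> set Is \<Longrightarrow> nonzero_ideal I"
    and Js: "\<And>J. J \<in> set Js \<Longrightarrow> nonzero_ideal J"
  shows "ser_iso Is Js"
proof -
  obtain f where f: "linear_on (pointwise (*)) (pointwise (*)) (dsum Is) f"
    "bij_betw f (dsum Is) (dsum Js)"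
    using iso by (auto simp: isomorphic_submods_def)
  have sub: "submod (pointwise (*)) (dsum Ks)" if "\<And>I. I \<in> set Ks \<Longrightarrow> nonzero_ideal I"
    for Ks :: "'a set list"
    by (rule submod_dsum) (use that in \<open>auto simp: nonzero_ideal_def\<close>)
  have "submod (pointwise (*)) (dsum Is)" by (rule sub) (rule Is)
  note g = linear_on_inv_into[OF f this]
  let ?g = "inv_into (dsum Is) f"
  have dsum_iff: "v \<in> dsum (map ser Ks) \<longleftrightarrow> (\<forall>n. coeffs_at v n \<in> dsum Ks)" for v
    and Ks :: "'a set list"
    by (auto simp: dsum_def ser_def coeffs_at_def fls_eq_iff)
  have comp: "linear_on (pointwise (*)) (*) V (\<lambda>w. h w j)"
    if "linear_on (pointwise (*)) (pointwise (*)) V h"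
    for V and h :: "(nat \<Rightarrow> 'a) \<Rightarrow> nat \<Rightarrow> 'a" and j
    using that by (auto simp: linear_on_def pointwise_def)
  define lv where "lv h v = (\<lambda>j. lift (\<lambda>w. h w j) v)" for h :: "(nat \<Rightarrow> 'a) \<Rightarrow> nat \<Rightarrow> 'a" and v
  have lv_coeffs: "coeffs_at (lv h v) n = h (coeffs_at v n)"
    if "linear_on (pointwise (*)) (pointwise (*)) (dsum Ks) h" "\<And>I. I \<in> set Ks \<Longrightarrow> nonzero_ideal I"
      "v \<in> dsum (map ser Ks)"
    for h Ks v n
    unfolding lv_def coeffs_at_def[of "\<lambda>j. lift (\<lambda>w. h w j) v"]
    using lift_nth[OF comp[OF that(1)] sub[OF that(2)] bounded_below_dsum[OF that(3)]]
    by (simp add: fun_eq_iff)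
  have lv_linear: "linear_on vmul vmul (dsum (map ser Ks)) (lv h)"
    if "linear_on (pointwise (*)) (pointwise (*)) (dsum Ks) h" "\<And>I. I \<in> set Ks \<Longrightarrow> nonzero_ideal I"
      for h Ks
  proof -
    have *: "bounded_below v \<and> (\<forall>n. coeffs_at v n \<in> dsum Ks)" if "v \<in> dsum (map ser Ks)" for v
      using bounded_below_dsum[OF that] that dsum_iff by blast
    have "linear_on vmul smul (dsum (map ser Ks)) (lift (\<lambda>w. h w j))" for j
      using lift_linear[OF comp[OF that(1)] sub[OF that(2)] * submod_dsum_ser[OF that(2)]] by blast
    then show ?thesis by (simp add: linear_on_def lv_def pointwise_def[abs_def] fun_eq_iff)
  qed
  have eqI: "u = v" if "\<And>n. coeffs_at u n = coeffs_at v n" for u v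
    using that by (auto simp: coeffs_at_def fun_eq_iff intro!: fls_eqI)
  have fg: "f x \<in> dsum Js \<and> ?g (f x) = x" if "x \<in> dsum Is" for x
    using f(2) that by (auto simp: bij_betw_def)
  have gf: "?g x \<in> dsum Is \<and> f (?g x) = x" if "x \<in> dsum Js" for x
    using f(2) that by (auto simp: bij_betw_def f_inv_into_f inv_into_into)
  have F: "coeffs_at (lv f v) n = f (coeffs_at v n)" if "v \<in> dsum (map ser Is)" for v n
    by (rule lv_coeffs[OF f(1) _ that]) (rule Is)
  have G: "coeffs_at (lv ?g v) n = ?g (coeffs_at v n)" if "v \<in> dsum (map ser Js)" for v n
    by (rule lv_coeffs[OF g _ that]) (rule Js)
  have F_mem: "lv f v \<in> dsum (map ser Js)" if "v \<in> dsum (map ser Is)" for v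
    using that fg F[OF that] unfolding dsum_iff by simp
  have G_mem: "lv ?g v \<in> dsum (map ser Is)" if "v \<in> dsum (map ser Js)" for v
    using that gf G[OF that] unfolding dsum_iff by simp
  show ?thesis
  proof (rule isomorphic_submodsI[where f = "lv f" and g = "lv ?g"])
    show "linear_on vmul vmul (dsum (map ser Is)) (lv f)"
      by (rule lv_linear[OF f(1) Is])
    show "lv ?g (lv f v) = v" if v: "v \<in> dsum (map ser Is)" for v
      by (rule eqI) (use v F[OF v] G[OF F_mem[OF v]] fg in \<open>simp add: dsum_iff\<close>)
    show "lv f (lv ?g v) = v" if v: "v \<in> dsum (map ser Js)" for v
      by (rule eqI) (use v G[OF v] F[OF G_mem[OF v]] gf in \<open>simp add: dsum_iff\<close>)
  qed (fact F_mem, fact G_mem)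
qed

end

section \<open>The order filtration\<close>

context skew_dedekind
begin

text \<open>The order filtration of a direct sum of modules \<open>L((x))\<close>; its members are \<open>D\<close>-submodules.\<close>
definition filt :: "'a set list \<Rightarrow> int \<Rightarrow> (nat \<Rightarrow> 'a fls) set" where
  "filt Ls j = {v \<in> dsum (map ser Ls). \<forall>i. vanishes_below j (v i)}"

abbreviation twist :: "int \<Rightarrow> 'a set list \<Rightarrow> 'a set list" where
  "twist k Ls \<equiv> map ((`) (spow k)) Ls"

lemma vanishes_below_add_one:
  assumes "vanishes_below j x" shows "vanishes_below (j + 1) x \<longleftrightarrow> fls_nth x j = 0"
proof
  assume zero: "fls_nth x j = 0"
  have "fls_nth x n = 0" if "n < j + 1" for n
    using that zero vanishes_belowD[OF assms, of n] by (cases "n = j") auto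
  then show "vanishes_below (j + 1) x" by (simp add: vanishes_below_def)
qed (simp add: vanishes_below_def)

lemma filt_antimono: "j \<le> m \<Longrightarrow> filt Ls m \<subseteq> filt Ls j"
  by (auto simp: filt_def intro: vanishes_below_antimono)

lemma submod_filt:
  assumes "\<And>L. L \<in> set Ls \<Longrightarrow> nonzero_ideal L"
  shows "submod vdmul (filt Ls j)"
proof -
  have D: "submod vdmul (dsum (map ser Ls))" by (rule submod_dmul[OF submod_dsum_ser[OF assms]])
  show ?thesis
    using submodD[OF D] unfolding submod_def filt_def
    by (simp add: vanishes_below_def pointwise_def)
qed

lemma nonzero_ideal_spow:
  assumes "nonzero_ideal L" shows "nonzero_ideal (spow k ` L)"
proof -
  obtain c where c: "c \<in> L" "c \<noteq> 0" "submod (*) L" using assms by (rule nonzero_idealE)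
  have "submod (*) (spow k ` L)" unfolding submod_def
  proof (intro conjI ballI allI)
    show "0 \<in> spow k ` L" using submodD(1)[OF c(3)] spow_simps(1) by (metis imageI)
    fix x assume "x \<in> spow k ` L"
    then obtain x' where x: "x' \<in> L" "x = spow k x'" by blast
    have "spow k (x' * spow (- k) a) \<in> spow k ` L" for a using submodD(3)[OF c(3) x(1)] by blast
    then show "x * a \<in> spow k ` L" for a by (simp add: x(2) spow_simps)
    fix y assume "y \<in> spow k ` L"
    then obtain y' where y: "y' \<in> L" "y = spow k y'" by blast
    have "spow k (x' + y') \<in> spow k ` L" using submodD(2)[OF c(3) x(1) y(1)] by blast
    then show "x + y \<in> spow k ` L" by (simp add: x(2) y(2) spow_simps)
  qed
  moreover have "spow k c \<in> spow k ` L" "spow k c \<noteq> 0" using c by auto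
  then have "spow k ` L \<noteq> {0}" by blast
  ultimately show ?thesis by (simp add: nonzero_ideal_def)
qed

text \<open>The quotient of two consecutive members of the filtration consists of the coefficients of
\<open>x\<^sup>j\<close>. Scalars act on them through \<open>\<sigma>\<^sup>j\<close>, so \<open>\<sigma>\<^sup>-\<^sup>j\<close> has to be applied to make this a \<open>D\<close>-linear
identification. The map \<open>\<psi>\<close> allows the filtration to be pulled back along an isomorphism.\<close>
lemma flag_graded:
  assumes lin: "linear_on vdmul vdmul V \<psi>" and img: "\<psi> ` V = filt Ls j"
    and Ls: "\<And>L. L \<in> set Ls \<Longrightarrow> nonzero_ideal L"
  shows "flag (*) vdmul V {v \<in> V. \<psi> v \<in> filt Ls (j + 1)} (twist (- j) Ls)"
proof -
  define f where "f v = (\<lambda>i. spow (- j) (fls_nth (\<psi> v i) j))" for v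
  have zero: "0 \<in> L" if "L \<in> set Ls" for L using Ls[OF that] submodD(1)
    by (auto simp: nonzero_ideal_def)
  have f_lin: "linear_on vdmul (pointwise (*)) V f"
  proof (rule linear_onI)
    fix u v assume uv: "u \<in> V" "v \<in> V"
    show "f (u + v) = f u + f v"
      unfolding f_def linear_onD(1)[OF lin uv] by (simp add: fun_eq_iff spow_simps)
  next
    fix u d assume u: "u \<in> V"
    show "f (vdmul u d) = pointwise (*) (f u) d"
      unfolding f_def linear_onD(2)[OF lin u] by (simp add: pointwise_def spow_simps)
  qed
  have "f ` V = dsum (twist (- j) Ls)"
  proof (intro equalityI subsetI)
    fix w assume "w \<in> f ` V"
    then obtain v where v: "v \<in> V" "w = f v" by blast
    then have "\<psi> v \<in> filt Ls j" using img by blast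
    then show "w \<in> dsum (twist (- j) Ls)"
      by (auto simp: v(2) filt_def dsum_def f_def ser_def spow_simps)
  next
    fix w assume w: "w \<in> dsum (twist (- j) Ls)"
    define u where "u = (\<lambda>i. monomial (spow j (w i)) j)"
    have "spow j (w i) \<in> Ls ! i" if "i < length Ls" for i
      using w that by (force simp: dsum_def)
    then have "u i \<in> ser (Ls ! i)" if "i < length Ls" for i
      using that zero unfolding u_def ser_def by simp
    moreover have "u i = 0" if "i \<ge> length Ls" for i
      using w that by (auto simp: u_def dsum_def spow_simps intro!: fls_eqI)
    ultimately have "u \<in> dsum (map ser Ls)" by (simp add: dsum_def)
    moreover have "vanishes_below j (u i)" for i by (simp add: vanishes_below_def u_def)
    ultimately have "u \<in> \<psi> ` V" unfolding img by (simp add: filt_def)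
    then obtain v where v: "v \<in> V" "\<psi> v = u" by blast
    then have "f v = w" by (simp add: f_def u_def)
    then show "w \<in> f ` V" using v(1) by blast
  qed
  moreover have "0 \<in> I" if I: "I \<in> set (twist (- j) Ls)" for I
  proof -
    obtain L where L: "L \<in> set Ls" "I = spow (- j) ` L" using I by auto
    have "spow (- j) 0 \<in> I" unfolding L(2) using zero[OF L(1)] by (rule imageI)
    then show ?thesis by (simp add: spow_simps)
  qed
  ultimately have "flag (*) vdmul V {v \<in> V. f v = 0} (twist (- j) Ls)"
    by (rule DV.flag_of_linear_surjection[OF f_lin])
  moreover have "f v = 0 \<longleftrightarrow> \<psi> v \<in> filt Ls (j + 1)" if "v \<in> V" for v
  proof -
    have mem: "\<psi> v \<in> filt Ls j" using img that by blast
    have "f v = 0 \<longleftrightarrow> (\<forall>i. fls_nth (\<psi> v i) j = 0)" by (simp add: f_def fun_eq_iff)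
    also have "\<dots> \<longleftrightarrow> (\<forall>i. vanishes_below (j + 1) (\<psi> v i))"
      using mem by (simp add: filt_def vanishes_below_add_one)
    also have "\<dots> \<longleftrightarrow> \<psi> v \<in> filt Ls (j + 1)" using mem by (simp add: filt_def)
    finally show ?thesis .
  qed
  then have "{v \<in> V. f v = 0} = {v \<in> V. \<psi> v \<in> filt Ls (j + 1)}" by blast
  ultimately show ?thesis by simp
qed

lemma flag_filt_step:
  assumes "\<And>L. L \<in> set Ls \<Longrightarrow> nonzero_ideal L"
  shows "flag (*) vdmul (filt Ls j) (filt Ls (j + 1)) (twist (- j) Ls)"
proof -
  have "{v \<in> filt Ls j. v \<in> filt Ls (j + 1)} = filt Ls (j + 1)" using filt_antimono[of j "j + 1" Ls]
    by auto
  moreover have "linear_on vdmul vdmul (filt Ls j) (\<lambda>v. v)" by (simp add: linear_on_def)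
  ultimately show ?thesis using flag_graded[of "filt Ls j" "\<lambda>v. v" Ls j] assms by simp
qed

lemma flag_filt:
  assumes "\<And>L. L \<in> set Ls \<Longrightarrow> nonzero_ideal L" and "j \<le> m"
  shows "\<exists>Is. flag (*) vdmul (filt Ls j) (filt Ls m) Is"
  using assms(2)
proof (induction m rule: int_ge_induct)
  case base
  show ?case using flag.Nil by metis
next
  case (step m)
  then show ?case using DV.flag_append flag_filt_step[OF assms(1)] by blast
qed

definition shift :: "int \<Rightarrow> (nat \<Rightarrow> 'a fls) \<Rightarrow> nat \<Rightarrow> 'a fls" where
  "shift k v = vmul v (monomial 1 k)"

lemma shift_inverse [simp]: "shift (- k) (shift k v) = v" "shift k (shift (- k) v) = v"
  by (simp_all add: shift_def pointwise_def)

lemma shift_filt: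
  assumes "\<And>L. L \<in> set Ls \<Longrightarrow> nonzero_ideal L"
  shows "shift k ` filt Ls j = filt Ls (j + k)"
proof -
  have *: "shift k v \<in> filt Ls (j + k)" if "v \<in> filt Ls j" for v j k
    using that submodD(3)[OF submod_dsum_ser[OF assms]]
    by (simp add: filt_def shift_def) (simp add: pointwise_def vanishes_below_shift)
  show ?thesis
  proof (intro equalityI subsetI)
    fix v assume "v \<in> filt Ls (j + k)"
    then have "shift (- k) v \<in> filt Ls j" using *[of v "j + k" "- k"] by simp
    then show "v \<in> shift k ` filt Ls j" by (intro image_eqI[of _ _ "shift (- k) v"]) simp_all
  qed (use * in auto)
qed

text \<open>Right multiplication by \<open>x\<close> is semilinear, since \<open>x d = \<sigma>(d) x\<close>; conjugating with it
twists the quotients by \<open>\<sigma>\<^sup>-\<^sup>1\<close>.\<close>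
lemma flag_shift:
  assumes "flag (*) vdmul U U' Is"
  shows "flag (*) vdmul (shift 1 ` U) (shift 1 ` U') (twist (- 1) Is)"
  using assms
proof (induction rule: flag.induct)
  case (Nil U)
  then show ?case by (simp add: flag.Nil)
next
  case (Cons U f I U' Is)
  define g where "g w = spow (- 1) (f (shift (- 1) w))" for w
  have X: "shift (- 1) (u + v) = shift (- 1) u + shift (- 1) v"
    "shift (- 1) (vdmul u d) = vdmul (shift (- 1) u) (spow 1 d)" for u v d
  proof -
    show "shift (- 1) (u + v) = shift (- 1) u + shift (- 1) v"
      by (simp add: shift_def RV.act_add_left)
    show "shift (- 1) (vdmul u d) = vdmul (shift (- 1) u) (spow 1 d)"
      using aut_power_add_exp[OF bij_sigma, of _ 1 d]
      by (auto simp: shift_def pointwise_def fun_eq_iff smul_monomial_one_nth intro!: fls_eqI)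
  qed
  have mem: "shift (- 1) w \<in> U" if "w \<in> shift 1 ` U" for w using that by auto
  have 1: "linear_on vdmul (*) (shift 1 ` U) g"
    by (rule linear_onI) (use mem in \<open>auto simp: g_def X linear_onD[OF Cons.hyps(1)] spow_simps\<close>)
  have 2: "g ` shift 1 ` U = spow (- 1) ` I"
    unfolding Cons.hyps(2)[symmetric] by (simp add: image_image g_def)
  have 3: "{w \<in> shift 1 ` U. g w = 0} = shift 1 ` {u \<in> U. f u = 0}"
    by (auto simp: g_def)
  show ?case using flag.Cons[OF 1 2, unfolded 3, OF Cons.IH] by simp
qed

text \<open>A linear map lowers orders by a bounded amount, because a direct sum of modules \<open>L((x))\<close>
is generated by finitely many constant vectors with coordinate functions that respect orders.\<close>
lemma linear_shifts_filtration:
  assumes \<phi>: "linear_on vmul vmul (dsum (map ser As)) \<phi>"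
    "\<phi> ` dsum (map ser As) \<subseteq> dsum (map ser Bs)"
    and As: "\<And>L. L \<in> set As \<Longrightarrow> nonzero_ideal L"
  shows "\<exists>c. \<forall>j. \<phi> ` filt As j \<subseteq> filt Bs (j + c)"
proof -
  let ?V = "dsum (map ser As)"
  have V: "submod vmul ?V" by (rule submod_dsum_ser[OF As])
  have sub: "submod smul I" if "I \<in> set (map ser As)" for I
    using that As by (auto simp: nonzero_ideal_def intro!: submod_ser)
  have sV: "single i x \<in> ?V" if "i < length As" "x \<in> ser (As ! i)" for i x
    using that submodD(1)[OF sub] by (intro single_in_dsum) auto
  have "\<exists>c. \<forall>x\<in>ser (As ! i). \<forall>j. vanishes_below j x \<longrightarrow> (\<forall>l. vanishes_below (j + c) (\<phi> (single i x) l))"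
    if i: "i < length As" for i
  proof -
    have L: "nonzero_ideal (As ! i)" using As i by simp
    then have Ls: "submod (*) (As ! i)" by (simp add: nonzero_ideal_def)
    obtain n :: nat and a H where aH: "\<And>k. k < n \<Longrightarrow> a k \<in> As ! i"
      "\<And>f m k. k < n \<Longrightarrow> f \<in> ser (As ! i) \<Longrightarrow> vanishes_below m f \<Longrightarrow> vanishes_below m (H k f)"
      and x: "\<And>f m. f \<in> ser (As ! i) \<Longrightarrow> fls_nth f m = (\<Sum>k<n. a k * fls_nth (H k f) m)"
      using ser_dual_basis[OF L] by blast
    let ?e = "\<lambda>k. single i (monomial (a k) 0)"
    have e: "?e k \<in> ?V" if "k < n" for k by (rule sV[OF i monomial_in_ser[OF Ls aH(1)[OF that]]])
    have "\<exists>N. \<forall>l. vanishes_below N (\<phi> (?e k) l)" if "k < n" for k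
    proof -
      have "\<phi> (?e k) \<in> dsum (map ser Bs)" using e[OF that] \<phi>(2) by blast
      from bounded_below_dsum[OF this] show ?thesis by (simp add: bounded_below_def)
    qed
    then obtain N where N: "\<And>k l. k < n \<Longrightarrow> vanishes_below (N k) (\<phi> (?e k) l)" by metis
    define c where "c = Min (insert 0 (N ` {..<n}))"
    have cN: "c \<le> N k" if "k < n" for k unfolding c_def using that by (intro Min_le) auto
    have "vanishes_below (j + c) (\<phi> (single i y) l)" if y: "y \<in> ser (As ! i)" "vanishes_below j y"
      for y j l
    proof -
      have "single i y = (\<Sum>k<n. vmul (?e k) (H k y))"
      proof
        fix t
        have "y = (\<Sum>k<n. smul (monomial (a k) 0) (H k y))"
          by (rule fls_eqI) (simp add: fls_nth_sum smul_const_left_nth x[OF y(1)])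
        then show "single i y t = (\<Sum>k<n. vmul (?e k) (H k y)) t"
          by (simp add: single_def pointwise_def)
      qed
      then have "\<phi> (single i y) = (\<Sum>k<n. \<phi> (vmul (?e k) (H k y)))"
        using RV.linear_on_sum[OF \<phi>(1) V, of "{..<n}" "\<lambda>k. vmul (?e k) (H k y)"] submodD(3)[OF V e]
        by simp
      also have "\<dots> = (\<Sum>k<n. vmul (\<phi> (?e k)) (H k y))"
        by (rule sum.cong) (use linear_onD(2)[OF \<phi>(1) e] in auto)
      finally have eq: "\<phi> (single i y) l = (\<Sum>k<n. smul (\<phi> (?e k) l) (H k y))"
        by (simp add: pointwise_def)
      have "vanishes_below (j + c) (smul (\<phi> (?e k) l) (H k y))" if "k < n" for k
        using smul_nth_leading(1)[OF N[OF that] aH(2)[OF that y], of l] cN[OF that]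
        by (elim vanishes_below_antimono) simp
      then show ?thesis unfolding eq by (simp add: vanishes_below_def fls_nth_sum)
    qed
    then show ?thesis by blast
  qed
  then obtain c where c: "\<And>i x j l. i < length As \<Longrightarrow> x \<in> ser (As ! i) \<Longrightarrow> vanishes_below j x \<Longrightarrow>
      vanishes_below (j + c i) (\<phi> (single i x) l)" by metis
  \<comment> \<open>The element \<open>0\<close> makes the set nonempty when there are no summands.\<close>
  define d where "d = Min (insert 0 (c ` {..<length As}))"
  have dc: "d \<le> c i" if "i < length As" for i unfolding d_def using that by (intro Min_le) auto
  have "\<phi> v \<in> filt Bs (j + d)" if v: "v \<in> filt As j" for v j
  proof -
    have vV: "v \<in> ?V" using v by (simp add: filt_def)
    have vi: "v i \<in> ser (As ! i)" if "i < length As" for i using vV that by (simp add: dsum_def)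
    have "v = (\<Sum>i<length As. single i (v i))" using dsum_eq_sum_single[OF vV] by simp
    then have "\<phi> v = \<phi> (\<Sum>i<length As. single i (v i))" by simp
    also have "\<dots> = (\<Sum>i<length As. \<phi> (single i (v i)))"
      by (rule RV.linear_on_sum[OF \<phi>(1) V]) (use sV vi in auto)
    finally have eq: "\<phi> v l = (\<Sum>i<length As. \<phi> (single i (v i)) l)" for l by simp
    have "vanishes_below (j + d) (\<phi> (single i (v i)) l)" if "i < length As" for i l
      using c[OF that vi[OF that], of j l] v dc[OF that]
      by (auto simp: filt_def elim: vanishes_below_antimono)
    then have "vanishes_below (j + d) (\<phi> v l)" for l unfolding eq
      by (simp add: vanishes_below_def fls_nth_sum)
    then show ?thesis using \<phi>(2) vV by (auto simp: filt_def)
  qed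
  then show ?thesis by blast
qed

text \<open>A \<open>D\<close>-isomorphism between nonzero ideals is multiplication by a fraction, here \<open>f c/c\<close>.\<close>
lemma ideal_equiv_spow:
  assumes "acts_trivially_on_class_group \<sigma>" and L: "nonzero_ideal L"
  shows "ideal_equiv (spow k ` L) L"
proof -
  have *: "ideal_equiv (\<sigma> ` I) I" if I: "nonzero_ideal I" for I
  proof -
    have s: "spow 1 = \<sigma>" using aut_power_Suc[OF bij_sigma, of 0] by auto
    obtain c where c: "c \<in> \<sigma> ` I" "c \<noteq> 0" "submod (*) (\<sigma> ` I)"
      using nonzero_ideal_spow[OF I, of 1] unfolding s by (rule nonzero_idealE)
    have "ideals_isomorphic (\<sigma> ` I) I"
      using assms(1) I by (simp add: acts_trivially_on_class_group_def submod_mult_iff_dom_ideal nonzero_ideal_def)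
    then obtain f where f_iso: "bij_betw f (\<sigma> ` I) I" "\<forall>a. \<forall>x\<in>\<sigma> ` I. f (a * x) = a * f x"
      unfolding ideals_isomorphic_def by (elim exE conjE)
    have f: "bij_betw f (\<sigma> ` I) I" "f (a * x) = a * f x" if "x \<in> \<sigma> ` I" for a x
      using f_iso(1) f_iso(2)[rule_format, OF that, of a] by auto
    have swap: "c * f y = f c * y" if "y \<in> \<sigma> ` I" for y
      using f(2)[OF that, of c] f(2)[OF c(1), of y] by (simp add: mult.commute[of y])
    have "f 0 = 0" using f(2)[OF c(1), of 0] by simp
    then have fc: "f c \<noteq> 0"
      using f_iso(1) c submodD(1)[OF c(3)] by (metis bij_betw_def inj_on_eq_iff)
    have "(*) (f c) ` \<sigma> ` I = (*) c ` f ` \<sigma> ` I"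
      unfolding image_image using swap by (intro image_cong) auto
    also have "f ` \<sigma> ` I = I" using f_iso(1) by (simp add: bij_betw_def)
    finally show ?thesis unfolding ideal_equiv_def using fc c(2) by blast
  qed
  have step: "ideal_equiv (spow (i + 1) ` L) (spow i ` L)" for i
  proof -
    have "spow (i + 1) ` L = \<sigma> ` spow i ` L" by (simp add: image_image aut_power_Suc[OF bij_sigma])
    then show ?thesis using *[OF nonzero_ideal_spow[OF L]] by simp
  qed
  show ?thesis
  proof (induction k rule: int_induct[where k = 0])
    case base
    show ?case by (simp add: ideal_equiv_refl)
  next
    case (step1 i)
    then show ?case using step ideal_equiv_trans by blast
  next
    case (step2 i)
    then show ?case using step[of "i - 1"] ideal_equiv_trans ideal_equiv_sym
      by (metis diff_add_cancel)
  qed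
qed

lemma iprods_twist:
  assumes "acts_trivially_on_class_group \<sigma>" "\<And>L. L \<in> set Ls \<Longrightarrow> nonzero_ideal L"
  shows "ideal_equiv (iprods (twist k Ls)) (iprods Ls)"
  by (rule ideal_equiv_iprods) (auto simp: list_all2_map1 intro!: list.rel_refl_strong ideal_equiv_spow[OF assms])

text \<open>Compare the two order filtrations of the same module, the second transported by the
isomorphism: the \<open>D\<close>-module \<open>G\<^sub>0/F\<^sub>m\<^sub>+\<^sub>1\<close> has a flag through \<open>F\<^sub>m\<close> and a flag through \<open>G\<^sub>1\<close>.
Both contain the quotients of \<open>G\<^sub>0/F\<^sub>m\<close>, the second one as the twisted quotients of
\<open>G\<^sub>1/F\<^sub>m\<^sub>+\<^sub>1\<close>.\<close>
theorem isomorphic_dsum_serD: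
  assumes triv: "acts_trivially_on_class_group \<sigma>"
    and iso: "ser_iso As Bs"
    and As: "\<And>L. L \<in> set As \<Longrightarrow> nonzero_ideal L" and Bs: "\<And>L. L \<in> set Bs \<Longrightarrow> nonzero_ideal L"
  shows "length As = length Bs" "ideal_equiv (iprods As) (iprods Bs)"
proof -
  let ?VA = "dsum (map ser As)" and ?VB = "dsum (map ser Bs)"
  have VA: "submod vmul ?VA" by (rule submod_dsum_ser[OF As])
  obtain \<phi> where \<phi>: "linear_on vmul vmul ?VA \<phi>" "bij_betw \<phi> ?VA ?VB"
    using iso by (auto simp: isomorphic_submods_def)
  define \<psi> where "\<psi> = inv_into ?VA \<phi>"
  have \<psi>: "linear_on vmul vmul ?VB \<psi>"
    unfolding \<psi>_def by (rule linear_on_inv_into[OF \<phi> VA])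
  have \<phi>\<psi>: "\<phi> v \<in> ?VB" "\<psi> (\<phi> v) = v" if "v \<in> ?VA" for v using that \<phi>(2)
    by (auto simp: \<psi>_def bij_betw_def)
  have \<psi>\<phi>: "\<psi> v \<in> ?VA" "\<phi> (\<psi> v) = v" if "v \<in> ?VB" for v
    using that \<phi>(2) by (auto simp: \<psi>_def bij_betw_def f_inv_into_f inv_into_into)
  have "\<exists>c. \<forall>j. \<phi> ` filt As j \<subseteq> filt Bs (j + c)"
    by (rule linear_shifts_filtration[OF \<phi>(1) _ As]) (use \<phi>\<psi>(1) in auto)
  then obtain c where c: "\<And>j. \<phi> ` filt As j \<subseteq> filt Bs (j + c)" by blast
  have "\<exists>c. \<forall>j. \<psi> ` filt Bs j \<subseteq> filt As (j + c)"
    by (rule linear_shifts_filtration[OF \<psi> _ Bs]) (use \<psi>\<phi>(1) in auto)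
  then obtain c' where c': "\<And>j. \<psi> ` filt Bs j \<subseteq> filt As (j + c')" by blast
  define G where "G j = {v \<in> ?VA. \<phi> v \<in> filt Bs j}" for j
  have \<phi>D: "linear_on vdmul vdmul ?VA \<phi>" by (rule linear_on_dmul[OF \<phi>(1)])
  have VAD: "submod vdmul ?VA" by (rule submod_dmul[OF VA])
  have filtV: "filt Ls j \<subseteq> dsum (map ser Ls)" for Ls j by (auto simp: filt_def)
  have filtA: "submod vdmul (filt As j)" for j by (rule submod_filt[OF As])
  have filtB: "submod vdmul (filt Bs j)" for j by (rule submod_filt[OF Bs])
  have shiftA: "shift k ` filt As j = filt As (j + k)" for k j by (rule shift_filt[OF As])
  have shiftB: "shift k ` filt Bs j = filt Bs (j + k)" for k j by (rule shift_filt[OF Bs])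
  have G_sub: "submod vdmul (G j)" for j
    using submodD[OF VAD] submodD[OF filtB[of j]] linear_onD[OF \<phi>D] DV.linear_on_zero[OF \<phi>D VAD]
    unfolding submod_def G_def by simp
  have G_img: "\<phi> ` G j = filt Bs j" for j
  proof (intro equalityI subsetI)
    fix w assume w: "w \<in> filt Bs j"
    then have "w \<in> ?VB" using filtV by blast
    from \<psi>\<phi>[OF this] show "w \<in> \<phi> ` G j" using w
      by (intro image_eqI[of _ _ "\<psi> w"]) (auto simp: G_def)
  qed (auto simp: G_def)
  \<comment> \<open>The isomorphism maps \<open>F\<^sub>j\<close> into the second filtration with index shifted by \<open>c\<close>, hence
    \<open>F\<^sub>m\<close> into its member at \<open>0\<close>.\<close>
  define m where "m = - c"
  have sub1: "filt As m \<subseteq> G 0" using c[of m] filtV by (auto simp: G_def m_def)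
  have sub2: "G 0 \<subseteq> filt As c'" using c'[of 0] \<phi>\<psi>(2) by (force simp: G_def)
  define a where "a = min c' m"
  have "\<exists>Is. flag (*) vdmul (filt As a) (filt As m) Is"
    by (rule flag_filt[OF As]) (auto simp: a_def)
  then obtain Is where Is: "flag (*) vdmul (filt As a) (filt As m) Is" by blast
  have "G 0 \<subseteq> filt As a" using sub2 filt_antimono[of a c' As] by (auto simp: a_def)
  then obtain Qs where Qs: "flag (*) vdmul (G 0) (filt As m) Qs" "\<forall>Q\<in>set Qs. submod (*) Q \<and> Q \<noteq> {0}"
    using DV.flag_submodule[OF Is filtA G_sub sub1] by blast
  have Qnz: "nonzero_ideal Q" if "Q \<in> set Qs" for Q using Qs(2) that
    by (simp add: nonzero_ideal_def)
  have flag1: "flag (*) vdmul (G 0) (filt As (m + 1)) (Qs @ twist (- m) As)"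
    by (rule DV.flag_append[OF Qs(1) flag_filt_step[OF As]])
  have G1: "{v \<in> G 0. \<phi> v \<in> filt Bs (0 + 1)} = G 1"
    using filt_antimono[of 0 1 Bs] by (auto simp: G_def)
  have "linear_on vdmul vdmul (G 0) \<phi>"
    by (rule linear_on_subset[OF \<phi>D]) (auto simp: G_def)
  then have "flag (*) vdmul (G 0) {v \<in> G 0. \<phi> v \<in> filt Bs (0 + 1)} (twist (- 0) Bs)"
    by (rule flag_graded[OF _ G_img[of 0] Bs])
  then have G01: "flag (*) vdmul (G 0) (G 1) (twist (- 0) Bs)" unfolding G1 .
  have shiftG: "shift 1 ` G 0 = G 1"
  proof -
    have \<phi>shift: "\<phi> (shift k v) = shift k (\<phi> v)" "shift k v \<in> ?VA" if "v \<in> ?VA" for k v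
      using linear_onD(2)[OF \<phi>(1) that] submodD(3)[OF VA that] by (simp_all add: shift_def)
    have *: "shift k v \<in> G (j + k)" if "v \<in> G j" for k j v
      using that \<phi>shift shiftB[of k j] by (auto simp: G_def)
    show ?thesis
    proof (intro equalityI subsetI)
      fix v assume "v \<in> G 1"
      then have "shift (- 1) v \<in> G 0" using *[of v 1 "- 1"] by simp
      then show "v \<in> shift 1 ` G 0" by (intro image_eqI[of _ _ "shift (- 1) v"]) simp_all
    qed (use *[of _ 0 1] in auto)
  qed
  have "flag (*) vdmul (G 1) (filt As (m + 1)) (twist (- 1) Qs)"
    using flag_shift[OF Qs(1)] unfolding shiftG shiftA .
  with G01 have flag2: "flag (*) vdmul (G 0) (filt As (m + 1)) (twist (- 0) Bs @ twist (- 1) Qs)"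
    by (rule DV.flag_append)
  have nz1: "nonzero_ideal I" if "I \<in> set (Qs @ twist (- m) As)" for I
    using that Qnz As nonzero_ideal_spow by auto
  have nz2: "nonzero_ideal I" if "I \<in> set (twist (- 0) Bs @ twist (- 1) Qs)" for I
    using that Qnz Bs nonzero_ideal_spow by fastforce
  have D: "dsum_iso (Qs @ twist (- m) As) (twist (- 0) Bs @ twist (- 1) Qs)"
  proof (rule DV.flags_isomorphic[OF G_sub flag1 _ flag2])
    show "has_dual_basis (*) I" if "I \<in> set (Qs @ twist (- m) As)" for I
      by (rule dual_basis[OF nz1[OF that]])
    show "has_dual_basis (*) I" if "I \<in> set (twist (- 0) Bs @ twist (- 1) Qs)" for I
      by (rule dual_basis[OF nz2[OF that]])
  qed
  have "length (Qs @ twist (- m) As) = length (twist (- 0) Bs @ twist (- 1) Qs)"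
    by (rule dsum_isoD(1)[OF D nz1 nz2])
  then show "length As = length Bs" by simp
  have 0: "ideal_equiv (iprods (Qs @ twist (- m) As)) (iprods (twist (- 0) Bs @ twist (- 1) Qs))"
    by (rule dsum_isoD(2)[OF D nz1 nz2])
  have 1: "ideal_equiv (iprod (iprods Qs) (iprods As)) (iprods (Qs @ twist (- m) As))"
    unfolding iprods_append
    by (intro ideal_equiv_iprod ideal_equiv_refl ideal_equiv_sym[OF iprods_twist[OF triv]] As)
  have 2: "ideal_equiv (iprods (twist (- 0) Bs @ twist (- 1) Qs)) (iprod (iprods Bs) (iprods Qs))"
    unfolding iprods_append by (intro ideal_equiv_iprod iprods_twist[OF triv] Bs Qnz)
  have "ideal_equiv (iprod (iprods Qs) (iprods As)) (iprod (iprods Qs) (iprods Bs))"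
    using ideal_equiv_trans[OF 1 ideal_equiv_trans[OF 0 2]]
    by (simp add: iprod_commute)
  moreover have "nonzero_ideal (iprods Qs)" by (rule nonzero_ideal_iprods[OF Qnz])
  ultimately show "ideal_equiv (iprods As) (iprods Bs)"
    using ideal_equiv_cancel submod_iprods by blast
qed

end

section \<open>Finitely generated projective modules\<close>

lemma (in right_module) finsum_closed_subset:
  assumes "finite A" "g \<in> A \<rightarrow> K" "K \<subseteq> carrier M" "\<zero>\<^bsub>M\<^esub> \<in> K"
    and "\<And>x y. x \<in> K \<Longrightarrow> y \<in> K \<Longrightarrow> x \<oplus>\<^bsub>M\<^esub> y \<in> K"
  shows "finsum M g A \<in> K"
  using assms(1,2)
proof (induction A rule: finite_induct)
  case empty
  then show ?case using assms(4) by simp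
next
  case (insert a A)
  have "g \<in> A \<rightarrow> carrier M" "g a \<in> carrier M" using insert.prems assms(3) by auto
  then have "finsum M g (insert a A) = g a \<oplus>\<^bsub>M\<^esub> finsum M g A"
    using insert.hyps by (simp add: M.finsum_insert)
  then show ?case using insert assms(5) by auto
qed

text \<open>A projective module is contained in a free one, and the images of finitely many generators
involve only finitely many basis elements.\<close>
lemma finitely_generated_projective_embeds:
  fixes R :: "('r, 'x) ring_scheme" and M :: "('r, 'm, 'y) rmodule_scheme"
  assumes R: "ring R" and M: "right_module R M" and fg: "rmod_finitely_generated R M"
    and pr: "rmod_projective R M"
  shows "\<exists>(k::nat) E. (\<forall>x\<in>carrier M. \<forall>i. E x i \<in> carrier R \<and> (i \<ge> k \<longrightarrow> E x i = \<zero>\<^bsub>R\<^esub>)) \<and>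
    inj_on E (carrier M) \<and>
    (\<forall>x\<in>carrier M. \<forall>y\<in>carrier M. E (x \<oplus>\<^bsub>M\<^esub> y) = (\<lambda>i. E x i \<oplus>\<^bsub>R\<^esub> E y i)) \<and>
    (\<forall>x\<in>carrier M. \<forall>a\<in>carrier R. E (x \<star>\<^bsub>M\<^esub> a) = (\<lambda>i. E x i \<otimes>\<^bsub>R\<^esub> a))"
proof -
  interpret right_module R M by fact
  obtain I :: "'m set" and Q :: "('r, 'm \<Rightarrow> 'r) rmodule" where Q: "right_module R Q"
    and iso: "rmod_isomorphic R (rmod_sum M Q) (rmod_free R I)"
    using pr unfolding rmod_projective_def by blast
  interpret Q: right_module R Q by fact
  obtain g where g: "g \<in> rmod_hom R (rmod_sum M Q) (rmod_free R I)"
      and bij: "bij_betw g (carrier (rmod_sum M Q)) (carrier (rmod_free R I))"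
    using iso unfolding rmod_isomorphic_def by blast
  have zero_act: "\<zero>\<^bsub>Q\<^esub> \<star>\<^bsub>Q\<^esub> a = \<zero>\<^bsub>Q\<^esub>" if "a \<in> carrier R" for a
  proof -
    have c: "\<zero>\<^bsub>Q\<^esub> \<star>\<^bsub>Q\<^esub> a \<in> carrier Q" using Q.ract_closed[OF _ that] by simp
    have "\<zero>\<^bsub>Q\<^esub> \<star>\<^bsub>Q\<^esub> a \<oplus>\<^bsub>Q\<^esub> \<zero>\<^bsub>Q\<^esub> \<star>\<^bsub>Q\<^esub> a = \<zero>\<^bsub>Q\<^esub> \<star>\<^bsub>Q\<^esub> a"
      using Q.ract_add_left[of "\<zero>\<^bsub>Q\<^esub>" "\<zero>\<^bsub>Q\<^esub>" a] that by simp
    then show ?thesis using c by (metis Q.M.add.r_cancel_one')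
  qed
  define e where "e x = g (x, \<zero>\<^bsub>Q\<^esub>)" for x
  have mem: "(x, \<zero>\<^bsub>Q\<^esub>) \<in> carrier (rmod_sum M Q)" if "x \<in> carrier M" for x
    using that by (simp add: rmod_sum_def)
  have e_mem: "e x \<in> carrier (rmod_free R I)" if "x \<in> carrier M" for x
    using g mem[OF that] unfolding rmod_hom_def e_def by blast
  have e_val: "e x i \<in> carrier R" if "x \<in> carrier M" "i \<in> I" for x i
    using e_mem[OF that(1)] that(2) by (auto simp: rmod_free_def)
  have e_add: "e (x \<oplus>\<^bsub>M\<^esub> y) = (\<lambda>i\<in>I. e x i \<oplus>\<^bsub>R\<^esub> e y i)" if "x \<in> carrier M" "y \<in> carrier M" for x y
  proof -
    have "g ((x, \<zero>\<^bsub>Q\<^esub>) \<oplus>\<^bsub>rmod_sum M Q\<^esub> (y, \<zero>\<^bsub>Q\<^esub>)) = g (x, \<zero>\<^bsub>Q\<^esub>) \<oplus>\<^bsub>rmod_free R I\<^esub> g (y, \<zero>\<^bsub>Q\<^esub>)"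
      using g mem[OF that(1)] mem[OF that(2)] unfolding rmod_hom_def by blast
    then show ?thesis by (simp add: e_def rmod_sum_def rmod_free_def)
  qed
  have e_act: "e (x \<star>\<^bsub>M\<^esub> a) = (\<lambda>i\<in>I. e x i \<otimes>\<^bsub>R\<^esub> a)" if "x \<in> carrier M" "a \<in> carrier R" for x a
  proof -
    have "g ((x, \<zero>\<^bsub>Q\<^esub>) \<star>\<^bsub>rmod_sum M Q\<^esub> a) = g (x, \<zero>\<^bsub>Q\<^esub>) \<star>\<^bsub>rmod_free R I\<^esub> a"
      using g mem[OF that(1)] that(2) unfolding rmod_hom_def by blast
    then show ?thesis using zero_act[OF that(2)] by (simp add: e_def rmod_sum_def rmod_free_def)
  qed
  obtain S where S: "finite S" "S \<subseteq> carrier M"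
      "\<And>x. x \<in> carrier M \<Longrightarrow> \<exists>a\<in>S \<rightarrow> carrier R. x = finsum M (\<lambda>s. s \<star>\<^bsub>M\<^esub> a s) S"
    using fg unfolding rmod_finitely_generated_def by blast
  define J where "J = (\<Union>s\<in>S. {i \<in> I. e s i \<noteq> \<zero>\<^bsub>R\<^esub>})"
  have finJ: "finite J"
    unfolding J_def using S(1,2) e_mem by (auto simp: rmod_free_def)
  have JI: "J \<subseteq> I" by (auto simp: J_def)
  \<comment> \<open>The elements supported on \<open>J\<close> form a submodule that contains the generators.\<close>
  define K where "K = {x \<in> carrier M. \<forall>i\<in>I - J. e x i = \<zero>\<^bsub>R\<^esub>}"
  have K_add: "x \<oplus>\<^bsub>M\<^esub> y \<in> K" if "x \<in> K" "y \<in> K" for x y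
    using that by (simp add: K_def e_add)
  have K_act: "s \<star>\<^bsub>M\<^esub> a \<in> K" if "s \<in> S" "a \<in> carrier R" for s a
    using that S(2) ract_closed by (auto simp: K_def e_act J_def)
  have K_zero: "\<zero>\<^bsub>M\<^esub> \<in> K"
  proof -
    have "e \<zero>\<^bsub>M\<^esub> i = \<zero>\<^bsub>R\<^esub>" if "i \<in> I" for i
    proof -
      have "e \<zero>\<^bsub>M\<^esub> i = e \<zero>\<^bsub>M\<^esub> i \<oplus>\<^bsub>R\<^esub> e \<zero>\<^bsub>M\<^esub> i"
        using fun_cong[OF e_add[OF M.zero_closed M.zero_closed], of i] that by simp
      then show ?thesis using e_val[OF M.zero_closed that] by (metis R.add.r_cancel_one')
    qed
    then show ?thesis by (simp add: K_def)
  qed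
  have all_K: "x \<in> K" if x: "x \<in> carrier M" for x
  proof -
    obtain a where a: "a \<in> S \<rightarrow> carrier R" "x = finsum M (\<lambda>s. s \<star>\<^bsub>M\<^esub> a s) S" using S(3)[OF x]
      by blast
    show ?thesis unfolding a(2)
      by (rule finsum_closed_subset[OF S(1) _ _ K_zero K_add]) (use a(1) K_act in \<open>auto simp: K_def\<close>)
  qed
  obtain t where t: "bij_betw t {..<card J} J"
    using ex_bij_betw_nat_finite[OF finJ] by (auto simp: atLeast0LessThan)
  define k where "k = card J"
  define E where "E x = (\<lambda>i. if i < k then e x (t i) else \<zero>\<^bsub>R\<^esub>)" for x
  have tJ: "t i \<in> I" if "i < k" for i using t that JI by (auto simp: bij_betw_def k_def)
  have "inj_on E (carrier M)"
  proof (rule inj_onI)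
    fix x y assume xy: "x \<in> carrier M" "y \<in> carrier M" "E x = E y"
    have "e x i = e y i" if "i \<in> I" for i
    proof (cases "i \<in> J")
      case True
      then obtain l where l: "l < k" "i = t l" using t by (auto simp: bij_betw_def k_def)
      then show ?thesis using fun_cong[OF xy(3), of l] by (simp add: E_def)
    next
      case False
      then show ?thesis using all_K[OF xy(1)] all_K[OF xy(2)] that by (simp add: K_def)
    qed
    moreover have "e x i = e y i" if "i \<notin> I" for i
      using e_mem[OF xy(1)] e_mem[OF xy(2)] that
      by (auto simp: rmod_free_def PiE_iff extensional_def)
    ultimately have "e x = e y" by blast
    then have "(x, \<zero>\<^bsub>Q\<^esub>) = (y, \<zero>\<^bsub>Q\<^esub>)"
      using bij mem[OF xy(1)] mem[OF xy(2)] unfolding e_def bij_betw_def inj_on_def by blast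
    then show "x = y" by simp
  qed
  moreover have "E x i \<in> carrier R \<and> (i \<ge> k \<longrightarrow> E x i = \<zero>\<^bsub>R\<^esub>)" if "x \<in> carrier M" for x i
    using e_val[OF that] tJ by (simp add: E_def)
  moreover have "E (x \<oplus>\<^bsub>M\<^esub> y) = (\<lambda>i. E x i \<oplus>\<^bsub>R\<^esub> E y i)" if "x \<in> carrier M" "y \<in> carrier M" for x y
    using e_add[OF that] tJ by (auto simp: E_def fun_eq_iff)
  moreover have "E (x \<star>\<^bsub>M\<^esub> a) = (\<lambda>i. E x i \<otimes>\<^bsub>R\<^esub> a)" if "x \<in> carrier M" "a \<in> carrier R" for x a
    using e_act[OF that] tJ that by (auto simp: E_def fun_eq_iff)
  ultimately show ?thesis by (intro exI[of _ k] exI[of _ E]) blast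
qed

context skew_dedekind
begin

abbreviation SL :: "'a fls ring" where "SL \<equiv> skew_laurent \<sigma>"

lemma SL_simps [simp]: "carrier SL = UNIV" "x \<otimes>\<^bsub>SL\<^esub> y = smul x y" "x \<oplus>\<^bsub>SL\<^esub> y = x + y"
  "\<zero>\<^bsub>SL\<^esub> = 0"
  by (simp_all add: skew_laurent_def)

definition coordinates :: "('a fls, 'm, 'y) rmodule_scheme \<Rightarrow> 'a set list \<Rightarrow> ('m \<Rightarrow> nat \<Rightarrow> 'a fls) \<Rightarrow> bool" where
  "coordinates M Ls e \<longleftrightarrow> (\<forall>L\<in>set Ls. nonzero_ideal L) \<and> bij_betw e (carrier M) (dsum (map ser Ls)) \<and>
     (\<forall>x\<in>carrier M. \<forall>y\<in>carrier M. e (x \<oplus>\<^bsub>M\<^esub> y) = e x + e y) \<and>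
     (\<forall>x\<in>carrier M. \<forall>a. e (x \<star>\<^bsub>M\<^esub> a) = vmul (e x) a)"

lemma coordinatesD:
  assumes "coordinates M Ls e"
  shows "\<And>L. L \<in> set Ls \<Longrightarrow> nonzero_ideal L" "bij_betw e (carrier M) (dsum (map ser Ls))"
    "x \<in> carrier M \<Longrightarrow> e x \<in> dsum (map ser Ls)"
    "x \<in> carrier M \<Longrightarrow> y \<in> carrier M \<Longrightarrow> e (x \<oplus>\<^bsub>M\<^esub> y) = e x + e y"
    "x \<in> carrier M \<Longrightarrow> e (x \<star>\<^bsub>M\<^esub> a) = vmul (e x) a"
  using assms by (auto simp: coordinates_def bij_betw_def)

lemma exists_coordinates:
  assumes M: "right_module SL M" and fg: "rmod_finitely_generated SL M"
    and pr: "rmod_projective SL M"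
  shows "\<exists>Ls e. coordinates M Ls e"
proof -
  interpret right_module SL M by fact
  obtain k :: nat and E where E0: "\<forall>x\<in>carrier M. \<forall>i. E x i \<in> carrier SL \<and> (i \<ge> k \<longrightarrow> E x i = \<zero>\<^bsub>SL\<^esub>)"
    "inj_on E (carrier M)"
    "\<forall>x\<in>carrier M. \<forall>y\<in>carrier M. E (x \<oplus>\<^bsub>M\<^esub> y) = (\<lambda>i. E x i \<oplus>\<^bsub>SL\<^esub> E y i)"
    "\<forall>x\<in>carrier M. \<forall>a\<in>carrier SL. E (x \<star>\<^bsub>M\<^esub> a) = (\<lambda>i. E x i \<otimes>\<^bsub>SL\<^esub> a)"
    using finitely_generated_projective_embeds[OF R.ring_axioms M fg pr] by blast
  have E: "x \<in> carrier M \<Longrightarrow> i \<ge> k \<Longrightarrow> E x i = 0" "inj_on E (carrier M)"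
    "x \<in> carrier M \<Longrightarrow> y \<in> carrier M \<Longrightarrow> E (x \<oplus>\<^bsub>M\<^esub> y) = E x + E y"
    "x \<in> carrier M \<Longrightarrow> E (x \<star>\<^bsub>M\<^esub> a) = vmul (E x) a" for x y i a
    using E0 by (simp_all add: fun_eq_iff pointwise_def)
  let ?W = "E ` carrier M"
  have "submod vmul ?W" unfolding submod_def
  proof (intro conjI ballI allI)
    have "E \<zero>\<^bsub>M\<^esub> + E \<zero>\<^bsub>M\<^esub> = E \<zero>\<^bsub>M\<^esub>" using E(3)[of "\<zero>\<^bsub>M\<^esub>" "\<zero>\<^bsub>M\<^esub>"] by simp
    then have "E \<zero>\<^bsub>M\<^esub> = 0" by (metis add_cancel_left_left)
    then show "0 \<in> ?W" by (metis M.zero_closed imageI)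
    fix u assume "u \<in> ?W"
    then obtain x where x: "x \<in> carrier M" "u = E x" by blast
    have "E (x \<star>\<^bsub>M\<^esub> a) \<in> ?W" for a using ract_closed[OF x(1)] by simp
    then show "vmul u a \<in> ?W" for a using E(4)[OF x(1)] x(2) by simp
    fix v assume "v \<in> ?W"
    then obtain y where y: "y \<in> carrier M" "v = E y" by blast
    have "E (x \<oplus>\<^bsub>M\<^esub> y) \<in> ?W" using x y by simp
    then show "u + v \<in> ?W" using E(3) x y by simp
  qed
  then have "\<exists>Ls. (\<forall>L\<in>set Ls. nonzero_ideal L) \<and>
      isomorphic_submods vmul vmul ?W (dsum (map ser Ls))"
    by (rule submodule_of_free[where k = k]) (use E(1) in auto)
  then obtain Ls f where Ls: "\<forall>L\<in>set Ls. nonzero_ideal L"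
    and f: "linear_on vmul vmul ?W f" "bij_betw f ?W (dsum (map ser Ls))"
    by (auto simp: isomorphic_submods_def)
  have "bij_betw (\<lambda>x. f (E x)) (carrier M) (dsum (map ser Ls))"
    using bij_betw_trans[OF inj_on_imp_bij_betw[OF E(2)] f(2)] by (simp add: comp_def)
  then have "coordinates M Ls (\<lambda>x. f (E x))"
    using Ls E(3,4) linear_onD[OF f(1)] by (simp add: coordinates_def)
  then show ?thesis by blast
qed

lemma coordinates_sum_free:
  assumes e: "coordinates M Ls e"
  shows "\<exists>e'. coordinates (rmod_sum M (rmod_free SL {..<n})) (Ls @ replicate n UNIV) e'"
proof -
  let ?r = "length Ls" and ?F = "rmod_free SL {..<n}"
  note Ls = coordinatesD(1)[OF e] and bij = coordinatesD(2)[OF e]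
    and add = coordinatesD(4)[OF e] and act = coordinatesD(5)[OF e]
  have carrier_F: "carrier ?F = {..<n} \<rightarrow>\<^sub>E UNIV" by (simp add: rmod_free_def)
  have dsum_iff: "v \<in> dsum (map ser (Ls @ replicate n UNIV)) \<longleftrightarrow>
      (\<forall>i<?r. v i \<in> ser (Ls ! i)) \<and> (\<forall>i\<ge>?r + n. v i = 0)" for v
    by (auto simp: dsum_def nth_append)
  have e_mem: "e x \<in> dsum (map ser Ls)" if "x \<in> carrier M" for x using that bij
    by (auto simp: bij_betw_def)
  have e_val: "e x i \<in> ser (Ls ! i)" if "x \<in> carrier M" "i < ?r" for x i
    using e_mem[OF that(1)] that(2) by (simp add: dsum_def)
  have tail: "i - ?r < n" if "i < ?r + n" "\<not> i < ?r" for i using that by linarith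
  define d where "d p = (\<lambda>i. if i < ?r then e (fst p) i else if i < ?r + n then snd p (i - ?r) else 0)" for p
  define e' where "e' = inv_into (carrier M) e"
  have e': "e' v \<in> carrier M" "e (e' v) = v" if "v \<in> dsum (map ser Ls)" for v
    using that bij by (auto simp: e'_def bij_betw_def f_inv_into_f inv_into_into)
  have e'e: "e' (e x) = x" if "x \<in> carrier M" for x using that bij
    by (auto simp: e'_def bij_betw_def)
  define d' where "d' v = (e' (\<lambda>i. if i < ?r then v i else 0), \<lambda>i\<in>{..<n}. v (i + ?r))" for v
  have "bij_betw d (carrier M \<times> ({..<n} \<rightarrow>\<^sub>E UNIV)) (dsum (map ser (Ls @ replicate n UNIV)))"
  proof (rule bij_betw_byWitness[where f' = d'])
    show "\<forall>p\<in>carrier M \<times> ({..<n} \<rightarrow>\<^sub>E UNIV). d' (d p) = p"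
    proof
      fix p assume p: "p \<in> carrier M \<times> ({..<n} \<rightarrow>\<^sub>E (UNIV :: 'a fls set))"
      then obtain x w where xw: "p = (x, w)" "x \<in> carrier M" "w \<in> {..<n} \<rightarrow>\<^sub>E UNIV" by auto
      have "(\<lambda>i. if i < ?r then d p i else 0) = e x"
        using e_mem[OF xw(2)] by (auto simp: d_def xw dsum_def fun_eq_iff)
      moreover have "(\<lambda>i\<in>{..<n}. d p (i + ?r)) = w"
        using xw(3) by (auto simp: d_def xw fun_eq_iff PiE_iff extensional_def)
      ultimately have "d' (d p) = (e' (e x), w)" unfolding d'_def by simp
      then show "d' (d p) = p" using e'e[OF xw(2)] xw(1) by simp
    qed
    have cut: "(\<lambda>i. if i < ?r then v i else 0) \<in> dsum (map ser Ls)"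
      if "v \<in> dsum (map ser (Ls @ replicate n UNIV))" for v
      using that unfolding dsum_iff by (simp add: dsum_def)
    show "\<forall>v\<in>dsum (map ser (Ls @ replicate n UNIV)). d (d' v) = v"
    proof
      fix v assume v: "v \<in> dsum (map ser (Ls @ replicate n UNIV))"
      show "d (d' v) = v"
        using e'(2)[OF cut[OF v]] v unfolding dsum_iff by (auto simp: d_def d'_def fun_eq_iff)
    qed
    show "d ` (carrier M \<times> ({..<n} \<rightarrow>\<^sub>E UNIV)) \<subseteq> dsum (map ser (Ls @ replicate n UNIV))"
    proof
      fix v assume "v \<in> d ` (carrier M \<times> ({..<n} \<rightarrow>\<^sub>E UNIV))"
      then obtain p where p: "p \<in> carrier M \<times> ({..<n} \<rightarrow>\<^sub>E UNIV)" "v = d p" by blast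
      show "v \<in> dsum (map ser (Ls @ replicate n UNIV))"
        unfolding dsum_iff p(2) using e_val p(1) by (auto simp: d_def)
    qed
    show "d' ` dsum (map ser (Ls @ replicate n UNIV)) \<subseteq> carrier M \<times> ({..<n} \<rightarrow>\<^sub>E UNIV)"
      using e'(1)[OF cut] by (auto simp: d'_def split: if_splits)
  qed
  moreover have "carrier (rmod_sum M ?F) = carrier M \<times> ({..<n} \<rightarrow>\<^sub>E UNIV)"
    by (simp add: rmod_sum_def carrier_F)
  moreover have "d (p \<oplus>\<^bsub>rmod_sum M ?F\<^esub> q) = d p + d q"
    if mem: "p \<in> carrier M \<times> ({..<n} \<rightarrow>\<^sub>E UNIV)" "q \<in> carrier M \<times> ({..<n} \<rightarrow>\<^sub>E UNIV)" for p q
  proof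
    fix i
    obtain x w y z where pq: "p = (x, w)" "q = (y, z)" "x \<in> carrier M" "y \<in> carrier M" using mem
      by auto
    have "p \<oplus>\<^bsub>rmod_sum M ?F\<^esub> q = (x \<oplus>\<^bsub>M\<^esub> y, \<lambda>i\<in>{..<n}. w i + z i)"
      by (simp add: pq rmod_sum_def rmod_free_def)
    then show "d (p \<oplus>\<^bsub>rmod_sum M ?F\<^esub> q) i = (d p + d q) i"
      using add[OF pq(3,4)] by (simp add: d_def pq tail)
  qed
  moreover have "d (p \<star>\<^bsub>rmod_sum M ?F\<^esub> a) = vmul (d p) a"
    if mem: "p \<in> carrier M \<times> ({..<n} \<rightarrow>\<^sub>E UNIV)" for p a
  proof
    fix i
    obtain x w where p: "p = (x, w)" "x \<in> carrier M" using mem by auto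
    have "p \<star>\<^bsub>rmod_sum M ?F\<^esub> a = (x \<star>\<^bsub>M\<^esub> a, \<lambda>i\<in>{..<n}. smul (w i) a)"
      by (simp add: p rmod_sum_def rmod_free_def)
    then show "d (p \<star>\<^bsub>rmod_sum M ?F\<^esub> a) i = vmul (d p) a i"
      using act[OF p(2), of a] by (simp add: d_def p pointwise_def tail)
  qed
  moreover have "\<forall>L\<in>set (Ls @ replicate n UNIV). nonzero_ideal L" using Ls by auto
  ultimately have "coordinates (rmod_sum M ?F) (Ls @ replicate n UNIV) d"
    by (simp add: coordinates_def del: set_append set_replicate map_append)
  then show ?thesis by blast
qed

lemma coordinates_isomorphicD:
  assumes M: "right_module SL M" and e: "coordinates M As e" and f: "coordinates N Bs f"
    and iso: "rmod_isomorphic SL M N"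
  shows "ser_iso As Bs"
proof -
  interpret right_module SL M by fact
  define e' where "e' = inv_into (carrier M) e"
  have e'_bij: "bij_betw e' (dsum (map ser As)) (carrier M)"
    unfolding e'_def by (rule bij_betw_inv_into[OF coordinatesD(2)[OF e]])
  have e': "e' v \<in> carrier M" "e (e' v) = v" if "v \<in> dsum (map ser As)" for v
    using that coordinatesD(2)[OF e] by (auto simp: e'_def bij_betw_def f_inv_into_f inv_into_into)
  have e'e: "e' (e x) = x" if "x \<in> carrier M" for x
    using that coordinatesD(2)[OF e] by (auto simp: e'_def bij_betw_def)
  obtain g where g: "g \<in> rmod_hom SL M N" "bij_betw g (carrier M) (carrier N)"
    using iso by (auto simp: rmod_isomorphic_def)
  have gN: "g x \<in> carrier N" if "x \<in> carrier M" for x using g(2) that by (auto simp: bij_betw_def)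
  have g_add: "g (x \<oplus>\<^bsub>M\<^esub> y) = g x \<oplus>\<^bsub>N\<^esub> g y" if "x \<in> carrier M" "y \<in> carrier M" for x y
    using g(1) that by (simp add: rmod_hom_def)
  have g_act: "g (x \<star>\<^bsub>M\<^esub> a) = g x \<star>\<^bsub>N\<^esub> a" if "x \<in> carrier M" for x a
    using g(1) that by (simp add: rmod_hom_def)
  have "bij_betw (\<lambda>v. f (g (e' v))) (dsum (map ser As)) (dsum (map ser Bs))"
    using bij_betw_trans[OF bij_betw_trans[OF e'_bij g(2)] coordinatesD(2)[OF f]]
    by (simp add: comp_def)
  moreover have "linear_on vmul vmul (dsum (map ser As)) (\<lambda>v. f (g (e' v)))"
  proof (rule linear_onI)
    fix u v assume uv: "u \<in> dsum (map ser As)" "v \<in> dsum (map ser As)"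
    have "e' (u + v) = e' u \<oplus>\<^bsub>M\<^esub> e' v"
      using e'e[of "e' u \<oplus>\<^bsub>M\<^esub> e' v"] coordinatesD(4)[OF e e'(1)[OF uv(1)] e'(1)[OF uv(2)]] e' uv
      by simp
    then show "f (g (e' (u + v))) = f (g (e' u)) + f (g (e' v))"
      using e'(1) uv g_add gN coordinatesD(4)[OF f] by simp
  next
    fix u a assume u: "u \<in> dsum (map ser As)"
    have "e' (vmul u a) = e' u \<star>\<^bsub>M\<^esub> a"
      using e'e[of "e' u \<star>\<^bsub>M\<^esub> a"] coordinatesD(5)[OF e e'(1)[OF u], of a] e' u ract_closed by simp
    then show "f (g (e' (vmul u a))) = vmul (f (g (e' u))) a"
      using e'(1) u g_act gN coordinatesD(5)[OF f] by simp
  qed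
  ultimately show ?thesis by (auto simp: isomorphic_submods_def)
qed

lemma coordinates_isomorphicI:
  assumes M: "right_module SL M" and N: "right_module SL N" and e: "coordinates M As e"
    and f: "coordinates N Bs f"
    and iso: "ser_iso As Bs"
  shows "rmod_isomorphic SL M N"
proof -
  interpret right_module SL N by fact
  obtain h where h: "linear_on vmul vmul (dsum (map ser As)) h"
    "bij_betw h (dsum (map ser As)) (dsum (map ser Bs))"
    using iso by (auto simp: isomorphic_submods_def)
  define f' where "f' = inv_into (carrier N) f"
  have f'_bij: "bij_betw f' (dsum (map ser Bs)) (carrier N)"
    unfolding f'_def by (rule bij_betw_inv_into[OF coordinatesD(2)[OF f]])
  have f': "f' v \<in> carrier N" "f (f' v) = v" if "v \<in> dsum (map ser Bs)" for v
    using that coordinatesD(2)[OF f] by (auto simp: f'_def bij_betw_def f_inv_into_f inv_into_into)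
  have f_inj: "x = y" if "f x = f y" "x \<in> carrier N" "y \<in> carrier N" for x y
    using that coordinatesD(2)[OF f] by (auto simp: bij_betw_def inj_on_def)
  define g where "g x = f' (h (e x))" for x
  have h_mem: "h v \<in> dsum (map ser Bs)" if "v \<in> dsum (map ser As)" for v
    using that h(2) by (auto simp: bij_betw_def)
  have gN: "g x \<in> carrier N" "f (g x) = h (e x)" if "x \<in> carrier M" for x
    using f' h_mem coordinatesD(3)[OF e that] by (simp_all add: g_def)
  have bij: "bij_betw g (carrier M) (carrier N)"
    using bij_betw_trans[OF bij_betw_trans[OF coordinatesD(2)[OF e] h(2)] f'_bij]
    by (simp add: comp_def g_def[abs_def])
  interpret M': right_module SL M by fact
  have closed: "x \<oplus>\<^bsub>M\<^esub> y \<in> carrier M" "x \<star>\<^bsub>M\<^esub> a \<in> carrier M" if "x \<in> carrier M" "y \<in> carrier M"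
    for x y a
    using that M'.ract_closed by simp_all
  have "g (x \<oplus>\<^bsub>M\<^esub> y) = g x \<oplus>\<^bsub>N\<^esub> g y" if x: "x \<in> carrier M" and y: "y \<in> carrier M" for x y
    by (rule f_inj)
      (use x y closed gN coordinatesD(4)[OF f] coordinatesD(3,4)[OF e] linear_onD(1)[OF h(1)] in simp_all)
  moreover have "g (x \<star>\<^bsub>M\<^esub> a) = g x \<star>\<^bsub>N\<^esub> a" if x: "x \<in> carrier M" for x a
    by (rule f_inj)
      (use x closed gN coordinatesD(5)[OF f] coordinatesD(3,5)[OF e] linear_onD(2)[OF h(1)] ract_closed in simp_all)
  ultimately have "g \<in> rmod_hom SL M N" using gN(1) by (auto simp: rmod_hom_def)
  then show ?thesis using bij by (auto simp: rmod_isomorphic_def)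
qed

end

theorem theorem2:
  fixes \<sigma> :: "'a::idom \<Rightarrow> 'a"
    and M :: "('a fls, 'm) rmodule"
    and N :: "('a fls, 'n) rmodule"
  assumes "dedekind_domain TYPE('a)"
    and "ring_automorphism \<sigma>"
    and "acts_trivially_on_class_group \<sigma>"
    and "right_module (skew_laurent \<sigma>) M"
    and "rmod_finitely_generated (skew_laurent \<sigma>) M"
    and "rmod_projective (skew_laurent \<sigma>) M"
    and "right_module (skew_laurent \<sigma>) N"
    and "rmod_finitely_generated (skew_laurent \<sigma>) N"
    and "rmod_projective (skew_laurent \<sigma>) N"
    and "rmod_stably_isomorphic (skew_laurent \<sigma>) M N"
  shows "rmod_isomorphic (skew_laurent \<sigma>) M N"
proof -
  interpret skew_dedekind "TYPE('a)" \<sigma> by unfold_locales (use assms(1,2) in auto)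
  obtain As e where e: "coordinates M As e" using exists_coordinates[OF assms(4-6)] by blast
  obtain Bs f where f: "coordinates N Bs f" using exists_coordinates[OF assms(7-9)] by blast
  obtain n :: nat where iso: "rmod_isomorphic SL (rmod_sum M (rmod_free SL {..<n})) (rmod_sum N (rmod_free SL {..<n}))"
    using assms(10) by (auto simp: rmod_stably_isomorphic_def)
  obtain e' where e': "coordinates (rmod_sum M (rmod_free SL {..<n})) (As @ replicate n UNIV) e'"
    using coordinates_sum_free[OF e] by blast
  obtain f' where f': "coordinates (rmod_sum N (rmod_free SL {..<n})) (Bs @ replicate n UNIV) f'"
    using coordinates_sum_free[OF f] by blast
  have "right_module SL (rmod_sum M (rmod_free SL {..<n}))"
    by (rule right_module_rmod_sum[OF assms(4) right_module_rmod_free[OF ring_skew_laurent[OF assms(2)]]])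
  note stable = coordinates_isomorphicD[OF this e' f' iso]
  have len: "length (As @ replicate n UNIV) = length (Bs @ replicate n UNIV)"
    by (rule isomorphic_dsum_serD(1)[OF assms(3) stable coordinatesD(1)[OF e'] coordinatesD(1)[OF f']])
  have eq: "ideal_equiv (iprods (As @ replicate n UNIV)) (iprods (Bs @ replicate n UNIV))"
    by (rule isomorphic_dsum_serD(2)[OF assms(3) stable coordinatesD(1)[OF e'] coordinatesD(1)[OF f']])
  have "iprods (replicate n UNIV) = (UNIV :: 'a set)"
    by (induction n) (simp_all add: iprod_UNIV)
  then have "ideal_equiv (iprods As) (iprods Bs)"
    using eq by (simp add: iprods_append iprod_UNIV submod_iprods)
  then have "dsum_iso As Bs"
    using len by (intro dsum_isoI coordinatesD(1)[OF e] coordinatesD(1)[OF f]) simp_all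
  from dsum_iso_ser[OF this coordinatesD(1)[OF e] coordinatesD(1)[OF f]]
  have "ser_iso As Bs" by simp
  then show ?thesis by (rule coordinates_isomorphicI[OF assms(4,7) e f])
qed

end
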